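(* Let $0<L_1,L_2<2\pi$. There exists $\delta>0$ such that the following holds: if $\phi_0\in L^2(\mathbb{T}^2)$ satisfies $\|\mathbb{P}\phi_0\|_{L^2}<\delta$, then for any $T>0$ there exists a mild solution on $[0,T]$, with initial data $\phi_0$, of the Kuramoto–Sivashinsky equation $$\partial_t\phi+\tfrac12|\nabla\phi|^2=-\Delta^2\phi-\Delta\phi .$$
   Context: $\mathbb{T}^2=[0,L_1]\times[0,L_2]$ with periodic boundary conditions. $\mathbb{P}f=f-\frac1{L_1L_2}\int_{\mathbb{T}^2}f\,dx$ is the projection onto mean-zero functions. $\mathcal{L}=\Delta^2+\Delta$, and $e^{-t\mathcal{L}}$ is the Fourier multiplier with symbol $e^{-t(|\tilde{\mathbf k}|^4-|\tilde{\mathbf k}|^2)}$, $\tilde{\mathbf k}=2\pi(k_1/L_1,k_2/L_2)$, $(k_1,k_2)\in\mathbb{Z}^2$ (also applied to $L^1$ functions for $t>0$). A mild solution on $[0,T]$ with initial data $\phi_0$ is a function $\phi\in C([0,T];L^2(\mathbb{T}^2))$ with $\nabla\phi$ locally integrable such that, for all $0\le t\le T$, $$\phi(t)=e^{-t\mathcal{L}}\phi_0-\frac12\int_0^te^{-(t-\tau)\mathcal{L}}|\nabla\phi(\tau)|^2\,d\tau$$ in $L^2(\mathbb{T}^2)$ (Bochner integral). *)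

theory Defs
  imports "HOL-Analysis.Analysis"
begin

section \<open>The torus, square integrability and the mean-zero projection\<close>

text \<open>
  Functions on the torus are represented by functions on the plane of which only the restriction to
  the fundamental domain matters, up to null sets; periodicity is carried by the Fourier modes
  and by the test functions below. Elements of \<open>L\<^sup>1\<close> and \<open>L\<^sup>2\<close> are represented by functions rather
  than by classes, so equality in \<open>L\<^sup>2\<close> is equality almost everywhere.
\<close>

definition torus_box :: "real \<Rightarrow> real \<Rightarrow> (real \<times> real) set" where
  "torus_box L1 L2 = {0..L1} \<times> {0..L2}"

definition torus :: "real \<Rightarrow> real \<Rightarrow> (real \<times> real) measure" where
  "torus L1 L2 = lebesgue_on (torus_box L1 L2)"

definition square_integrable :: "'a measure \<Rightarrow> ('a \<Rightarrow> real) \<Rightarrow> bool" where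
  "square_integrable M f \<longleftrightarrow> f \<in> borel_measurable M \<and> integrable M (\<lambda>x. (f x)\<^sup>2)"

text \<open>Meaningful for \<^term>\<open>square_integrable M f\<close> only.\<close>

definition L2norm :: "'a measure \<Rightarrow> ('a \<Rightarrow> real) \<Rightarrow> real" where
  "L2norm M f = sqrt (LINT x|M. (f x)\<^sup>2)"

definition mean_free :: "real \<Rightarrow> real \<Rightarrow> (real \<times> real \<Rightarrow> real) \<Rightarrow> real \<times> real \<Rightarrow> real" where
  "mean_free L1 L2 f = (\<lambda>x. f x - 1 / (L1 * L2) * (LINT y|torus L1 L2. f y))"

section \<open>The linear semigroup\<close>

definition wavevector :: "real \<Rightarrow> real \<Rightarrow> int \<times> int \<Rightarrow> real \<times> real" where
  "wavevector L1 L2 k = (2 * pi * (real_of_int (fst k) / L1), 2 * pi * (real_of_int (snd k) / L2))"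

definition fourier_coeff ::
    "real \<Rightarrow> real \<Rightarrow> (real \<times> real \<Rightarrow> real) \<Rightarrow> int \<times> int \<Rightarrow> complex" where
  "fourier_coeff L1 L2 f k =
     (LINT x|torus L1 L2. complex_of_real (f x) * cis (- (wavevector L1 L2 k \<bullet> x)))
       / complex_of_real (L1 * L2)"

text \<open>
  For \<open>t > 0\<close> and integrable \<open>f\<close> the series converges absolutely. It is real valued, because the
  symbol is even in \<open>k\<close>; \<open>Re\<close> only adjusts the type. At \<open>t = 0\<close> the operator is the
  identity; it is not used for \<open>t < 0\<close>.
\<close>

definition ks_semigroup ::
    "real \<Rightarrow> real \<Rightarrow> real \<Rightarrow> (real \<times> real \<Rightarrow> real) \<Rightarrow> real \<times> real \<Rightarrow> real" where
  "ks_semigroup L1 L2 t f =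
     (if t > 0 then
        (\<lambda>x. Re (\<Sum>\<^sub>\<infinity>k\<in>UNIV.
           complex_of_real
             (exp (- t * (norm (wavevector L1 L2 k) ^ 4 - norm (wavevector L1 L2 k) ^ 2)))
           * fourier_coeff L1 L2 f k * cis (wavevector L1 L2 k \<bullet> x)))
      else f)"

section \<open>Weak gradients\<close>

text \<open>
  The class of infinitely differentiable functions on the plane, as the greatest class of functions that
  are differentiable with both partial derivatives again in the class.
\<close>

coinductive smooth :: "(real \<times> real \<Rightarrow> real) \<Rightarrow> bool" where
  "(\<forall>x. (f has_derivative (\<lambda>h. fst h * p x + snd h * q x)) (at x)) \<Longrightarrow> smooth p \<Longrightarrow> smooth q
     \<Longrightarrow> smooth f"

definition torus_test_function :: "real \<Rightarrow> real \<Rightarrow> (real \<times> real \<Rightarrow> real) \<Rightarrow> bool" where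
  "torus_test_function L1 L2 \<psi> \<longleftrightarrow>
     smooth \<psi> \<and> (\<forall>x y. \<psi> (x + L1, y) = \<psi> (x, y) \<and> \<psi> (x, y + L2) = \<psi> (x, y))"

definition weak_gradient ::
    "real \<Rightarrow> real \<Rightarrow> (real \<times> real \<Rightarrow> real) \<Rightarrow> (real \<times> real \<Rightarrow> real \<times> real) \<Rightarrow> bool" where
  "weak_gradient L1 L2 f g \<longleftrightarrow>
     integrable (torus L1 L2) f \<and> integrable (torus L1 L2) g \<and>
     (\<forall>\<psi>. torus_test_function L1 L2 \<psi> \<longrightarrow>
        (\<forall>v. (LINT x|torus L1 L2. f x * frechet_derivative \<psi> (at x) v)
              = - (LINT x|torus L1 L2. (g x \<bullet> v) * \<psi> x)))"

section \<open>Bochner integrals with values in \<open>L\<^sup>2\<close>\<close>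

text \<open>
  \<open>L\<^sup>2\<close> is not a type here, so \<^const>\<open>has_bochner_integral\<close> does not apply. The following transcribes
  the library definition of \<^const>\<open>has_bochner_integral\<close> for functions from a finite
  measure space \<open>M\<close> into the functions square integrable on \<open>N\<close>, with the \<open>L\<^sup>2\<close> norm. The integrand
  need only take values in \<open>L\<^sup>2\<close> almost everywhere. Its strong measurability up to null sets follows
  from the approximation by simple functions.
\<close>

definition simple_L2_integral :: "'t measure \<Rightarrow> ('t \<Rightarrow> 'a \<Rightarrow> real) \<Rightarrow> 'a \<Rightarrow> real" where
  "simple_L2_integral M s = (\<lambda>x. \<Sum>y\<in>s ` space M. measure M {\<tau> \<in> space M. s \<tau> = y} * y x)"

definition has_L2_bochner_integral ::
    "'t measure \<Rightarrow> 'a measure \<Rightarrow> ('t \<Rightarrow> 'a \<Rightarrow> real) \<Rightarrow> ('a \<Rightarrow> real) \<Rightarrow> bool" where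
  "has_L2_bochner_integral M N F I \<longleftrightarrow>
     finite_measure M \<and>
     (AE \<tau> in M. square_integrable N (F \<tau>)) \<and>
     square_integrable N I \<and>
     (\<exists>s :: nat \<Rightarrow> 't \<Rightarrow> 'a \<Rightarrow> real.
        (\<forall>n. simple_function M (s n)) \<and>
        (\<forall>n. \<forall>\<tau>\<in>space M. square_integrable N (s n \<tau>)) \<and>
        (\<forall>n. (\<lambda>\<tau>. L2norm N (\<lambda>x. F \<tau> x - s n \<tau> x)) \<in> borel_measurable M) \<and>
        (\<lambda>n. \<integral>\<^sup>+\<tau>. ennreal (L2norm N (\<lambda>x. F \<tau> x - s n \<tau> x)) \<partial>M) \<longlonglongrightarrow> 0 \<and>
        (\<lambda>n. L2norm N (\<lambda>x. simple_L2_integral M (s n) x - I x)) \<longlonglongrightarrow> 0)"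

section \<open>Mild solutions of the Kuramoto--Sivashinsky equation\<close>

definition L2_continuous_on :: "'a measure \<Rightarrow> real set \<Rightarrow> (real \<Rightarrow> 'a \<Rightarrow> real) \<Rightarrow> bool" where
  "L2_continuous_on N S \<phi> \<longleftrightarrow>
     (\<forall>t\<in>S. square_integrable N (\<phi> t)) \<and>
     (\<forall>t\<in>S. ((\<lambda>s. L2norm N (\<lambda>x. \<phi> s x - \<phi> t x)) \<longlongrightarrow> 0) (at t within S))"

text \<open>
  \<open>G\<close> is the spatial distributional gradient of \<open>\<phi>\<close>, given as a jointly measurable function on
  \<open>[0,T] \<times> T\<^sup>2\<close>. This set is compact, so local integrability is integrability. The squared gradient
  is required to be integrable in space for almost every time, so that the semigroup can be applied
  to it.
\<close>

definition mild_solution ::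
    "real \<Rightarrow> real \<Rightarrow> real \<Rightarrow> (real \<times> real \<Rightarrow> real) \<Rightarrow> (real \<Rightarrow> real \<times> real \<Rightarrow> real) \<Rightarrow> bool" where
  "mild_solution L1 L2 T \<phi>0 \<phi> \<longleftrightarrow>
     L2_continuous_on (torus L1 L2) {0..T} \<phi> \<and>
     (\<exists>G :: real \<Rightarrow> real \<times> real \<Rightarrow> real \<times> real.
        integrable (lebesgue_on ({0..T} \<times> torus_box L1 L2)) (\<lambda>(\<tau>, x). G \<tau> x) \<and>
        (AE \<tau> in lebesgue_on {0..T}.
           weak_gradient L1 L2 (\<phi> \<tau>) (G \<tau>) \<and> integrable (torus L1 L2) (\<lambda>x. (norm (G \<tau> x))\<^sup>2)) \<and>
        (\<forall>t\<in>{0..T}. \<exists>I.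
           has_L2_bochner_integral (lebesgue_on {0..t}) (torus L1 L2)
             (\<lambda>\<tau>. ks_semigroup L1 L2 (t - \<tau>) (\<lambda>x. (norm (G \<tau> x))\<^sup>2)) I \<and>
           (AE x in torus L1 L2. \<phi> t x = ks_semigroup L1 L2 t \<phi>0 x - 1 / 2 * I x)))"

end

theory Submission
  imports Defs
begin

text \<open>
  The equation is solved in Fourier space. Write \<open>k\<close> for a nonzero wave vector of the torus. Both
  periods are below \<open>2 \<pi>\<close>, so \<open>|k| > 1\<close> with a uniform gap and the symbol of the linear operator
  satisfies \<open>|k|^4 - |k|^2 \<ge> gap * |k|^4\<close>: the linear flow damps every nonconstant mode, uniformly
  in time. The constant mode feels no damping, but only the gradient enters the nonlinearity, so
  it is slaved to the other modes. This is why only the mean-free part of the data has to be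
  small.

  For data in \<open>L\<^sup>2\<close> the linear flow satisfies \<open>|k| * |u_k(t)| \<le> e_k / t^(1/4)\<close> with \<open>e\<close> square
  summable. Consequently every Fourier coefficient of \<open>|\<nabla>u|\<^sup>2\<close>, being a convolution of two such
  sequences, is bounded by \<open>(sum of e_k^2) / sqrt t\<close>. Its Duhamel integral is at most a multiple
  of \<open>Phi k t\<close>, the Duhamel integral of the bare weight \<open>1 / sqrt t\<close>, and \<open>Phi\<close> again satisfies \<open>|k| *
  Phi k t \<le> const * |k|^(-2) / t^(1/4)\<close> (lemma \<open>wn_Phi_le\<close>). In two dimensions \<open>|k|^(-2)\<close> is square
  summable away from \<open>0\<close>, so the estimate closes. All constants are independent of the time
  horizon. For small data the Duhamel map is therefore a contraction on the set of families \<open>u\<close>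
  with \<open>|u_k(t) - linear part| \<le> eps * Phi k t\<close>, with respect to the distance \<open>sup |u_k(t) -
  w_k(t)| / Phi k t\<close>. The Picard iterates converge for each mode and each time separately, and
  their limit is a fixed point (theorem \<open>sol_fixed_point\<close>).

  The rest translates the fixed point into a mild solution. For \<open>t > 0\<close> the coefficients,
  multiplied by \<open>|k|\<close>, are absolutely summable, with a sum that is integrable in time down to \<open>t =
  0\<close>. Hence the solution and its gradient are absolutely convergent series: weak derivatives and
  products can be computed term by term, and the coefficients of \<open>|\<nabla>u|\<^sup>2\<close> are the expected
  convolutions. The Bochner integral is obtained by truncating the Fourier series and
  approximating each coefficient by a simple function of time (theorem
  \<open>has_L2_bochner_integral_fseries\<close>). Continuity in \<open>L\<^sup>2\<close>, in particular at \<open>t = 0\<close>, where the series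
  need not converge absolutely, follows from Parseval's identity and dominated convergence for
  series. Completeness of the trigonometric system is derived from the Stone--Weierstrass
  theorem on a product of two circles and the inner regularity of Lebesgue measure.
\<close>

section \<open>Unordered sums over the frequency lattice\<close>

definition freq_box :: "nat \<Rightarrow> (int \<times> int) set" where
  "freq_box n = {- int n..int n} \<times> {- int n..int n}"

lemma finite_freq_box [simp]: "finite (freq_box n)"
  by (simp add: freq_box_def)

text \<open>
  Square partial sums are cofinal among all finite ones. They turn an unordered sum over the
  frequency lattice into the limit of a sequence, to which the theorems on measurability and on
  convergence of integrals apply.
\<close>

lemma freq_box_exhausts: "filterlim freq_box (finite_subsets_at_top UNIV) sequentially"
  unfolding filterlim_finite_subsets_at_top
proof (intro allI impI)
  fix X :: "(int \<times> int) set"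
  assume X: "finite X \<and> X \<subseteq> UNIV"
  define N where "N = Max (insert 0 ((\<lambda>k. nat (max \<bar>fst k\<bar> \<bar>snd k\<bar>)) ` X))"
  have "X \<subseteq> freq_box n" if "n \<ge> N" for n
  proof
    fix k assume "k \<in> X"
    then have "nat (max \<bar>fst k\<bar> \<bar>snd k\<bar>) \<le> N"
      unfolding N_def using X by (intro Max_ge) auto
    with that show "k \<in> freq_box n"
      by (cases k) (auto simp: freq_box_def)
  qed
  then show "\<forall>\<^sub>F n in sequentially. finite (freq_box n) \<and> X \<subseteq> freq_box n \<and> freq_box n \<subseteq> UNIV"
    by (auto simp: eventually_sequentially)
qed

lemma infsum_freq_box_limit:
  assumes "f summable_on (UNIV :: (int \<times> int) set)"
  shows "(\<lambda>n. \<Sum>k\<in>freq_box n. f k) \<longlonglongrightarrow> (\<Sum>\<^sub>\<infinity>k. f k)"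
  using filterlim_compose[OF infsum_tendsto[OF assms] freq_box_exhausts] .

lemma borel_measurable_infsum:
  fixes f :: "int \<times> int \<Rightarrow> 'a \<Rightarrow> 'b::{second_countable_topology, real_normed_vector}"
  assumes "\<And>k. f k \<in> borel_measurable M"
    and "\<And>x. x \<in> space M \<Longrightarrow> (\<lambda>k. f k x) summable_on UNIV"
  shows "(\<lambda>x. \<Sum>\<^sub>\<infinity>k. f k x) \<in> borel_measurable M"
proof (rule borel_measurable_LIMSEQ_metric)
  show "(\<lambda>x. \<Sum>k\<in>freq_box n. f k x) \<in> borel_measurable M" for n
    using assms(1) by (intro borel_measurable_sum)
  show "(\<lambda>n. \<Sum>k\<in>freq_box n. f k x) \<longlonglongrightarrow> (\<Sum>\<^sub>\<infinity>k. f k x)" if "x \<in> space M" for x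
    by (rule infsum_freq_box_limit[OF assms(2)[OF that]])
qed

lemma norm_infsum_bound_le:
  fixes f :: "'k \<Rightarrow> 'b::banach"
  assumes "g summable_on UNIV" "\<And>k. norm (f k) \<le> g k"
  shows "(\<lambda>k. norm (f k)) summable_on UNIV" "f summable_on UNIV"
    "norm (\<Sum>\<^sub>\<infinity>k. f k) \<le> (\<Sum>\<^sub>\<infinity>k. g k)"
proof -
  show 1: "(\<lambda>k. norm (f k)) summable_on UNIV"
    using Infinite_Sum.abs_summable_on_comparison_test'[OF assms(1)] assms(2) by blast
  then show "f summable_on UNIV" by (rule abs_summable_summable)
  show "norm (\<Sum>\<^sub>\<infinity>k. f k) \<le> (\<Sum>\<^sub>\<infinity>k. g k)"
    using norm_infsum_bound[OF 1] infsum_mono[OF 1 assms(1)] assms(2) by fastforce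
qed

text \<open>
  Dominated convergence for unordered sums, along an arbitrary filter: a finite index set
  carries the majorant up to an arbitrarily small remainder, and on it the limit is taken term
  by term.
\<close>

lemma tendsto_infsum_dominated:
  fixes f :: "'t \<Rightarrow> 'k \<Rightarrow> 'b::banach"
  assumes lim: "\<And>k. ((\<lambda>t. f t k) \<longlongrightarrow> h k) F"
    and bd: "\<forall>\<^sub>F t in F. \<forall>k. norm (f t k) \<le> g k"
    and g: "g summable_on UNIV" and F: "F \<noteq> bot"
  shows "((\<lambda>t. \<Sum>\<^sub>\<infinity>k. f t k) \<longlongrightarrow> (\<Sum>\<^sub>\<infinity>k. h k)) F"
proof (rule tendstoI)
  fix e :: real assume e: "e > 0"
  have hb: "norm (h k) \<le> g k" for k
    by (rule tendsto_upperbound[OF tendsto_norm[OF lim]]) (use bd F in \<open>auto elim: eventually_mono\<close>)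
  obtain K where K: "finite K" "dist (sum g K) (infsum g UNIV) \<le> e/4"
    using infsum_finite_approximation[OF g, of "e/4"] e by auto
  have tail: "(\<Sum>\<^sub>\<infinity>k\<in>-K. g k) \<le> e/4"
  proof -
    have "infsum g UNIV = (\<Sum>\<^sub>\<infinity>k\<in>K. g k) + (\<Sum>\<^sub>\<infinity>k\<in>-K. g k)"
      using infsum_Un_disjoint[of g K "-K"] summable_on_subset[OF g] by (simp add: Compl_partition)
    with K show ?thesis by (simp add: dist_real_def)
  qed
  have ft: "dist (\<Sum>\<^sub>\<infinity>k. x k) (\<Sum>k\<in>K. x k) \<le> e/4" if "\<forall>k. norm (x k) \<le> g k" for x :: "'k \<Rightarrow> 'b"
  proof -
    have xs: "x summable_on A" for A
      by (rule summable_on_subset_banach[OF norm_infsum_bound_le(2)[OF g]]) (use that in auto)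
    have "infsum x UNIV = (\<Sum>k\<in>K. x k) + (\<Sum>\<^sub>\<infinity>k\<in>-K. x k)"
      using infsum_Un_disjoint[of x K "-K"] xs K by (simp add: Compl_partition)
    moreover have "norm (\<Sum>\<^sub>\<infinity>k\<in>-K. x k) \<le> (\<Sum>\<^sub>\<infinity>k\<in>-K. g k)"
      by (rule norm_infsum_le[OF has_sum_infsum[OF xs] has_sum_infsum[OF summable_on_subset[OF g]]])
        (use that in auto)
    ultimately show ?thesis using tail by (simp add: dist_norm)
  qed
  have "((\<lambda>t. \<Sum>k\<in>K. f t k) \<longlongrightarrow> (\<Sum>k\<in>K. h k)) F"
    by (intro tendsto_sum lim)
  then have "\<forall>\<^sub>F t in F. dist (\<Sum>k\<in>K. f t k) (\<Sum>k\<in>K. h k) < e/4"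
    using e by (auto dest!: tendstoD[where e="e/4"])
  with bd show "\<forall>\<^sub>F t in F. dist (\<Sum>\<^sub>\<infinity>k. f t k) (\<Sum>\<^sub>\<infinity>k. h k) < e"
  proof eventually_elim
    case (elim t)
    have "dist (\<Sum>\<^sub>\<infinity>k. h k) (\<Sum>k\<in>K. h k) \<le> e/4" using ft hb by blast
    moreover have "dist (\<Sum>\<^sub>\<infinity>k. f t k) (\<Sum>k\<in>K. f t k) \<le> e/4" using ft elim by blast
    ultimately show ?case
      using elim(2) dist_triangle[of "\<Sum>\<^sub>\<infinity>k. f t k" "\<Sum>\<^sub>\<infinity>k. h k" "\<Sum>k\<in>K. f t k"]
        dist_triangle[of "\<Sum>k\<in>K. f t k" "\<Sum>\<^sub>\<infinity>k. h k" "\<Sum>k\<in>K. h k"] e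
      by (simp add: dist_commute)
  qed
qed

text \<open>
  Fatou's lemma along the square partial sums.
\<close>

lemma nn_integral_infsum_le:
  fixes g :: "int \<times> int \<Rightarrow> 'a \<Rightarrow> real"
  assumes int: "\<And>k. integrable M (g k)" and nonneg: "\<And>k x. x \<in> space M \<Longrightarrow> 0 \<le> g k x"
    and sx: "AE x in M. (\<lambda>k. g k x) summable_on UNIV"
    and bd: "\<And>k. (LINT x|M. g k x) \<le> b k" and b: "b summable_on UNIV"
  shows "(\<integral>\<^sup>+x. ennreal (\<Sum>\<^sub>\<infinity>k. g k x) \<partial>M) \<le> ennreal (\<Sum>\<^sub>\<infinity>k. b k)"
proof -
  have b0: "0 \<le> b k" for k
    by (rule order_trans[OF Bochner_Integration.integral_nonneg bd]) (rule nonneg)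
  have "(\<integral>\<^sup>+x. ennreal (\<Sum>\<^sub>\<infinity>k. g k x) \<partial>M)
      = (\<integral>\<^sup>+x. liminf (\<lambda>n. ennreal (\<Sum>k\<in>freq_box n. g k x)) \<partial>M)"
  proof (rule nn_integral_cong_AE)
    show "AE x in M. ennreal (\<Sum>\<^sub>\<infinity>k. g k x) = liminf (\<lambda>n. ennreal (\<Sum>k\<in>freq_box n. g k x))"
      using sx
    proof eventually_elim
      case (elim x)
      then show ?case
        using lim_imp_Liminf[OF _ tendsto_ennrealI[OF infsum_freq_box_limit[OF elim]]] by simp
    qed
  qed
  also have "\<dots> \<le> liminf (\<lambda>n. \<integral>\<^sup>+x. ennreal (\<Sum>k\<in>freq_box n. g k x) \<partial>M)"
    using int by (intro nn_integral_liminf) (auto intro!: borel_measurable_sum)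
  also have "\<dots> \<le> liminf (\<lambda>n. ennreal (\<Sum>\<^sub>\<infinity>k. b k))"
  proof (intro Liminf_mono always_eventually allI)
    fix n
    have "(\<integral>\<^sup>+x. ennreal (\<Sum>k\<in>freq_box n. g k x) \<partial>M) = ennreal (LINT x|M. (\<Sum>k\<in>freq_box n. g k x))"
      using int nonneg by (intro nn_integral_eq_integral) (auto intro!: AE_I2 sum_nonneg)
    also have "(LINT x|M. (\<Sum>k\<in>freq_box n. g k x)) = (\<Sum>k\<in>freq_box n. LINT x|M. g k x)"
      using int by simp
    also have "\<dots> \<le> (\<Sum>k\<in>freq_box n. b k)" using bd by (intro sum_mono)
    also have "\<dots> \<le> (\<Sum>\<^sub>\<infinity>k. b k)" using b b0 by (intro finite_sum_le_infsum) auto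
    finally show "(\<integral>\<^sup>+x. ennreal (\<Sum>k\<in>freq_box n. g k x) \<partial>M) \<le> ennreal (\<Sum>\<^sub>\<infinity>k. b k)"
      by (simp add: ennreal_leI)
  qed
  also have "\<dots> = ennreal (\<Sum>\<^sub>\<infinity>k. b k)" by (simp add: Liminf_const)
  finally show ?thesis .
qed

text \<open>
  By the arithmetic-geometric mean inequality with weight \<open>\<eta>\<close>. The weight balances the two factors
  when one of them is a small difference and the other is merely bounded.
\<close>

lemma infsum_convolution_bound:
  fixes x y p q :: "'k::ab_group_add \<Rightarrow> real"
  assumes x: "\<And>m. 0 \<le> x m" "\<And>m. x m \<le> p m" and y: "\<And>m. 0 \<le> y m" "\<And>m. y m \<le> q m"
    and p: "(\<lambda>m. (p m)\<^sup>2) summable_on UNIV" "(\<Sum>\<^sub>\<infinity>m. (p m)\<^sup>2) \<le> P"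
    and q: "(\<lambda>m. (q m)\<^sup>2) summable_on UNIV" "(\<Sum>\<^sub>\<infinity>m. (q m)\<^sup>2) \<le> Q"
    and \<eta>: "\<eta> > 0"
  shows "(\<lambda>m. x m * y (k - m)) summable_on UNIV"
    "(\<Sum>\<^sub>\<infinity>m. x m * y (k - m)) \<le> (\<eta> * P + Q / \<eta>) / 2"
proof -
  have bij: "bij_betw (\<lambda>m. k - m) UNIV (UNIV :: 'k set)"
    by (rule bij_betwI[of _ _ _ "\<lambda>m. k - m"]) auto
  have q': "(\<lambda>m. (q (k - m))\<^sup>2) summable_on UNIV" "(\<Sum>\<^sub>\<infinity>m. (q (k - m))\<^sup>2) \<le> Q"
    using summable_on_reindex_bij_betw[OF bij, of "\<lambda>m. (q m)\<^sup>2"]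
      infsum_reindex_bij_betw[OF bij, of "\<lambda>m. (q m)\<^sup>2"] q by auto
  have pt: "x m * y (k - m) \<le> \<eta>/2 * (p m)\<^sup>2 + 1/(2*\<eta>) * (q (k - m))\<^sup>2" for m
  proof -
    have "x m * y (k - m) \<le> p m * q (k - m)"
      by (rule mult_mono) (use x y order_trans[OF x] in auto)
    also have "\<dots> \<le> \<eta>/2 * (p m)\<^sup>2 + 1/(2*\<eta>) * (q (k - m))\<^sup>2"
    proof -
      have "0 \<le> (\<eta> * p m - q (k - m))\<^sup>2 / (2*\<eta>)" using \<eta> by simp
      also have "\<dots> = \<eta>/2 * (p m)\<^sup>2 + 1/(2*\<eta>) * (q (k - m))\<^sup>2 - p m * q (k - m)"
        using \<eta> by (simp add: field_simps power2_eq_square)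
      finally show ?thesis by simp
    qed
    finally show ?thesis .
  qed
  have s: "(\<lambda>m. \<eta>/2 * (p m)\<^sup>2 + 1/(2*\<eta>) * (q (k - m))\<^sup>2) summable_on UNIV"
    by (intro summable_on_add summable_on_cmult_right p q')
  show 1: "(\<lambda>m. x m * y (k - m)) summable_on UNIV"
    by (rule summable_on_comparison_test[OF s pt]) (use x y in auto)
  have "(\<Sum>\<^sub>\<infinity>m. x m * y (k - m)) \<le> (\<Sum>\<^sub>\<infinity>m. \<eta>/2 * (p m)\<^sup>2 + 1/(2*\<eta>) * (q (k - m))\<^sup>2)"
    by (rule infsum_mono[OF 1 s pt])
  also have "\<dots> = \<eta>/2 * (\<Sum>\<^sub>\<infinity>m. (p m)\<^sup>2) + 1/(2*\<eta>) * (\<Sum>\<^sub>\<infinity>m. (q (k - m))\<^sup>2)"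
    by (subst infsum_add[OF summable_on_cmult_right[OF p(1)] summable_on_cmult_right[OF q'(1)]])
       (simp only: infsum_cmult_right')
  also have "\<dots> \<le> \<eta>/2 * P + 1/(2*\<eta>) * Q"
    using p q' \<eta> by (intro add_mono mult_left_mono) auto
  finally show "(\<Sum>\<^sub>\<infinity>m. x m * y (k - m)) \<le> (\<eta> * P + Q / \<eta>) / 2"
    using \<eta> by (simp add: field_simps)
qed

text \<open>
  The Cauchy product over a group: the double series is reindexed by \<open>(m, n) = (m, k - m)\<close>.
\<close>

lemma abs_summable_convolution:
  fixes c d :: "'k::ab_group_add \<Rightarrow> complex"
  assumes c: "(\<lambda>m. norm (c m)) summable_on UNIV" and d: "(\<lambda>m. norm (d m)) summable_on UNIV"
  shows "(\<lambda>k. norm (\<Sum>\<^sub>\<infinity>m. c m * d (k - m))) summable_on UNIV"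
    "(\<Sum>\<^sub>\<infinity>m. c m) * (\<Sum>\<^sub>\<infinity>m. d m) = (\<Sum>\<^sub>\<infinity>k. \<Sum>\<^sub>\<infinity>m. c m * d (k - m))"
proof -
  have prod: "(\<lambda>z. norm (case z of (m, n) \<Rightarrow> c m * d n)) summable_on (UNIV \<times> UNIV)"
    unfolding Infinite_Sum.abs_summable_on_Sigma_iff using c d
    by (auto simp: norm_mult infsum_cmult_right' abs_mult infsum_nonneg
        intro!: summable_on_cmult_right summable_on_cmult_left)
  have bij: "bij_betw (\<lambda>(k, m). (m, k - m)) (UNIV \<times> UNIV) (UNIV \<times> (UNIV :: 'k set))"
    by (rule bij_betwI[of _ _ _ "\<lambda>(m, n). (m + n, m)"]) auto
  have sh: "(\<lambda>z. norm (case z of (k, m) \<Rightarrow> c m * d (k - m))) summable_on (UNIV \<times> UNIV)"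
    using summable_on_reindex_bij_betw[OF bij, of "\<lambda>z. norm (case z of (m, n) \<Rightarrow> c m * d n)"] prod
    by (simp add: case_prod_unfold)
  then have outer: "(\<lambda>k. \<Sum>\<^sub>\<infinity>m. norm (c m * d (k - m))) summable_on UNIV"
    and inner: "\<And>k. (\<lambda>m. norm (c m * d (k - m))) summable_on UNIV"
    using Infinite_Sum.abs_summable_on_Sigma_iff[of "\<lambda>(k, m). c m * d (k - m)" UNIV "\<lambda>_. UNIV"]
      summable_on_iff_abs_summable_on_real by auto
  show "(\<lambda>k. norm (\<Sum>\<^sub>\<infinity>m. c m * d (k - m))) summable_on UNIV"
    by (rule norm_infsum_bound_le(1)[OF outer]) (rule norm_infsum_bound[OF inner])
  have "(\<Sum>\<^sub>\<infinity>m. c m) * (\<Sum>\<^sub>\<infinity>m. d m) = (\<Sum>\<^sub>\<infinity>m. \<Sum>\<^sub>\<infinity>n. c m * d n)"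
    by (simp only: infsum_cmult_right' infsum_cmult_left')
  also have "\<dots> = (\<Sum>\<^sub>\<infinity>z\<in>UNIV \<times> UNIV. case z of (m, n) \<Rightarrow> c m * d n)"
    by (rule infsum_Sigma'_banach[OF abs_summable_summable[OF prod]])
  also have "\<dots> = (\<Sum>\<^sub>\<infinity>z\<in>UNIV \<times> UNIV. case z of (k, m) \<Rightarrow> c m * d (k - m))"
    by (subst infsum_reindex_bij_betw[OF bij, symmetric]) (simp add: case_prod_unfold)
  also have "\<dots> = (\<Sum>\<^sub>\<infinity>k. \<Sum>\<^sub>\<infinity>m. c m * d (k - m))"
    by (rule infsum_Sigma'_banach[OF abs_summable_summable[OF sh], symmetric])
  finally show "(\<Sum>\<^sub>\<infinity>m. c m) * (\<Sum>\<^sub>\<infinity>m. d m) = (\<Sum>\<^sub>\<infinity>k. \<Sum>\<^sub>\<infinity>m. c m * d (k - m))" .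
qed

section \<open>Absolutely convergent Fourier series on the torus\<close>

locale rectangular_torus =
  fixes L1 L2 :: real
  assumes L1_pos: "0 < L1" and L2_pos: "0 < L2"
begin

abbreviation wv :: "int \<times> int \<Rightarrow> real \<times> real" where "wv \<equiv> wavevector L1 L2"

abbreviation TT :: "(real \<times> real) measure" where "TT \<equiv> torus L1 L2"

definition mode :: "int \<times> int \<Rightarrow> real \<times> real \<Rightarrow> complex" where
  "mode k x = cis (wv k \<bullet> x)"

text \<open>
  For absolutely summable \<open>c\<close> the series converges uniformly to a bounded function; this is the
  case of interest.
\<close>

definition fseries :: "(int \<times> int \<Rightarrow> complex) \<Rightarrow> real \<times> real \<Rightarrow> complex" where
  "fseries c x = (\<Sum>\<^sub>\<infinity>k. c k * mode k x)"

lemma wv_simps [simp]: "wv 0 = 0" "wv (k + m) = wv k + wv m" "wv (k - m) = wv k - wv m" "wv (- k)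
    = - wv k"
  by (auto simp: wavevector_def zero_prod_def add_divide_distrib diff_divide_distrib algebra_simps)

lemma mode_add: "mode (k + m) x = mode k x * mode m x"
  by (simp add: mode_def cis_mult inner_add_left)

lemma norm_mode [simp]: "norm (mode k x) = 1"
  by (simp add: mode_def)

lemma cnj_mode: "cnj (mode k x) = mode (- k) x"
  by (simp add: mode_def cis_cnj)

lemma mode_zero [simp]: "mode 0 x = 1"
  by (simp add: mode_def)

lemma mode_periodic: "mode k (x + L1, y) = mode k (x, y)" "mode k (x, y + L2) = mode k (x, y)"
proof -
  have "wv k \<bullet> (x + L1, y) = wv k \<bullet> (x, y) + 2 * pi * of_int (fst k)"
    "wv k \<bullet> (x, y + L2) = wv k \<bullet> (x, y) + 2 * pi * of_int (snd k)"
    using L1_pos L2_pos by (auto simp: wavevector_def field_simps)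
  then show "mode k (x + L1, y) = mode k (x, y)" "mode k (x, y + L2) = mode k (x, y)"
    by (auto simp: mode_def cis_mult[symmetric] cis_multiple_2pi)
qed

lemma mode_has_derivative:
  "(mode k has_derivative (\<lambda>h. \<i> * of_real (wv k \<bullet> h) * mode k x)) (at x)"
proof -
  have "((\<lambda>x. exp (\<i> * of_real (wv k \<bullet> x))) has_derivative
      (\<lambda>h. exp (\<i> * of_real (wv k \<bullet> x)) * (\<i> * of_real (wv k \<bullet> h)))) (at x)"
    by (rule has_derivative_compose[OF _ DERIV_exp[unfolded has_field_derivative_def]])
       (auto intro!: derivative_eq_intros)
  then show ?thesis
    unfolding mode_def cis_conv_exp by (simp add: mult_ac)
qed

lemma continuous_on_mode [continuous_intros]: "continuous_on A (mode k)"
  unfolding mode_def cis_conv_exp by (intro continuous_intros)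

lemma mode_measurable [measurable]: "mode k \<in> borel_measurable borel"
  by (rule borel_measurable_continuous_onI[OF continuous_on_mode])

lemma torus_box_cbox: "torus_box L1 L2 = cbox (0, 0) (L1, L2)"
  by (auto simp: torus_box_def cbox_Pair_eq)

lemma torus_box_lmeasurable [simp]: "torus_box L1 L2 \<in> lmeasurable" "torus_box L1 L2 \<in> sets
    lebesgue"
  by (auto simp: torus_box_cbox)

lemma space_TT: "space TT = torus_box L1 L2"
  by (simp add: torus_def)

lemma measure_TT: "measure TT (space TT) = L1 * L2"
  using L1_pos L2_pos
  by (simp add: torus_def measure_restrict_space torus_box_cbox content_Pair)

lemma finite_measure_TT: "finite_measure TT"
  unfolding torus_def by (rule finite_measure_lebesgue_on) simp

sublocale TT: finite_measure TT by (rule finite_measure_TT)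

lemma measurable_TT [measurable (raw)]: "f \<in> borel_measurable borel \<Longrightarrow> f \<in> borel_measurable TT"
  unfolding torus_def by (intro measurable_restrict_space1 measurable_completion) simp

lemma integrable_TT_bounded:
  fixes f :: "real \<times> real \<Rightarrow> 'b::{banach, second_countable_topology}"
  assumes "f \<in> borel_measurable TT" "\<And>x. x \<in> torus_box L1 L2 \<Longrightarrow> norm (f x) \<le> B"
  shows "integrable TT f"
  by (rule TT.integrable_const_bound[of _ B]) (use assms in \<open>auto simp: space_TT intro!: AE_I2\<close>)

lemma integral_TT_norm_bound:
  fixes f :: "real \<times> real \<Rightarrow> 'b::{banach, second_countable_topology}"
  assumes "\<And>x. x \<in> torus_box L1 L2 \<Longrightarrow> norm (f x) \<le> B" "0 \<le> B"
  shows "norm (LINT x|TT. f x) \<le> B * (L1 * L2)"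
proof (cases "integrable TT f")
  case True
  have "norm (LINT x|TT. f x) \<le> (LINT x|TT. norm (f x))" by (rule integral_norm_bound)
  also have "\<dots> \<le> (LINT x|TT. B)"
    using True assms by (intro integral_mono) (auto simp: space_TT)
  finally show ?thesis by (simp add: measure_TT mult.commute)
next
  case False
  then show ?thesis using assms L1_pos L2_pos by (simp add: not_integrable_integral_eq)
qed

text \<open>
  Fubini's theorem and the fundamental theorem of calculus in the variable of differentiation;
  the boundary values cancel by periodicity. Orthogonality of the modes and integration by parts
  both come from this.
\<close>

lemma integral_periodic_derivative:
  fixes f p q :: "real \<times> real \<Rightarrow> 'b::euclidean_space"
  assumes der: "\<And>x. (f has_derivative (\<lambda>h. fst h *\<^sub>R p x + snd h *\<^sub>R q x)) (at x)"
    and cont: "continuous_on UNIV p" "continuous_on UNIV q"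
    and per: "\<And>x y. f (x + L1, y) = f (x, y)" "\<And>x y. f (x, y + L2) = f (x, y)"
  shows "(LINT x|TT. p x) = 0" "(LINT x|TT. q x) = 0"
proof -
  have HK: "(LINT x|TT. g x) = integral (cbox (0, 0) (L1, L2)) g" if "continuous_on UNIV g"
    for g :: "real \<times> real \<Rightarrow> 'b"
    unfolding torus_def torus_box_cbox
    by (intro lebesgue_integral_eq_integral continuous_imp_integrable continuous_on_subset[OF
        that]) auto
  have x: "((\<lambda>s. p (s, y)) has_integral f (L1, y) - f (0, y)) {0..L1}" for y
  proof (rule fundamental_theorem_of_calculus)
    fix s
    have "((\<lambda>s. f (s, y)) has_derivative (\<lambda>h. h *\<^sub>R p (s, y))) (at s)"
      by (rule has_derivative_eq_rhs[OF has_derivative_compose[of "\<lambda>s. (s, y)" "\<lambda>h. (h, 0)", OF _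
          der]])
         (auto intro!: derivative_eq_intros)
    then show "((\<lambda>s. f (s, y)) has_vector_derivative p (s, y)) (at s within {0..L1})"
      by (simp add: has_vector_derivative_def has_derivative_at_withinI)
  qed (use L1_pos in auto)
  have y: "((\<lambda>s. q (r, s)) has_integral f (r, L2) - f (r, 0)) {0..L2}" for r
  proof (rule fundamental_theorem_of_calculus)
    fix s
    have "((\<lambda>s. f (r, s)) has_derivative (\<lambda>h. h *\<^sub>R q (r, s))) (at s)"
      by (rule has_derivative_eq_rhs[OF has_derivative_compose[of "\<lambda>s. (r, s)" "\<lambda>h. (0, h)", OF _
          der]])
         (auto intro!: derivative_eq_intros)
    then show "((\<lambda>s. f (r, s)) has_vector_derivative q (r, s)) (at s within {0..L2})"
      by (simp add: has_vector_derivative_def has_derivative_at_withinI)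
  qed (use L2_pos in auto)
  have p0: "integral {0..L1} (\<lambda>s. p (s, y)) = 0" for y
    using x[of y] per(1)[of 0 y] by (simp add: integral_unique)
  have q0: "integral {0..L2} (\<lambda>s. q (r, s)) = 0" for r
    using y[of r] per(2)[of r 0] by (simp add: integral_unique)
  have "(LINT x|TT. p x) = integral (cbox 0 L1) (\<lambda>x. integral (cbox 0 L2) (\<lambda>y. p (x, y)))"
    using HK[OF cont(1)] integral_prod_continuous[OF continuous_on_subset[OF cont(1)]] by simp
  also have "\<dots> = integral (cbox 0 L2) (\<lambda>y. integral (cbox 0 L1) (\<lambda>x. p (x, y)))"
    by (rule integral_swap_continuous) (use continuous_on_subset[OF cont(1)] in simp)
  finally show "(LINT x|TT. p x) = 0" by (simp add: p0)
  have "(LINT x|TT. q x) = integral (cbox 0 L1) (\<lambda>x. integral (cbox 0 L2) (\<lambda>y. q (x, y)))"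
    using HK[OF cont(2)] integral_prod_continuous[OF continuous_on_subset[OF cont(2)]] by simp
  then show "(LINT x|TT. q x) = 0" by (simp add: q0)
qed

lemma wv_eq_0_iff [simp]: "wv k = 0 \<longleftrightarrow> k = 0"
  using L1_pos L2_pos by (auto simp: wavevector_def zero_prod_def prod_eq_iff)

text \<open>
  A mode of nonzero frequency is a multiple of one of its own partial derivatives.
\<close>

lemma integral_mode: "(LINT x|TT. mode k x) = (if k = 0 then of_real (L1 * L2) else 0)"
proof (cases "k = 0")
  case True
  then show ?thesis by (simp add: measure_TT scaleR_conv_of_real)
next
  case False
  have c: "continuous_on UNIV (\<lambda>x. \<i> * of_real a * mode k x)" for a
    by (intro continuous_intros)
  note d = integral_periodic_derivative[of "mode k" "\<lambda>x. \<i> * of_real (fst (wv k)) * mode k x"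
      "\<lambda>x. \<i> * of_real (snd (wv k)) * mode k x", OF _ c c mode_periodic]
  have "(mode k has_derivative (\<lambda>h. fst h *\<^sub>R (\<i> * of_real (fst (wv k)) * mode k x)
      + snd h *\<^sub>R (\<i> * of_real (snd (wv k)) * mode k x))) (at x)" for x
    by (rule has_derivative_eq_rhs[OF mode_has_derivative])
       (auto simp: inner_prod_def scaleR_conv_of_real algebra_simps)
  from d[OF this] have "\<i> * of_real (fst (wv k)) * (LINT x|TT. mode k x) = 0"
    "\<i> * of_real (snd (wv k)) * (LINT x|TT. mode k x) = 0"
    by auto
  moreover have "fst (wv k) \<noteq> 0 \<or> snd (wv k) \<noteq> 0"
    using False wv_eq_0_iff[of k] by (auto simp: prod_eq_iff)
  ultimately show ?thesis using False by auto
qed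

lemma summable_modes:
  assumes "(\<lambda>k. norm (c k)) summable_on UNIV"
  shows "(\<lambda>k. c k * mode k x) summable_on UNIV"
  by (rule norm_infsum_bound_le(2)[OF assms]) (simp add: norm_mult)

lemma norm_fseries_le:
  assumes "(\<lambda>k. norm (c k)) summable_on UNIV"
  shows "norm (fseries c x) \<le> (\<Sum>\<^sub>\<infinity>k. norm (c k))"
  unfolding fseries_def by (rule norm_infsum_bound_le(3)[OF assms]) (simp add: norm_mult)

lemma fseries_measurable:
  assumes "(\<lambda>k. norm (c k)) summable_on UNIV"
  shows "fseries c \<in> borel_measurable borel"
proof -
  have "(\<lambda>x. \<Sum>\<^sub>\<infinity>k. c k * mode k x) \<in> borel_measurable borel"
    by (rule borel_measurable_infsum) (use summable_modes[OF assms] in auto)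
  then show ?thesis unfolding fseries_def[abs_def] .
qed

lemma fseries_integrable:
  assumes "(\<lambda>k. norm (c k)) summable_on UNIV"
  shows "integrable TT (fseries c)"
  by (rule integrable_TT_bounded[OF measurable_TT[OF fseries_measurable[OF assms]]
      norm_fseries_le[OF assms]])

lemma fseries_linear:
  assumes "(\<lambda>k. norm (c k)) summable_on UNIV" "(\<lambda>k. norm (d k)) summable_on UNIV"
  shows "fseries (\<lambda>k. c k + d k) x = fseries c x + fseries d x"
    "fseries (\<lambda>k. c k - d k) x = fseries c x - fseries d x"
    "fseries (\<lambda>k. a * c k) x = a * fseries c x"
proof -
  show "fseries (\<lambda>k. c k + d k) x = fseries c x + fseries d x"
    unfolding fseries_def using infsum_add[OF summable_modes[OF assms(1)] summable_modes[OF
        assms(2)], of x]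
    by (simp add: algebra_simps)
  show "fseries (\<lambda>k. c k - d k) x = fseries c x - fseries d x"
    unfolding fseries_def
    using infsum_add[OF summable_modes[OF assms(1)] summable_on_uminus[THEN iffD2, OF
        summable_modes[OF assms(2)]], of x x]
    by (simp add: algebra_simps infsum_uminus)
  show "fseries (\<lambda>k. a * c k) x = a * fseries c x"
    unfolding fseries_def by (simp only: infsum_cmult_right' mult.assoc)
qed

text \<open>
  Dominated convergence with the majorant \<open>(\<Sum>\<^sub>\<infinity>k. norm (c k)) * norm (h x)\<close>; this covers the
  pairing of a series with an \<open>L\<^sup>2\<close> function.
\<close>

lemma integral_fseries_mult:
  assumes c: "(\<lambda>k. norm (c k)) summable_on UNIV"
    and h: "integrable TT h"
  shows "(LINT x|TT. fseries c x * h x) = (\<Sum>\<^sub>\<infinity>k. c k * (LINT x|TT. mode k x * h x))"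
proof -
  have hb: "integrable TT (\<lambda>x. mode k x * h x)" for k
    by (rule Bochner_Integration.integrable_bound[OF h])
       (use h in \<open>auto simp: norm_mult intro!: borel_measurable_times\<close>)
  have s: "(\<lambda>k. c k * (LINT x|TT. mode k x * h x)) summable_on UNIV"
  proof (rule norm_infsum_bound_le(2))
    show "(\<lambda>k. norm (c k) * (LINT x|TT. norm (h x))) summable_on UNIV"
      by (rule summable_on_cmult_left[OF c])
    have "norm (LINT x|TT. mode k x * h x) \<le> (LINT x|TT. norm (h x))" for k
      using integral_norm_bound[of TT "\<lambda>x. mode k x * h x"] by (simp add: norm_mult)
    then show "norm (c k * (LINT x|TT. mode k x * h x)) \<le> norm (c k) * (LINT x|TT. norm (h x))"
        for k
      unfolding norm_mult by (rule mult_left_mono) simp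
  qed
  have "(\<lambda>n. LINT x|TT. (\<Sum>k\<in>freq_box n. c k * mode k x) * h x) \<longlonglongrightarrow> (LINT x|TT. fseries c x * h x)"
  proof (rule integral_dominated_convergence[where w="\<lambda>x. (\<Sum>\<^sub>\<infinity>k. norm (c k)) * norm (h x)"])
    have [measurable]: "h \<in> borel_measurable TT" using h by auto
    show "(\<lambda>x. fseries c x * h x) \<in> borel_measurable TT"
      using fseries_measurable[OF c] by measurable
    show "(\<lambda>x. (\<Sum>k\<in>freq_box n. c k * mode k x) * h x) \<in> borel_measurable TT" for n
      by measurable
    show "AE x in TT. (\<lambda>n. (\<Sum>k\<in>freq_box n. c k * mode k x) * h x) \<longlonglongrightarrow> fseries c x * h x"
      unfolding fseries_def by (intro AE_I2 tendsto_intros infsum_freq_box_limit summable_modes c)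
    show "AE x in TT. norm ((\<Sum>k\<in>freq_box n. c k * mode k x) * h x)
        \<le> (\<Sum>\<^sub>\<infinity>k. norm (c k)) * norm (h x)" for n
    proof (rule AE_I2)
      fix x assume x: "x \<in> space TT"
      have "norm (\<Sum>k\<in>freq_box n. c k * mode k x) \<le> (\<Sum>k\<in>freq_box n. norm (c k))"
        by (rule sum_norm_le) (simp add: norm_mult)
      also have "\<dots> \<le> (\<Sum>\<^sub>\<infinity>k. norm (c k))" by (intro finite_sum_le_infsum c) auto
      finally show "norm ((\<Sum>k\<in>freq_box n. c k * mode k x) * h x) \<le> (\<Sum>\<^sub>\<infinity>k. norm (c k)) * norm (h x)"
        unfolding norm_mult by (rule mult_right_mono) simp
    qed
  qed (use h in auto)
  moreover have "(LINT x|TT. (\<Sum>k\<in>freq_box n. c k * mode k x) * h x)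
      = (\<Sum>k\<in>freq_box n. c k * (LINT x|TT. mode k x * h x))" for n
    using hb by (simp add: sum_distrib_right mult.assoc)
  ultimately show ?thesis
    using infsum_freq_box_limit[OF s] LIMSEQ_unique by simp
qed

lemma fourier_coeff_eq:
  "fourier_coeff L1 L2 f k = (LINT x|TT. of_real (f x) * cnj (mode k x)) / of_real (L1 * L2)"
  by (simp add: fourier_coeff_def mode_def cis_cnj)

lemma integral_fseries_coeff:
  assumes "(\<lambda>k. norm (c k)) summable_on UNIV"
  shows "(LINT x|TT. fseries c x * cnj (mode k x)) = of_real (L1 * L2) * c k"
proof -
  have "(LINT x|TT. fseries c x * cnj (mode k x))
      = (\<Sum>\<^sub>\<infinity>m. c m * (LINT x|TT. mode m x * cnj (mode k x)))"
    by (rule integral_fseries_mult[OF assms integrable_TT_bounded[of _ 1]]) (auto simp: cnj_mode)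
  also have "\<dots> = (\<Sum>\<^sub>\<infinity>m. if m = k then of_real (L1 * L2) * c k else 0)"
    by (intro infsum_cong) (simp add: cnj_mode mode_add[symmetric] integral_mode)
  also have "\<dots> = (\<Sum>\<^sub>\<infinity>m\<in>{k}. of_real (L1 * L2) * c k)"
    by (intro infsum_cong_neutral) auto
  finally show ?thesis by simp
qed

lemma fourier_coeff_fseries:
  assumes "(\<lambda>k. norm (c k)) summable_on UNIV" "\<And>x. of_real (f x) = fseries c x"
  shows "fourier_coeff L1 L2 f k = c k"
  using L1_pos L2_pos integral_fseries_coeff[OF assms(1), of k]
    by (simp add: fourier_coeff_eq assms(2))

lemma fseries_mult:
  assumes "(\<lambda>k. norm (c k)) summable_on UNIV" "(\<lambda>k. norm (d k)) summable_on UNIV"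
  shows "fseries c x * fseries d x = fseries (\<lambda>k. \<Sum>\<^sub>\<infinity>m. c m * d (k - m)) x"
proof -
  have "(\<Sum>\<^sub>\<infinity>m. c m * mode m x * (d (k - m) * mode (k - m) x))
      = (\<Sum>\<^sub>\<infinity>m. c m * d (k - m)) * mode k x" for k
    unfolding infsum_cmult_left'[symmetric] using mode_add[where k = m and m = "k - m" and x = x
        for m]
    by (intro infsum_cong) simp
  then show ?thesis
    unfolding fseries_def
    by (subst abs_summable_convolution(2)) (use assms in \<open>auto simp: norm_mult\<close>)
qed

lemma fseries_real:
  assumes "\<And>k. c (- k) = cnj (c k)"
  shows "of_real (Re (fseries c x)) = fseries c x"
proof -
  have "cnj (fseries c x) = (\<Sum>\<^sub>\<infinity>k. c (- k) * mode (- k) x)"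
    unfolding fseries_def infsum_cnj[symmetric] by (simp add: assms cnj_mode)
  also have "\<dots> = fseries c x"
    unfolding fseries_def
    by (rule infsum_reindex_bij_betw[of uminus, where f="\<lambda>k. c k * mode k x"])
       (auto intro!: bij_betwI[of _ _ _ uminus])
  finally show ?thesis
    by (metis Reals_cnj_iff of_real_Re)
qed

lemma smooth_continuous: "smooth \<psi> \<Longrightarrow> continuous_on A \<psi>"
  by (erule smooth.cases) (metis continuous_at_imp_continuous_on has_derivative_continuous)

lemma continuous_bounded_on_torus:
  fixes h :: "real \<times> real \<Rightarrow> 'b::real_normed_vector"
  assumes "continuous_on UNIV h"
  obtains B where "\<And>x. x \<in> torus_box L1 L2 \<Longrightarrow> norm (h x) \<le> B"
proof -
  have "bounded (h ` torus_box L1 L2)"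
    unfolding torus_box_cbox
    by (intro compact_imp_bounded compact_continuous_image continuous_on_subset[OF assms]) auto
  then show ?thesis using that by (auto simp: bounded_iff)
qed

text \<open>
  For a single mode this is \<open>integral_periodic_derivative\<close>, applied to the product of the mode and
  the test function. The modes are then summed inside the integral.
\<close>

lemma weak_gradient_fseries:
  assumes c: "(\<lambda>k. norm (c k)) summable_on UNIV"
    and wc: "(\<lambda>k. norm (wv k) * norm (c k)) summable_on UNIV"
  shows "weak_gradient L1 L2 (\<lambda>x. Re (fseries c x))
    (\<lambda>x. (Re (fseries (\<lambda>k. \<i> * of_real (fst (wv k)) * c k) x),
          Re (fseries (\<lambda>k. \<i> * of_real (snd (wv k)) * c k) x)))"
proof -
  let ?g1 = "\<lambda>k. \<i> * complex_of_real (fst (wv k)) * c k" and ?g2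
      = "\<lambda>k. \<i> * complex_of_real (snd (wv k)) * c k"
  have "norm (?g1 k) \<le> norm (wv k) * norm (c k)" "norm (?g2 k) \<le> norm (wv k) * norm (c k)" for k
    using norm_fst_le[of "fst (wv k)" "snd (wv k)"] norm_snd_le[of "snd (wv k)" "fst (wv k)"]
    by (auto simp: norm_mult intro!: mult_right_mono)
  then have g: "(\<lambda>k. norm (?g1 k)) summable_on UNIV" "(\<lambda>k. norm (?g2 k)) summable_on UNIV"
    by (auto intro!: norm_infsum_bound_le(1)[OF wc])
  note m = fseries_measurable[OF c, measurable] fseries_measurable[OF g(1), measurable]
    fseries_measurable[OF g(2), measurable]
  show ?thesis
    unfolding weak_gradient_def
  proof (intro conjI allI impI)
    show "integrable TT (\<lambda>x. Re (fseries c x))"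
      using fseries_integrable[OF c] by simp
    have "integrable TT (\<lambda>x. Re (fseries ?g1 x) *\<^sub>R (1, 0) + Re (fseries ?g2 x) *\<^sub>R (0, 1 :: real)
        :: real \<times> real)"
      using fseries_integrable[OF g(1)] fseries_integrable[OF g(2)]
      by (intro Bochner_Integration.integrable_add integrable_scaleR_left integrable_Re) auto
    then show "integrable TT (\<lambda>x. (Re (fseries ?g1 x), Re (fseries ?g2 x)))"
      by simp
  next
    fix \<psi> :: "real \<times> real \<Rightarrow> real" and v :: "real \<times> real"
    assume "torus_test_function L1 L2 \<psi>"
    then have "smooth \<psi>" and per: "\<And>x y. \<psi> (x + L1, y) = \<psi> (x, y)" "\<And>x y. \<psi> (x, y + L2) = \<psi> (x, y)"
      by (auto simp: torus_test_function_def)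
    from \<open>smooth \<psi>\<close> obtain p q where
      der: "\<And>x. (\<psi> has_derivative (\<lambda>h. fst h * p x + snd h * q x)) (at x)" and "smooth p" "smooth q"
      by (rule smooth.cases) blast
    have co: "continuous_on UNIV \<psi>" "continuous_on UNIV p" "continuous_on UNIV q"
      using \<open>smooth \<psi>\<close> \<open>smooth p\<close> \<open>smooth q\<close> smooth_continuous by auto
    define D where "D x = fst v * p x + snd v * q x" for x
    have D: "frechet_derivative \<psi> (at x) v = D x" for x
      unfolding frechet_derivative_at[OF der, symmetric] D_def by simp
    have coD: "continuous_on UNIV D" unfolding D_def using co by (intro continuous_intros)
    have I: "integrable TT g" if "continuous_on UNIV g" for g :: "real \<times> real \<Rightarrow> complex"
      using continuous_bounded_on_torus[OF that] integrable_TT_bounded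
        borel_measurable_continuous_onI[OF that] measurable_TT by metis
    have parts: "(LINT x|TT. mode k x * of_real (D x))
        = - \<i> * of_real (wv k \<bullet> v) * (LINT x|TT. mode k x * of_real (\<psi> x))"
      for k
    proof -
      let ?f = "\<lambda>x. mode k x * of_real (\<psi> x)"
      let ?P = "\<lambda>x. \<i> * of_real (fst (wv k)) * ?f x + mode k x * of_real (p x)"
      let ?Q = "\<lambda>x. \<i> * of_real (snd (wv k)) * ?f x + mode k x * of_real (q x)"
      have d: "(?f has_derivative (\<lambda>h. fst h *\<^sub>R ?P x + snd h *\<^sub>R ?Q x)) (at x)" for x
        by (rule has_derivative_eq_rhs[OF has_derivative_mult[OF mode_has_derivative
                has_derivative_of_real[OF der]]])
           (auto simp: inner_prod_def scaleR_conv_of_real algebra_simps)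
      have cP: "continuous_on UNIV ?P" "continuous_on UNIV ?Q"
        using co by (auto intro!: continuous_intros)
      have z: "(LINT x|TT. ?P x) = 0" "(LINT x|TT. ?Q x) = 0"
        using integral_periodic_derivative[OF d cP] mode_periodic per by auto
      have Im: "integrable TT (\<lambda>x. mode k x * of_real (D x))" "integrable TT ?f"
        "integrable TT ?P" "integrable TT ?Q"
        using co coD cP by (auto intro!: I continuous_intros)
      have "(LINT x|TT. mode k x * of_real (D x))
          = (LINT x|TT. of_real (fst v) * ?P x + of_real (snd v) * ?Q x - \<i> * of_real (wv k \<bullet> v) *
              ?f x)"
        by (rule Bochner_Integration.integral_cong) (auto simp: D_def inner_prod_def algebra_simps)
      also have "\<dots> = of_real (fst v) * (LINT x|TT. ?P x) + of_real (snd v) * (LINT x|TT. ?Q x)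
          - \<i> * of_real (wv k \<bullet> v) * (LINT x|TT. ?f x)"
        using Im by simp
      finally show ?thesis by (simp add: z)
    qed
    have gv: "(\<lambda>k. norm (\<i> * of_real (wv k \<bullet> v) * c k)) summable_on UNIV"
    proof (rule norm_infsum_bound_le(1))
      show "(\<lambda>k. norm v * (norm (wv k) * norm (c k))) summable_on UNIV"
        by (rule summable_on_cmult_right[OF wc])
      show "norm (\<i> * of_real (wv k \<bullet> v) * c k) \<le> norm v * (norm (wv k) * norm (c k))" for k
        using mult_right_mono[OF Cauchy_Schwarz_ineq2[of "wv k" v] norm_ge_zero[of "c k"]]
        by (simp add: norm_mult mult_ac)
    qed
    have gvx: "fseries (\<lambda>k. \<i> * of_real (wv k \<bullet> v) * c k) x
        = of_real (fst v) * fseries ?g1 x + of_real (snd v) * fseries ?g2 x" for x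
    proof -
      have s: "(\<lambda>k. norm (of_real (fst v) * ?g1 k)) summable_on UNIV" "(\<lambda>k. norm (of_real (snd v)
          * ?g2 k)) summable_on UNIV"
        using summable_on_cmult_right[OF g(1), of "\<bar>fst v\<bar>"] summable_on_cmult_right[OF g(2), of
            "\<bar>snd v\<bar>"]
        by (simp_all add: norm_mult)
      have "fseries (\<lambda>k. \<i> * of_real (wv k \<bullet> v) * c k) x
          = fseries (\<lambda>k. of_real (fst v) * ?g1 k + of_real (snd v) * ?g2 k) x"
        by (simp add: inner_prod_def algebra_simps)
      also have "\<dots> = of_real (fst v) * fseries ?g1 x + of_real (snd v) * fseries ?g2 x"
        using fseries_linear(1)[OF s] fseries_linear(3)[OF g(1) g(1)] fseries_linear(3)[OF g(2)
            g(2)] by simp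
      finally show ?thesis .
    qed
    have int: "integrable TT (\<lambda>x. fseries b x * of_real (h x))"
      if b: "(\<lambda>k. norm (b k)) summable_on UNIV" and h: "continuous_on UNIV h"
      for b and h :: "real \<times> real \<Rightarrow> real"
    proof -
      obtain C where C: "\<And>x. x \<in> torus_box L1 L2 \<Longrightarrow> norm (h x) \<le> C"
        using continuous_bounded_on_torus[OF h] by blast
      show ?thesis
      proof (rule integrable_TT_bounded)
        show "(\<lambda>x. fseries b x * of_real (h x)) \<in> borel_measurable TT"
          using fseries_measurable[OF b]
            measurable_compose[OF borel_measurable_continuous_onI[OF h] borel_measurable_of_real]
          by (intro measurable_TT borel_measurable_times)
        show "norm (fseries b x * of_real (h x)) \<le> (\<Sum>\<^sub>\<infinity>k. norm (b k)) * C"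
          if "x \<in> torus_box L1 L2" for x
          unfolding norm_mult using C[OF that] norm_fseries_le[OF b, of x]
          by (intro mult_mono) (auto intro: infsum_nonneg)
      qed
    qed
    have "(LINT x|TT. Re (fseries c x) * D x) = Re (LINT x|TT. fseries c x * of_real (D x))"
      by (subst integral_Re[OF int[OF c coD], symmetric]) auto
    also have "(LINT x|TT. fseries c x * of_real (D x))
        = (\<Sum>\<^sub>\<infinity>k. c k * (LINT x|TT. mode k x * of_real (D x)))"
      by (rule integral_fseries_mult[OF c I]) (use coD in \<open>auto intro!: continuous_intros\<close>)
    also have "\<dots> = (\<Sum>\<^sub>\<infinity>k. - (\<i> * of_real (wv k \<bullet> v) * c k * (LINT x|TT. mode k x * of_real (\<psi> x))))"
      unfolding parts by (intro infsum_cong) algebra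
    also have "\<dots> = - (LINT x|TT. fseries (\<lambda>k. \<i> * of_real (wv k \<bullet> v) * c k) x * of_real (\<psi> x))"
      unfolding infsum_uminus
      by (subst integral_fseries_mult[OF gv I]) (use co in \<open>auto intro!: continuous_intros\<close>)
    also have "Re \<dots> = - (LINT x|TT. Re (fseries (\<lambda>k. \<i> * of_real (wv k \<bullet> v) * c k) x * of_real (\<psi>
        x)))"
      by (subst integral_Re[OF int[OF gv co(1)]]) auto
    also have "\<dots> = - (LINT x|TT. ((Re (fseries ?g1 x), Re (fseries ?g2 x)) \<bullet> v) * \<psi> x)"
      unfolding gvx by (simp add: inner_prod_def distrib_right mult_ac)
    finally show "(LINT x|TT. Re (fseries c x) * frechet_derivative \<psi> (at x) v)
        = - (LINT x|TT. ((Re (fseries ?g1 x), Re (fseries ?g2 x)) \<bullet> v) * \<psi> x)"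
      by (simp add: D)
  qed
qed

end

section \<open>Completeness of the modes and Parseval's identity\<close>

context rectangular_torus
begin

definition L2_fun :: "(real \<times> real \<Rightarrow> complex) \<Rightarrow> bool" where
  "L2_fun f \<longleftrightarrow> f \<in> borel_measurable TT \<and> integrable TT (\<lambda>x. (norm (f x))\<^sup>2)"

lemma norm_add_square_le: "(norm (a + b :: 'b::real_normed_vector))\<^sup>2
    \<le> 2 * (norm a)\<^sup>2 + 2 * (norm b)\<^sup>2"
proof -
  have "(norm (a + b))\<^sup>2 \<le> (norm a + norm b)\<^sup>2" by (simp add: norm_triangle_ineq power_mono)
  also have "\<dots> \<le> 2 * (norm a)\<^sup>2 + 2 * (norm b)\<^sup>2"
    using zero_le_power2[of "norm a - norm b"] by (simp add: power2_eq_square algebra_simps)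
  finally show ?thesis .
qed

lemma L2_fun_add:
  assumes "L2_fun f" "L2_fun g"
  shows "L2_fun (\<lambda>x. f x + g x)"
    "(LINT x|TT. (norm (f x + g x))\<^sup>2) \<le> 2 * (LINT x|TT. (norm (f x))\<^sup>2) + 2 * (LINT x|TT. (norm
        (g x))\<^sup>2)"
proof -
  have [measurable]: "f \<in> borel_measurable TT" "g \<in> borel_measurable TT"
    and i: "integrable TT (\<lambda>x. 2 * (norm (f x))\<^sup>2 + 2 * (norm (g x))\<^sup>2)"
    using assms by (auto simp: L2_fun_def)
  have j: "integrable TT (\<lambda>x. (norm (f x + g x))\<^sup>2)"
    by (rule Bochner_Integration.integrable_bound[OF i]) (auto intro!: AE_I2 norm_add_square_le)
  then show "L2_fun (\<lambda>x. f x + g x)" by (simp add: L2_fun_def)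
  have "(LINT x|TT. (norm (f x + g x))\<^sup>2) \<le> (LINT x|TT. 2 * (norm (f x))\<^sup>2 + 2 * (norm (g x))\<^sup>2)"
    by (rule integral_mono[OF j i norm_add_square_le])
  then show "(LINT x|TT. (norm (f x + g x))\<^sup>2)
      \<le> 2 * (LINT x|TT. (norm (f x))\<^sup>2) + 2 * (LINT x|TT. (norm (g x))\<^sup>2)"
    using assms by (simp add: L2_fun_def)
qed

lemma L2_fun_cmult: "L2_fun f \<Longrightarrow> L2_fun (\<lambda>x. a * f x)"
  by (auto simp: L2_fun_def norm_mult power_mult_distrib)

lemma L2_fun_diff: "L2_fun f \<Longrightarrow> L2_fun g \<Longrightarrow> L2_fun (\<lambda>x. f x - g x)"
  using L2_fun_add(1)[of f "\<lambda>x. (- 1) * g x"] L2_fun_cmult[of g "- 1"] by simp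

lemma L2_fun_bounded:
  assumes "f \<in> borel_measurable TT" "\<And>x. x \<in> torus_box L1 L2 \<Longrightarrow> norm (f x) \<le> B"
  shows "L2_fun f"
  unfolding L2_fun_def using assms
  by (auto intro!: integrable_TT_bounded[of _ "B\<^sup>2"] power_mono)

lemma L2_fun_fseries: "(\<lambda>k. norm (c k)) summable_on UNIV \<Longrightarrow> L2_fun (fseries c)"
  by (rule L2_fun_bounded[OF measurable_TT[OF fseries_measurable] norm_fseries_le])

text \<open>
  The closure in \<open>L\<^sup>2\<close> of the absolutely convergent Fourier series. Absolutely summable
  coefficients are used instead of trigonometric polynomials, because sums and products of such
  series are again of this form without any bookkeeping of supports.
\<close>

definition L2_approximable :: "(real \<times> real \<Rightarrow> complex) \<Rightarrow> bool" where
  "L2_approximable f \<longleftrightarrow> L2_fun f \<and>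
     (\<forall>e>0. \<exists>c. (\<lambda>k. norm (c k)) summable_on UNIV \<and> (LINT x|TT. (norm (f x - fseries c x))\<^sup>2) < e)"

lemma L2_approximable_limit:
  assumes f: "L2_fun f" and g: "\<And>e. e > 0 \<Longrightarrow> \<exists>g. L2_approximable g
      \<and> (LINT x|TT. (norm (f x - g x))\<^sup>2) < e"
  shows "L2_approximable f"
  unfolding L2_approximable_def
proof (intro conjI f allI impI)
  fix e :: real assume "e > 0"
  then obtain g where g: "L2_approximable g" "(LINT x|TT. (norm (f x - g x))\<^sup>2) < e/4"
    using g[of "e/4"] by auto
  then obtain c where c: "(\<lambda>k. norm (c k)) summable_on UNIV" "(LINT x|TT. (norm (g x - fseries c
      x))\<^sup>2) < e/4"
    using \<open>e > 0\<close> unfolding L2_approximable_def by (meson zero_less_divide_iff zero_less_numeral)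
  have "(LINT x|TT. (norm (f x - fseries c x))\<^sup>2) < e"
    using L2_fun_add(2)[of "\<lambda>x. f x - g x" "\<lambda>x. g x - fseries c x"] f g c L2_fun_diff L2_fun_fseries
    by (force simp: L2_approximable_def)
  with c show "\<exists>c. (\<lambda>k. norm (c k)) summable_on UNIV
      \<and> (LINT x|TT. (norm (f x - fseries c x))\<^sup>2) < e"
    by blast
qed

lemma L2_approximable_fseries: "(\<lambda>k. norm (c k)) summable_on UNIV \<Longrightarrow> L2_approximable (fseries c)"
  unfolding L2_approximable_def using L2_fun_fseries by (auto intro!: exI[of _ c])

lemma L2_approximable_add:
  assumes f: "L2_approximable f" and g: "L2_approximable g"
  shows "L2_approximable (\<lambda>x. f x + g x)"
  unfolding L2_approximable_def
proof (intro conjI allI impI)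
  show "L2_fun (\<lambda>x. f x + g x)" using f g L2_fun_add(1) by (auto simp: L2_approximable_def)
  fix e :: real assume "e > 0"
  then have "e/4 > 0" by simp
  with f g obtain c d where c: "(\<lambda>k. norm (c k)) summable_on UNIV" "(LINT x|TT. (norm (f x -
      fseries c x))\<^sup>2) < e/4"
    and d: "(\<lambda>k. norm (d k)) summable_on UNIV" "(LINT x|TT. (norm (g x - fseries d x))\<^sup>2) < e/4"
    unfolding L2_approximable_def by meson
  have "(LINT x|TT. (norm ((f x - fseries c x) + (g x - fseries d x)))\<^sup>2) < e"
    using L2_fun_add(2)[of "\<lambda>x. f x - fseries c x" "\<lambda>x. g x - fseries d x"] f g c d L2_fun_diff
        L2_fun_fseries
    by (force simp: L2_approximable_def)
  moreover have "(\<lambda>k. norm (c k + d k)) summable_on UNIV"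
    by (rule norm_infsum_bound_le(1)[OF summable_on_add[OF c(1) d(1)]]) (rule norm_triangle_ineq)
  moreover have "f x - fseries c x + (g x - fseries d x) = f x + g x - fseries (\<lambda>k. c k + d k) x"
      for x
    by (simp add: fseries_linear(1)[OF c(1) d(1)])
  ultimately show "\<exists>c. (\<lambda>k. norm (c k)) summable_on UNIV
      \<and> (LINT x|TT. (norm (f x + g x - fseries c x))\<^sup>2) < e"
    by auto
qed

lemma L2_approximable_cmult:
  assumes f: "L2_approximable f"
  shows "L2_approximable (\<lambda>x. a * f x)"
proof (cases "a = 0")
  case True
  have "fseries (\<lambda>k. 0) = (\<lambda>x. 0)" by (simp add: fseries_def fun_eq_iff)
  then show ?thesis using True L2_approximable_fseries[of "\<lambda>k. 0"] by simp
next
  case False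
  show ?thesis
    unfolding L2_approximable_def
  proof (intro conjI allI impI)
    show "L2_fun (\<lambda>x. a * f x)" using f L2_fun_cmult by (auto simp: L2_approximable_def)
    fix e :: real assume "e > 0"
    then have "e / (norm a)\<^sup>2 > 0" using False by simp
    with f obtain c where c: "(\<lambda>k. norm (c k)) summable_on UNIV"
      "(LINT x|TT. (norm (f x - fseries c x))\<^sup>2) < e / (norm a)\<^sup>2"
      unfolding L2_approximable_def by meson
    have "(LINT x|TT. (norm (a * f x - fseries (\<lambda>k. a * c k) x))\<^sup>2)
        = (norm a)\<^sup>2 * (LINT x|TT. (norm (f x - fseries c x))\<^sup>2)"
      by (simp add: fseries_linear(3)[OF c(1) c(1)] right_diff_distrib[symmetric] norm_mult
          power_mult_distrib)
    also have "\<dots> < e" using c(2) False by (simp add: field_simps)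
    finally show "\<exists>c. (\<lambda>k. norm (c k)) summable_on UNIV
        \<and> (LINT x|TT. (norm (a * f x - fseries c x))\<^sup>2) < e"
      using summable_on_cmult_right[OF c(1), of "norm a"]
        by (auto simp: norm_mult intro!: exI[of _ "\<lambda>k. a * c k"])
  qed
qed

lemma L2_approximable_cong:
  assumes "L2_approximable f" "\<And>x. x \<in> torus_box L1 L2 \<Longrightarrow> f x = g x"
  shows "L2_approximable g"
proof -
  have "L2_fun g = L2_fun f"
    unfolding L2_fun_def using assms(2)
    by (intro arg_cong2[of _ _ _ _ "(\<and>)"] measurable_cong Bochner_Integration.integrable_cong)
        (auto simp: space_TT)
  moreover have "(LINT x|TT. (norm (g x - fseries c x))\<^sup>2)
      = (LINT x|TT. (norm (f x - fseries c x))\<^sup>2)" for c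
    using assms(2) by (intro Bochner_Integration.integral_cong) (auto simp: space_TT)
  ultimately show ?thesis using assms(1) unfolding L2_approximable_def by simp
qed

text \<open>
  The torus as a subset of \<open>\<complex>\<^sup>2\<close>. Periodic functions cannot separate opposite edges of the box, so
  the Stone--Weierstrass theorem is applied on this image instead.
\<close>

definition circle_coords :: "real \<times> real \<Rightarrow> complex \<times> complex" where
  "circle_coords x = (mode (1, 0) x, mode (0, 1) x)"

lemma continuous_on_circle_coords: "continuous_on A circle_coords"
  unfolding circle_coords_def by (intro continuous_intros)

lemma compact_circle_coords: "compact (circle_coords ` torus_box L1 L2)"
  unfolding torus_box_cbox by (intro compact_continuous_image continuous_on_circle_coords) auto

text \<open>
  Real and imaginary parts of the two coordinates are combinations of modes, and the absolutely
  convergent series form an algebra.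
\<close>

lemma real_polynomial_is_fseries:
  assumes "real_polynomial_function g"
  shows "\<exists>c. (\<lambda>k. norm (c k)) summable_on UNIV \<and> (\<forall>x. of_real (g (circle_coords x)) = fseries c x)"
proof -
  define W where "W F \<longleftrightarrow> (\<exists>c. (\<lambda>k. norm (c k)) summable_on UNIV \<and> F = fseries c)" for F
  have mode: "W (\<lambda>x. a * mode k x)" for a k
  proof -
    let ?c = "\<lambda>m. if m = k then a else 0"
    have "(\<lambda>m. norm (?c m)) summable_on UNIV"
      by (rule finite_nonzero_values_imp_summable_on) (auto intro: finite_subset[of _ "{k}"])
    moreover have "fseries ?c x = a * mode k x" for x
    proof -
      have "fseries ?c x = (\<Sum>\<^sub>\<infinity>m\<in>{k}. a * mode k x)"
        unfolding fseries_def by (intro infsum_cong_neutral) auto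
      then show ?thesis by simp
    qed
    ultimately show ?thesis unfolding W_def by (intro exI[of _ ?c]) auto
  qed
  have add: "W (\<lambda>x. F x + G x)" if "W F" "W G" for F G
  proof -
    from that obtain c d where c: "(\<lambda>k. norm (c k)) summable_on UNIV" "F = fseries c"
      and d: "(\<lambda>k. norm (d k)) summable_on UNIV" "G = fseries d" by (auto simp: W_def)
    have "(\<lambda>k. norm (c k + d k)) summable_on UNIV"
      by (rule norm_infsum_bound_le(1)[OF summable_on_add[OF c(1) d(1)]]) (rule norm_triangle_ineq)
    then show ?thesis using fseries_linear(1)[OF c(1) d(1)] unfolding W_def
      by (intro exI[of _ "\<lambda>k. c k + d k"]) (auto simp: c d)
  qed
  have mult: "W (\<lambda>x. F x * G x)" if "W F" "W G" for F G
  proof -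
    from that obtain c d where c: "(\<lambda>k. norm (c k)) summable_on UNIV" "F = fseries c"
      and d: "(\<lambda>k. norm (d k)) summable_on UNIV" "G = fseries d" by (auto simp: W_def)
    show ?thesis
      unfolding W_def using fseries_mult[OF c(1) d(1)] abs_summable_convolution(1)[OF c(1) d(1)]
      by (intro exI[of _ "\<lambda>k. \<Sum>\<^sub>\<infinity>m. c m * d (k - m)"]) (auto simp: c d)
  qed
  have "W (\<lambda>x. of_real (g (circle_coords x)))"
    using assms
  proof (induction g rule: real_polynomial_function.induct)
    case (linear f)
    have "complex_of_real (f (circle_coords x)) =
        (of_real (f (1, 0)) / 2 - \<i> * of_real (f (\<i>, 0)) / 2) * mode (1, 0) x
      + (of_real (f (1, 0)) / 2 + \<i> * of_real (f (\<i>, 0)) / 2) * mode (- (1, 0)) x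
      + (of_real (f (0, 1)) / 2 - \<i> * of_real (f (0, \<i>)) / 2) * mode (0, 1) x
      + (of_real (f (0, 1)) / 2 + \<i> * of_real (f (0, \<i>)) / 2) * mode (- (0, 1)) x" for x
    proof -
      have split: "circle_coords x = Re (mode (1, 0) x) *\<^sub>R (1, 0) + Im (mode (1, 0) x) *\<^sub>R (\<i>, 0)
          + Re (mode (0, 1) x) *\<^sub>R (0, 1) + Im (mode (0, 1) x) *\<^sub>R (0, \<i>)"
        by (simp add: circle_coords_def complex_eq_iff)
      have "f (circle_coords x) = Re (mode (1, 0) x) * f (1, 0) + Im (mode (1, 0) x) * f (\<i>, 0)
          + Re (mode (0, 1) x) * f (0, 1) + Im (mode (0, 1) x) * f (0, \<i>)"
        unfolding split using bounded_linear.linear[OF linear]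
        by (simp only: linear_add linear_scale real_scaleR_def)
      then show ?thesis
        unfolding cnj_mode[symmetric] by (simp add: complex_eq_iff algebra_simps)
    qed
    then show ?case by (simp only:) (intro add mode)
  next
    case (const c)
    then show ?case using mode[of "of_real c" 0] by simp
  qed (auto intro: add mult)
  then show ?thesis by (auto simp: W_def fun_eq_iff)
qed

lemma L2_approximable_continuous:
  assumes F: "continuous_on (circle_coords ` torus_box L1 L2) F"
  shows "L2_approximable (\<lambda>x. of_real (F (circle_coords x)))"
proof (rule L2_approximable_limit)
  have "continuous_on (torus_box L1 L2) (\<lambda>x. of_real (F (circle_coords x)) :: complex)"
    by (intro continuous_on_of_real continuous_on_compose2[OF F continuous_on_circle_coords]) auto
  then have m: "(\<lambda>x. of_real (F (circle_coords x)) :: complex) \<in> borel_measurable TT"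
    unfolding torus_def by (intro continuous_imp_measurable_on_sets_lebesgue) auto
  have "bounded (F ` circle_coords ` torus_box L1 L2)"
    by (intro compact_imp_bounded compact_continuous_image F compact_circle_coords)
  then obtain B where "\<And>x. x \<in> torus_box L1 L2 \<Longrightarrow> norm (F (circle_coords x)) \<le> B"
    by (auto simp: bounded_iff)
  then show L: "L2_fun (\<lambda>x. of_real (F (circle_coords x)))"
    by (intro L2_fun_bounded[OF m, of B]) auto
  fix e :: real assume "e > 0"
  define d where "d = sqrt (e / (2 * (L1 * L2)))"
  have d: "d > 0" "d\<^sup>2 * (L1 * L2) = e / 2"
    using \<open>e > 0\<close> L1_pos L2_pos by (auto simp: d_def)
  obtain g where g: "real_polynomial_function g" "\<And>y. y \<in> circle_coords ` torus_box L1 L2 \<Longrightarrow> \<bar>F y -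
      g y\<bar> < d"
    using Stone_Weierstrass_real_polynomial_function[OF compact_circle_coords F d(1)] by blast
  obtain c where c: "(\<lambda>k. norm (c k)) summable_on UNIV" "\<And>x. of_real (g (circle_coords x))
      = fseries c x"
    using real_polynomial_is_fseries[OF g(1)] by blast
  have "(LINT x|TT. (norm (of_real (F (circle_coords x)) - fseries c x))\<^sup>2) \<le> d\<^sup>2 * (L1 * L2)"
  proof -
    have "norm (LINT x|TT. (norm (of_real (F (circle_coords x)) - fseries c x))\<^sup>2)
        \<le> d\<^sup>2 * (L1 * L2)"
    proof (rule integral_TT_norm_bound)
      show "norm ((norm (of_real (F (circle_coords x)) - fseries c x))\<^sup>2) \<le> d\<^sup>2"
          if "x \<in> torus_box L1 L2" for x
      proof -
        have "norm (of_real (F (circle_coords x)) - fseries c x)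
            = \<bar>F (circle_coords x) - g (circle_coords x)\<bar>"
          unfolding c(2)[symmetric] of_real_diff[symmetric] by (rule norm_of_real)
        then have "norm (of_real (F (circle_coords x)) - fseries c x) \<le> d"
          using g(2)[of "circle_coords x"] that by simp
        then show ?thesis by (simp add: power_mono)
      qed
    qed simp
    then show ?thesis by simp
  qed
  then show "\<exists>g. L2_approximable g \<and> (LINT x|TT. (norm (of_real (F (circle_coords x)) - g x))\<^sup>2) <
      e"
    using L2_approximable_fseries[OF c(1)] d \<open>e > 0\<close> by (intro exI[of _ "fseries c"]) auto
qed

text \<open>
  Opposite edges of the box have the same image, so one of the two points has to be interior.
\<close>

lemma circle_coords_inj:
  assumes "circle_coords x = circle_coords y" "x \<in> torus_box L1 L2" "y \<in> box (0, 0) (L1, L2)"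
  shows "x = y"
proof -
  have *: "s = t" if "cis (2 * pi * s / L) = cis (2 * pi * t / L)" "0 \<le> s" "s
      \<le> L" "0 < t" "t < L" "0 < L" for s t L :: real
  proof -
    have "cis (2 * pi * s / L - 2 * pi * t / L) = 1"
      using that(1) by (simp add: cis_divide[symmetric])
    then have "cos (2 * pi * s / L - 2 * pi * t / L) = 1" by (simp add: complex_eq_iff)
    then obtain n :: int where "2 * pi * s / L - 2 * pi * t / L = of_int n * 2 * pi"
      unfolding cos_one_2pi_int by blast
    then have "2 * pi * ((s - t) / L) = 2 * pi * of_int n"
      by (simp add: diff_divide_distrib right_diff_distrib)
    then have "(s - t) / L = of_int n"
      using mult_cancel_left[of "2 * pi" "(s - t) / L" "of_int n"] by (simp del: mult_cancel_left)
    then have "s - t = of_int n * L" using that by (simp add: field_simps)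
    moreover from this have "n = 0"
    proof -
      have "\<bar>of_int n * L\<bar> < L" using \<open>s - t = of_int n * L\<close> that by auto
      then have "\<bar>of_int n :: real\<bar> < 1" using that by (simp add: abs_mult)
      then show ?thesis by linarith
    qed
    ultimately show ?thesis by simp
  qed
  have e: "cis (2 * pi * fst x / L1) = cis (2 * pi * fst y / L1)" "cis (2 * pi * snd x / L2)
      = cis (2 * pi * snd y / L2)"
    using assms(1) by (auto simp: circle_coords_def mode_def wavevector_def inner_prod_def)
  have x: "0 \<le> fst x" "fst x \<le> L1" "0 \<le> snd x" "snd x \<le> L2"
    using assms(2) by (auto simp: torus_box_def)
  have y: "0 < fst y" "fst y < L1" "0 < snd y" "snd y < L2"
    using assms(3) by (auto simp: mem_box Basis_prod_def inner_prod_def)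
  have "fst x = fst y" "snd x = snd y"
    using *[OF e(1) x(1,2) y(1,2) L1_pos] *[OF e(2) x(3,4) y(3,4) L2_pos] by auto
  then show ?thesis by (simp add: prod_eq_iff)
qed

text \<open>
  The continuous functions \<open>max 0 (1 - n * infdist y T)\<close>, taken on the image of the torus in \<open>\<complex>\<^sup>2\<close>,
  decrease to the indicator function of the image of \<open>T\<close>. As \<open>T\<close> avoids the edges of the box, no
  other point of the box is mapped into this image.
\<close>

lemma L2_approximable_indicator_compact:
  assumes T: "compact T" "T \<subseteq> box (0, 0) (L1, L2)"
  shows "L2_approximable (indicator T)"
proof (cases "T = {}")
  case True
  then show ?thesis using L2_approximable_fseries[of "\<lambda>k. 0"]
    by (simp add: fseries_def[abs_def] indicator_def[abs_def])
next
  case False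

  have cl: "closed (circle_coords ` T)"
    by (intro compact_imp_closed compact_continuous_image continuous_on_circle_coords T)
  have ind [measurable]: "indicator T \<in> borel_measurable borel"
    using borel_closed[OF compact_imp_closed[OF T(1)]] by (rule borel_measurable_indicator)
  define F where "F n y = max 0 (1 - real n * infdist y (circle_coords ` T))" for n y
  have F01: "0 \<le> F n y" "F n y \<le> 1" for n y by (auto simp: F_def infdist_nonneg)
  have cF: "continuous_on A (F n)" for A n
    unfolding F_def by (intro continuous_intros)
  have lim: "(\<lambda>n. F n (circle_coords x)) \<longlonglongrightarrow> indicator T x" if x: "x \<in> torus_box L1 L2" for x
  proof (cases "x \<in> T")
    case True
    then show ?thesis by (simp add: F_def)
  next
    case xT: False
    have "circle_coords x \<notin> circle_coords ` T"
      using circle_coords_inj[of x] x xT T(2) by fastforce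
    then have pos: "infdist (circle_coords x) (circle_coords ` T) > 0"
      using in_closed_iff_infdist_zero[OF cl, of "circle_coords x"] False
        infdist_nonneg[of "circle_coords x" "circle_coords ` T"] by (simp add: less_le)
    obtain N where N: "1 < real N * infdist (circle_coords x) (circle_coords ` T)"
      using reals_Archimedean3[OF pos] by blast
    have "F n (circle_coords x) = 0" if "n \<ge> N" for n
    proof -
      have "real N * infdist (circle_coords x) (circle_coords ` T)
          \<le> real n * infdist (circle_coords x) (circle_coords ` T)"
        using that pos by (intro mult_right_mono) auto
      then show ?thesis using N by (simp add: F_def)
    qed
    then show ?thesis using xT by (auto intro!: tendsto_eventually eventually_sequentiallyI)
  qed
  have mF [measurable]: "(\<lambda>x. F n (circle_coords x)) \<in> borel_measurable borel" for n
    by (intro borel_measurable_continuous_onI continuous_on_compose2[OF cF[of UNIV]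
        continuous_on_circle_coords]) auto
  have "(\<lambda>n. LINT x|TT. (norm (indicator T x - complex_of_real (F n (circle_coords x))))\<^sup>2)
      \<longlonglongrightarrow> (LINT x|TT. 0)"
  proof (rule integral_dominated_convergence[where w="\<lambda>_. 4"])
    show "AE x in TT. (\<lambda>n. (norm (indicator T x - complex_of_real (F n (circle_coords x))))\<^sup>2) \<longlonglongrightarrow> 0"
    proof (rule AE_I2)
      fix x assume "x \<in> space TT"
      then have "(\<lambda>n. complex_of_real (F n (circle_coords x))) \<longlonglongrightarrow> of_real (indicator T x)"
        by (intro tendsto_of_real lim) (simp add: space_TT)
      then have "(\<lambda>n. (norm (indicator T x - complex_of_real (F n (circle_coords x))))\<^sup>2)
          \<longlonglongrightarrow> (norm (indicator T x - complex_of_real (indicator T x)))\<^sup>2"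
        by (rule tendsto_power[OF tendsto_norm[OF tendsto_diff[OF tendsto_const]]])
      moreover have "(norm (indicator T x - complex_of_real (indicator T x)))\<^sup>2 = 0"
        by (simp add: indicator_def)
      ultimately show "(\<lambda>n. (norm (indicator T x - complex_of_real (F n (circle_coords x))))\<^sup>2) \<longlonglongrightarrow> 0"
        by (simp only:)
    qed
    show "AE x in TT. norm ((norm (indicator T x - complex_of_real (F n (circle_coords x))))\<^sup>2)
        \<le> 4" for n
    proof (rule AE_I2)
      fix x
      have "norm (indicator T x - complex_of_real (F n (circle_coords x))) \<le> 1 + 1"
        by (rule order_trans[OF norm_triangle_ineq4]) (use F01[of n "circle_coords x"] in \<open>auto
            simp: indicator_def\<close>)
      then have "(norm (indicator T x - complex_of_real (F n (circle_coords x))))\<^sup>2 \<le> 2\<^sup>2"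
        by (intro power_mono) auto
      then show "norm ((norm (indicator T x - complex_of_real (F n (circle_coords x))))\<^sup>2)
          \<le> 4" by simp
    qed
  qed auto
  then have conv: "(\<lambda>n. LINT x|TT. (norm (indicator T x - complex_of_real (F n (circle_coords
      x))))\<^sup>2) \<longlonglongrightarrow> 0"
    by simp
  show ?thesis
  proof (rule L2_approximable_limit)
    show "L2_fun (indicator T)"
      by (rule L2_fun_bounded[of _ 1]) (auto simp: indicator_def)
    fix e :: real assume "e > 0"
    with conv obtain n where "(LINT x|TT. (norm (indicator T x - complex_of_real (F n
        (circle_coords x))))\<^sup>2) < e"
      using order_tendstoD(2)[OF conv] by (metis (no_types, lifting) eventually_happens'
          sequentially_bot)
    then show "\<exists>g. L2_approximable g \<and> (LINT x|TT. (norm (indicator T x - g x))\<^sup>2) < e"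
      using L2_approximable_continuous[OF cF] by blast
  qed
qed

text \<open>
  Up to a null set the set lies in the open box, and there it is exhausted from within by closed
  sets.
\<close>

lemma L2_approximable_indicator:
  assumes A: "A \<in> sets TT"
  shows "L2_approximable (indicator A)"
proof (rule L2_approximable_limit)
  show "L2_fun (indicator A)"
    using A by (intro L2_fun_bounded[of _ 1]) (auto simp: indicator_def)
  fix e :: real assume e: "e > 0"
  have A': "A \<in> sets lebesgue" "A \<subseteq> torus_box L1 L2"
    using A by (auto simp: torus_def sets_restrict_space)
  define A0 where "A0 = A \<inter> box (0, 0) (L1, L2)"
  have "A0 \<in> sets lebesgue" using A' by (auto simp: A0_def)
  then obtain T where T: "closed T" "T \<subseteq> A0" "A0 - T \<in> lmeasurable" "emeasure lebesgue (A0 - T) <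
      ennreal e"
    using sets_lebesgue_inner_closed[OF _ e] by blast
  have cT: "compact T"
    using T bounded_subset[OF bounded_box[of "(0, 0)" "(L1, L2)"]]
      by (auto simp: compact_eq_bounded_closed A0_def)
  have bdry: "torus_box L1 L2 - box (0, 0) (L1, L2) \<in> null_sets lebesgue"
    unfolding torus_box_cbox negligible_iff_null_sets[symmetric]
    using negligible_frontier_interval[of "(0, 0)" "(L1, L2)"] by simp
  have setsT: "A0 - T \<in> sets TT"
    using T(3) A' by (auto simp: torus_def sets_restrict_space fmeasurable_def A0_def intro!:
        image_eqI[of _ _ "A0 - T"])
  have "(LINT x|TT. (norm (indicator A x - indicator T x :: complex))\<^sup>2)
      = (LINT x|TT. indicator (A0 - T) x)"
  proof (rule Bochner_Integration.integral_cong_AE)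
    show "AE x in TT. (norm (indicator A x - indicator T x :: complex))\<^sup>2 = indicator (A0 - T) x"
    proof -
      have "AE x in lebesgue. x \<in> torus_box L1 L2 \<longrightarrow> x \<in> box (0, 0) (L1, L2)"
        using AE_not_in[OF bdry] by eventually_elim auto
      then have "AE x in TT. x \<in> box (0, 0) (L1, L2)"
        unfolding torus_def by (subst AE_restrict_space_iff) auto
      then show ?thesis
        by eventually_elim (use T(2) in \<open>auto simp: indicator_def A0_def\<close>)
    qed
    have [measurable]: "T \<in> sets borel" using T(1) by auto
    have "indicator T \<in> borel_measurable TT" by (intro measurable_TT) measurable
    then show "(\<lambda>x. (norm (indicator A x - indicator T x :: complex))\<^sup>2) \<in> borel_measurable TT"
      using A by measurable
  qed (use setsT in auto)
  also have "\<dots> = measure TT (A0 - T)" using setsT by simp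
  also have "\<dots> = measure lebesgue (A0 - T)"
    unfolding torus_def using A'(2) by (intro measure_restrict_space) (auto simp: A0_def)
  also have "\<dots> < e"
    using T(3,4) e emeasure_eq_measure2[OF T(3)] by (simp add: ennreal_less_iff)
  finally show "\<exists>g. L2_approximable g \<and> (LINT x|TT. (norm (indicator A x - g x))\<^sup>2) < e"
    using L2_approximable_indicator_compact[OF cT] T(2) by (auto simp: A0_def)
qed

theorem fseries_dense:
  assumes f: "L2_fun f"
  shows "L2_approximable f"
proof (rule L2_approximable_limit[OF f])
  fix e :: real assume e: "e > 0"
  have [measurable]: "f \<in> borel_measurable TT" and fi: "integrable TT (\<lambda>x. (norm (f x))\<^sup>2)"
    using f by (auto simp: L2_fun_def)
  obtain S where "(\<forall>i. simple_function TT (S i)) \<and> (\<forall>x\<in>space TT. (\<lambda>i. S i x) \<longlonglongrightarrow> f x) \<and>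
      (\<forall>i. \<forall>x\<in>space TT. norm (S i x) \<le> 2 * norm (f x))"
    using borel_measurable_implies_sequence_metric[of f TT 0]
      unfolding dist_norm diff_0_right by auto
  then have S: "\<And>i. simple_function TT (S i)" "\<And>x. x \<in> space TT \<Longrightarrow> (\<lambda>i. S i x) \<longlonglongrightarrow> f x"
    "\<And>i x. x \<in> space TT \<Longrightarrow> norm (S i x) \<le> 2 * norm (f x)"
    by blast+
  have mS [measurable]: "S i \<in> borel_measurable TT" for i
    by (rule borel_measurable_simple_function[OF S(1)])
  have approx: "L2_approximable (S i)" for i
  proof -
    have fin: "finite (S i ` space TT)" using S(1) by (rule simple_functionD)
    have "L2_approximable (\<lambda>x. \<Sum>y\<in>Y. y * indicator (S i -` {y} \<inter> space TT) x)" if "finite Y" for Y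
      using that
    proof (induction Y)
      case empty
      then show ?case using L2_approximable_fseries[of "\<lambda>k. 0"] by (simp add: fseries_def[abs_def])
    next
      case (insert y Y)
      have "S i -` {y} \<inter> space TT \<in> sets TT" by measurable
      then have "L2_approximable (\<lambda>x. y * indicator (S i -` {y} \<inter> space TT) x + (\<Sum>y\<in>Y. y *
          indicator (S i -` {y} \<inter> space TT) x))"
        by (intro L2_approximable_add L2_approximable_cmult L2_approximable_indicator insert)
      then show ?case unfolding sum.insert[OF insert(1,2)] .
    qed
    from this[OF fin] show ?thesis
    proof (rule L2_approximable_cong)
      fix x assume "x \<in> torus_box L1 L2"
      then have x: "x \<in> space TT" by (simp add: space_TT)
      have "(\<Sum>y\<in>S i ` space TT. y * indicator (S i -` {y} \<inter> space TT) x)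
          = (\<Sum>y\<in>S i ` space TT. if y = S i x then y else 0)"
        using x by (intro sum.cong) (auto simp: indicator_def)
      then show "(\<Sum>y\<in>S i ` space TT. y * indicator (S i -` {y} \<inter> space TT) x) = S i x"
        using x fin by (simp add: sum.delta')
    qed
  qed
  have "(\<lambda>i. LINT x|TT. (norm (f x - S i x))\<^sup>2) \<longlonglongrightarrow> (LINT x|TT. 0)"
  proof (rule integral_dominated_convergence[where w="\<lambda>x. 9 * (norm (f x))\<^sup>2"])
    show "AE x in TT. (\<lambda>i. (norm (f x - S i x))\<^sup>2) \<longlonglongrightarrow> 0"
    proof (rule AE_I2)
      fix x assume x: "x \<in> space TT"
      have "(\<lambda>i. (norm (f x - S i x))\<^sup>2) \<longlonglongrightarrow> (norm (f x - f x))\<^sup>2"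
        by (intro tendsto_intros S x)
      then show "(\<lambda>i. (norm (f x - S i x))\<^sup>2) \<longlonglongrightarrow> 0" by simp
    qed
    show "AE x in TT. norm ((norm (f x - S i x))\<^sup>2) \<le> 9 * (norm (f x))\<^sup>2" for i
    proof (rule AE_I2)
      fix x assume "x \<in> space TT"
      then have "norm (f x - S i x) \<le> 3 * norm (f x)"
        using norm_triangle_ineq4[of "f x" "S i x"] S(3)[of x i] by simp
      then have "(norm (f x - S i x))\<^sup>2 \<le> (3 * norm (f x))\<^sup>2" by (intro power_mono) auto
      then show "norm ((norm (f x - S i x))\<^sup>2) \<le> 9 * (norm (f x))\<^sup>2"
        by (simp add: power_mult_distrib)
    qed
  qed (use fi in auto)
  then have conv: "(\<lambda>i. LINT x|TT. (norm (f x - S i x))\<^sup>2) \<longlonglongrightarrow> 0" by simp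
  with e obtain i where "(LINT x|TT. (norm (f x - S i x))\<^sup>2) < e"
    using order_tendstoD(2)[OF conv] by (metis (no_types, lifting) eventually_happens'
        sequentially_bot)
  then show "\<exists>g. L2_approximable g \<and> (LINT x|TT. (norm (f x - g x))\<^sup>2) < e"
    using approx by blast
qed

lemma L2_fun_of_real: "square_integrable TT f \<longleftrightarrow> L2_fun (\<lambda>x. of_real (f x))"
proof -
  have "f \<in> borel_measurable TT" if "(\<lambda>x. complex_of_real (f x)) \<in> borel_measurable TT"
    using measurable_compose[OF that borel_measurable_Re] by simp
  moreover have "(\<lambda>x. complex_of_real (f x)) \<in> borel_measurable TT" if "f \<in> borel_measurable TT"
    using measurable_compose[OF that borel_measurable_of_real] by simp
  ultimately have "(\<lambda>x. complex_of_real (f x)) \<in> borel_measurable TT \<longleftrightarrow> f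
      \<in> borel_measurable TT" by blast
  then show ?thesis by (simp add: square_integrable_def L2_fun_def)
qed

lemma square_integrable_imp_integrable:
  assumes "square_integrable TT f"
  shows "integrable TT f"
  by (rule TT.square_integrable_imp_integrable) (use assms in \<open>simp_all add: square_integrable_def\<close>)

lemma summable_uminus:
  assumes "(\<lambda>k. norm (c k :: complex)) summable_on (UNIV :: (int \<times> int) set)"
  shows "(\<lambda>k. norm (c (- k))) summable_on UNIV"
  using summable_on_reindex_bij_betw[of uminus UNIV "UNIV :: (int \<times> int) set" "\<lambda>k. norm (c k)"]
      assms
  by (simp add: bij_betw_byWitness[of _ uminus])

lemma cnj_fseries: "cnj (fseries c x) = fseries (\<lambda>k. cnj (c (- k))) x"
proof -
  have "cnj (fseries c x) = (\<Sum>\<^sub>\<infinity>k. cnj (c k) * mode (- k) x)"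
    unfolding fseries_def infsum_cnj[symmetric] by (simp add: cnj_mode)
  also have "\<dots> = (\<Sum>\<^sub>\<infinity>k. cnj (c (- k)) * mode k x)"
    by (subst infsum_reindex_bij_betw[of uminus UNIV UNIV, symmetric]) (auto intro!:
        bij_betw_byWitness[of _ uminus])
  finally show ?thesis by (simp add: fseries_def)
qed

text \<open>
  The square is expanded and integrated term by term. Completing the square on the right-hand
  side shows that the distance is least when \<open>c\<close> consists of the Fourier coefficients of \<open>f\<close>.
\<close>

lemma integral_square_diff_fseries:
  assumes f: "square_integrable TT f" and c: "(\<lambda>k. norm (c k)) summable_on UNIV"
  defines "a \<equiv> fourier_coeff L1 L2 f"
  shows "(LINT x|TT. (norm (of_real (f x) - fseries c x))\<^sup>2)
     = (LINT x|TT. (f x)\<^sup>2) + L1 * L2 * (\<Sum>\<^sub>\<infinity>k. (norm (c k))\<^sup>2 - 2 * Re (cnj (c k) * a k))"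
    "(\<lambda>k. (norm (c k))\<^sup>2 - 2 * Re (cnj (c k) * a k)) summable_on UNIV"
proof -
  have A: "L1 * L2 > 0" using L1_pos L2_pos by simp
  have fi: "integrable TT (\<lambda>x. complex_of_real (f x))"
    using square_integrable_imp_integrable[OF f] by simp
  have f2: "integrable TT (\<lambda>x. (f x)\<^sup>2)" using f by (simp add: square_integrable_def)
  have cc: "(\<lambda>k. norm (cnj (c (- k)))) summable_on UNIV" using summable_uminus[OF c] by simp
  note cnjS = cnj_fseries[of c]
  have cross: "(LINT x|TT. of_real (f x) * cnj (fseries c x))
      = of_real (L1 * L2) * (\<Sum>\<^sub>\<infinity>k. cnj (c k) * a k)"
  proof -
    have "(LINT x|TT. of_real (f x) * cnj (fseries c x))
        = (\<Sum>\<^sub>\<infinity>k. cnj (c (- k)) * (LINT x|TT. mode k x * of_real (f x)))"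
      unfolding cnjS mult.commute[of "of_real _" "fseries _ _"]
        by (rule integral_fseries_mult[OF cc fi])
    also have "\<dots> = (\<Sum>\<^sub>\<infinity>k. cnj (c k) * (LINT x|TT. mode (- k) x * of_real (f x)))"
      by (subst infsum_reindex_bij_betw[of uminus UNIV UNIV, symmetric]) (auto intro!:
          bij_betw_byWitness[of _ uminus])
    also have "\<dots> = (\<Sum>\<^sub>\<infinity>k. of_real (L1 * L2) * (cnj (c k) * a k))"
      using L1_pos L2_pos by (intro infsum_cong) (simp add: a_def fourier_coeff_eq cnj_mode
          mult.commute)
    finally show ?thesis by (simp only: infsum_cmult_right')
  qed
  \<comment> \<open>The coefficients of an integrable function are bounded, so the mixed series converges.\<close>
  obtain M where M: "\<And>k. norm (a k) \<le> M"
  proof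
    fix k
    have "norm (LINT x|TT. of_real (f x) * cnj (mode k x))
        \<le> (LINT x|TT. norm (of_real (f x) * cnj (mode k x)))"
      by (rule integral_norm_bound)
    from divide_right_mono[OF this less_imp_le[OF A]]
    show "norm (a k) \<le> (LINT x|TT. \<bar>f x\<bar>) / (L1 * L2)"
      using L1_pos L2_pos by (simp add: a_def fourier_coeff_eq norm_divide norm_mult)
  qed
  have sx: "(\<lambda>k. cnj (c k) * a k) summable_on UNIV"
    by (rule norm_infsum_bound_le(2)[OF summable_on_cmult_left[OF c, of M]])
       (use M in \<open>auto simp: norm_mult intro!: mult_left_mono\<close>)
  have s2: "(\<lambda>k. (norm (c k))\<^sup>2) summable_on UNIV"
    unfolding power2_eq_square using summable_on_cmult_left[OF c, of "\<Sum>\<^sub>\<infinity>k. norm (c k)"]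
  proof (rule summable_on_comparison_test)
    fix k
    have "norm (c k) \<le> (\<Sum>\<^sub>\<infinity>k. norm (c k))"
      using finite_sum_le_infsum[OF c, of "{k}"] by simp
    then show "norm (c k) * norm (c k) \<le> norm (c k) * (\<Sum>\<^sub>\<infinity>k. norm (c k))"
      by (intro mult_left_mono) auto
  qed auto
  have sq: "(LINT x|TT. fseries c x * cnj (fseries c x))
      = of_real (L1 * L2 * (\<Sum>\<^sub>\<infinity>k. (norm (c k))\<^sup>2))"
  proof -
    have i: "integrable TT (\<lambda>x. cnj (fseries c x))" using fseries_integrable[OF cc]
      by (simp add: cnjS)
    have "(LINT x|TT. mode k x * cnj (fseries c x))
        = cnj (LINT x|TT. fseries c x * cnj (mode k x))" for k
      by (subst Bochner_Integration.integral_cnj[symmetric]) (simp add: mult.commute)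
    then have "(LINT x|TT. mode k x * cnj (fseries c x)) = of_real (L1 * L2) * cnj (c k)" for k
      by (simp add: integral_fseries_coeff[OF c])
    then have "(LINT x|TT. fseries c x * cnj (fseries c x))
        = (\<Sum>\<^sub>\<infinity>k. c k * (of_real (L1 * L2) * cnj (c k)))"
      using integral_fseries_mult[OF c i] by simp
    also have "\<dots> = (\<Sum>\<^sub>\<infinity>k. of_real (L1 * L2) * of_real ((norm (c k))\<^sup>2))"
      by (intro infsum_cong) (simp add: complex_norm_square mult_ac del: of_real_mult of_real_power)
    also have "\<dots> = of_real (L1 * L2) * of_real (\<Sum>\<^sub>\<infinity>k. (norm (c k))\<^sup>2)"
      by (simp only: infsum_cmult_right' infsumI[OF has_sum_of_real[OF has_sum_infsum[OF s2]]])
    finally show ?thesis by (simp only: of_real_mult)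
  qed
  have iS: "integrable TT (\<lambda>x. fseries c x * cnj (fseries c x))"
  proof -
    have "integrable TT (\<lambda>x. complex_of_real ((norm (fseries c x))\<^sup>2))"
      using L2_fun_fseries[OF c] unfolding L2_fun_def by (intro integrable_of_real) auto
    then show ?thesis by (simp only: complex_norm_square)
  qed
  have w: "integrable TT (\<lambda>x. of_real (f x) * complex_of_real (\<Sum>\<^sub>\<infinity>k. norm (c k)))"
    using fi by (rule integrable_mult_left)
  have iX: "integrable TT (\<lambda>x. of_real (f x) * cnj (fseries c x))"
  proof (rule Bochner_Integration.integrable_bound[OF w])
    show "(\<lambda>x. of_real (f x) * cnj (fseries c x)) \<in> borel_measurable TT"
      using fi measurable_TT[OF fseries_measurable[OF cc]] unfolding cnjS
        by (intro borel_measurable_times) auto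
    show "AE x in TT. norm (of_real (f x) * cnj (fseries c x))
        \<le> norm (of_real (f x) * complex_of_real (\<Sum>\<^sub>\<infinity>k. norm (c k)))"
    proof (rule AE_I2)
      fix x
      have "norm (cnj (fseries c x)) \<le> norm (complex_of_real (\<Sum>\<^sub>\<infinity>k. norm (c k)))"
        unfolding complex_mod_cnj by (rule order_trans[OF norm_fseries_le[OF c]]) simp
      then show "norm (of_real (f x) * cnj (fseries c x))
          \<le> norm (of_real (f x) * complex_of_real (\<Sum>\<^sub>\<infinity>k. norm (c k)))"
        unfolding norm_mult by (rule mult_left_mono) simp
    qed
  qed
  have "(LINT x|TT. (norm (of_real (f x) - fseries c x))\<^sup>2)
     = (LINT x|TT. (f x)\<^sup>2 - 2 * Re (of_real (f x) * cnj (fseries c x)) + Re (fseries c x * cnj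
         (fseries c x)))"
    unfolding cmod_power2
    by (intro Bochner_Integration.integral_cong) (auto simp: power2_eq_square algebra_simps)
  also have "\<dots> = (LINT x|TT. (f x)\<^sup>2) - 2 * Re (LINT x|TT. of_real (f x) * cnj (fseries c x))
      + Re (LINT x|TT. fseries c x * cnj (fseries c x))"
  proof -
    have r: "integrable TT (\<lambda>x. 2 * Re (of_real (f x) * cnj (fseries c x)))"
      "integrable TT (\<lambda>x. Re (fseries c x * cnj (fseries c x)))"
      using integrable_mult_right[OF integrable_Re[OF iX]] integrable_Re[OF iS] by blast+
    show ?thesis
      unfolding integral_Re[OF iX, symmetric] integral_Re[OF iS, symmetric]
          integral_mult_right_zero[symmetric]
        Bochner_Integration.integral_diff[OF f2 r(1), symmetric]
      by (rule Bochner_Integration.integral_add[OF Bochner_Integration.integrable_diff[OF f2 r(1)]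
          r(2)])
  qed
  also have "\<dots> = (LINT x|TT. (f x)\<^sup>2) + L1 * L2 * ((\<Sum>\<^sub>\<infinity>k. (norm (c k))\<^sup>2) - 2 * (\<Sum>\<^sub>\<infinity>k. Re (cnj (c
      k) * a k)))"
    unfolding cross sq using infsum_Re[OF sx]
    by (simp only: times_complex.sel Re_complex_of_real Im_complex_of_real mult_zero_left
        diff_0_right
        right_diff_distrib)
  also have "(\<Sum>\<^sub>\<infinity>k. (norm (c k))\<^sup>2) - 2 * (\<Sum>\<^sub>\<infinity>k. Re (cnj (c k) * a k))
      = (\<Sum>\<^sub>\<infinity>k. (norm (c k))\<^sup>2 - 2 * Re (cnj (c k) * a k))"
  proof -
    have "(\<Sum>\<^sub>\<infinity>k. (norm (c k))\<^sup>2 + (- 2) * Re (cnj (c k) * a k))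
        = (\<Sum>\<^sub>\<infinity>k. (norm (c k))\<^sup>2) + (\<Sum>\<^sub>\<infinity>k. (- 2) * Re (cnj (c k) * a k))"
      by (rule infsum_add[OF s2 summable_on_cmult_right[OF summable_on_Re[OF sx]]])
    then show ?thesis
      unfolding infsum_cmult_right'[of "- 2"] by (simp only: mult_minus_left add_uminus_conv_diff)
  qed
  finally show "(LINT x|TT. (norm (of_real (f x) - fseries c x))\<^sup>2)
     = (LINT x|TT. (f x)\<^sup>2) + L1 * L2 * (\<Sum>\<^sub>\<infinity>k. (norm (c k))\<^sup>2 - 2 * Re (cnj (c k) * a k))" .
  show "(\<lambda>k. (norm (c k))\<^sup>2 - 2 * Re (cnj (c k) * a k)) summable_on UNIV"
    using summable_on_add[OF s2 summable_on_cmult_right[OF summable_on_Re[OF sx], of "-2"]]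
    by (simp only: mult_minus_left add_uminus_conv_diff)
qed

text \<open>
  Finite truncations of the coefficients give Bessel's inequality. For the converse inequality,
  the squared distance of \<open>f\<close> to a series is never less than the defect in Bessel's inequality,
  and by density it can be made arbitrarily small.
\<close>

theorem parseval:
  assumes f: "square_integrable TT f"
  defines "a \<equiv> fourier_coeff L1 L2 f"
  shows "(\<lambda>k. (norm (a k))\<^sup>2) summable_on UNIV"
    "(LINT x|TT. (f x)\<^sup>2) = L1 * L2 * (\<Sum>\<^sub>\<infinity>k. (norm (a k))\<^sup>2)"
proof -
  have A: "L1 * L2 > 0" using L1_pos L2_pos by simp
  have Re_a: "Re (cnj (a k) * a k) = (norm (a k))\<^sup>2" for k
    unfolding cmod_power2 by (simp add: power2_eq_square)
  have bessel: "(\<Sum>k\<in>K. (norm (a k))\<^sup>2) \<le> (LINT x|TT. (f x)\<^sup>2) / (L1 * L2)" if "finite K" for K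
  proof -
    let ?c = "\<lambda>k. if k \<in> K then a k else 0"
    have c: "(\<lambda>k. norm (?c k)) summable_on UNIV"
      by (rule finite_nonzero_values_imp_summable_on) (auto intro: finite_subset[OF _ that])
    have "0 \<le> (LINT x|TT. (norm (of_real (f x) - fseries ?c x))\<^sup>2)" by simp
    also have "\<dots> = (LINT x|TT. (f x)\<^sup>2) + L1 * L2 * (\<Sum>\<^sub>\<infinity>k. (norm (?c k))\<^sup>2 - 2 * Re (cnj (?c k) *
        a k))"
      unfolding a_def by (rule integral_square_diff_fseries(1)[OF f c[unfolded a_def]])
    also have "(\<Sum>\<^sub>\<infinity>k. (norm (?c k))\<^sup>2 - 2 * Re (cnj (?c k) * a k)) = (\<Sum>\<^sub>\<infinity>k\<in>K. - (norm (a k))\<^sup>2)"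
      by (intro infsum_cong_neutral) (use Re_a in fastforce)+
    finally show ?thesis using that A by (simp add: sum_negf field_simps)
  qed
  show s: "(\<lambda>k. (norm (a k))\<^sup>2) summable_on UNIV"
    by (rule nonneg_bdd_above_summable_on) (use bessel in \<open>auto intro!: bdd_aboveI2\<close>)
  have le: "L1 * L2 * (\<Sum>\<^sub>\<infinity>k. (norm (a k))\<^sup>2) \<le> (LINT x|TT. (f x)\<^sup>2)"
    using infsum_le_finite_sums[OF s bessel] A by (simp add: field_simps)
  moreover have "(LINT x|TT. (f x)\<^sup>2) \<le> L1 * L2 * (\<Sum>\<^sub>\<infinity>k. (norm (a k))\<^sup>2)"
  proof (rule field_le_epsilon)
    fix e :: real assume "e > 0"
    then obtain c where c: "(\<lambda>k. norm (c k)) summable_on UNIV"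
      "(LINT x|TT. (norm (of_real (f x) - fseries c x))\<^sup>2) < e"
      using fseries_dense[OF f[unfolded L2_fun_of_real]] unfolding L2_approximable_def by blast
    note d = integral_square_diff_fseries[OF f c(1), folded a_def]
    have "(\<Sum>\<^sub>\<infinity>k. - (norm (a k))\<^sup>2) \<le> (\<Sum>\<^sub>\<infinity>k. (norm (c k))\<^sup>2 - 2 * Re (cnj (c k) * a k))"
    proof (rule infsum_mono[OF _ d(2)])
      show "(\<lambda>k. - (norm (a k))\<^sup>2) summable_on UNIV" using s
        by (rule summable_on_uminus[THEN iffD2])
      show "- (norm (a k))\<^sup>2 \<le> (norm (c k))\<^sup>2 - 2 * Re (cnj (c k) * a k)" for k
      proof -
        have "0 \<le> (norm (c k - a k))\<^sup>2" by simp
        also have "\<dots> = (norm (c k))\<^sup>2 - 2 * Re (cnj (c k) * a k) + (norm (a k))\<^sup>2"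
          unfolding cmod_power2 by (simp add: power2_eq_square algebra_simps)
        finally show ?thesis by simp
      qed
    qed
    then have "- (\<Sum>\<^sub>\<infinity>k. (norm (a k))\<^sup>2) \<le> (\<Sum>\<^sub>\<infinity>k. (norm (c k))\<^sup>2 - 2 * Re (cnj (c k) * a k))"
      by (simp add: infsum_uminus)
    from mult_left_mono[OF this less_imp_le[OF A]]
    show "(LINT x|TT. (f x)\<^sup>2) \<le> L1 * L2 * (\<Sum>\<^sub>\<infinity>k. (norm (a k))\<^sup>2) + e"
      using c(2) unfolding d(1) by simp
  qed
  ultimately show "(LINT x|TT. (f x)\<^sup>2) = L1 * L2 * (\<Sum>\<^sub>\<infinity>k. (norm (a k))\<^sup>2)" by simp
qed

end

section \<open>Damping of the nonconstant modes\<close>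

lemma summable_on_int_powr: "(\<lambda>m::int. (1 + \<bar>real_of_int m\<bar>) powr (-3/2)) summable_on UNIV"
proof -
  let ?f = "\<lambda>m::int. (1 + \<bar>real_of_int m\<bar>) powr (-3/2)"
  have "summable (\<lambda>n. real (Suc n) powr (-3/2))"
    using summable_real_powr_iff[of "-3/2"] summable_Suc_iff[of "\<lambda>n. real n powr (-3/2)"] by simp
  then have n: "(\<lambda>n. (1 + real n) powr (-3/2)) summable_on UNIV"
    by (subst summable_on_UNIV_nonneg_real_iff) auto
  have "?f summable_on range int" "?f summable_on range (\<lambda>n. - int n)"
    using n by (auto simp: summable_on_reindex inj_on_def o_def)
  then have "?f summable_on (range int \<union> range (\<lambda>n. - int n))"
    by (rule summable_on_union)
  moreover have "range int \<union> range (\<lambda>n. - int n) = UNIV"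
    by (auto simp: image_iff) (metis int_cases2)
  ultimately show ?thesis by simp
qed

text \<open>
  The integrand may have a singularity at an end point; as it is nonnegative, its integral
  converges absolutely.
\<close>

lemma set_integrable_nonneg_FTC:
  fixes f F :: "real \<Rightarrow> real"
  assumes "a \<le> b" "continuous_on {a..b} F" "\<And>x. x \<in> {a<..<b} \<Longrightarrow> (F has_real_derivative f x) (at x)"
    and "\<And>x. x \<in> {a..b} \<Longrightarrow> 0 \<le> f x" and [measurable]: "f \<in> borel_measurable borel"
  shows "set_integrable lborel {a..b} f" "(LINT x:{a..b}|lborel. f x) = F b - F a"
proof -
  have h: "(f has_integral F b - F a) {a..b}"
    by (rule fundamental_theorem_of_calculus_interior[OF assms(1,2)])
       (use assms(3) in \<open>auto simp: has_real_derivative_iff_has_vector_derivative\<close>)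
  then have "set_integrable lebesgue {a..b} f"
    using assms(4) by (intro nonnegative_absolutely_integrable_1) (auto simp: integrable_on_def)
  then show i: "set_integrable lborel {a..b} f"
    unfolding set_integrable_def by (subst (asm) integrable_completion) auto
  show "(LINT x:{a..b}|lborel. f x) = F b - F a"
    using set_borel_integral_eq_integral(2)[OF i] h by (simp add: integral_unique)
qed

lemma integral_inverse_sqrt:
  assumes "0 \<le> t"
  shows "set_integrable lborel {0..t} (\<lambda>tau. 1 / sqrt tau)" "(LINT tau:{0..t}|lborel. 1 / sqrt
      tau) = 2 * sqrt t"
proof -
  have d: "((\<lambda>tau. 2 * sqrt tau) has_real_derivative 1 / sqrt x) (at x)" if "x \<in> {0<..<t}" for x
    using DERIV_cmult[OF DERIV_real_sqrt[of x], of 2] that by (simp add: inverse_eq_divide)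
  have c: "continuous_on {0..t} (\<lambda>tau. 2 * sqrt tau)" by (intro continuous_intros)
  show "set_integrable lborel {0..t} (\<lambda>tau. 1 / sqrt tau)"
    by (rule set_integrable_nonneg_FTC(1)[OF assms c d]) auto
  have "(LINT tau:{0..t}|lborel. 1 / sqrt tau) = 2 * sqrt t - 2 * sqrt 0"
    by (rule set_integrable_nonneg_FTC(2)[OF assms c d]) auto
  then show "(LINT tau:{0..t}|lborel. 1 / sqrt tau) = 2 * sqrt t" by simp
qed

lemma integral_exp_decay:
  fixes t l :: real
  assumes "0 \<le> t" "0 < l"
  shows "set_integrable lborel {0..t} (\<lambda>tau. exp (- (t - tau) * l))"
    "(LINT tau:{0..t}|lborel. exp (- (t - tau) * l)) \<le> 1 / l"
proof -
  have "set_integrable lborel {0..t} (\<lambda>tau. exp (- (t - tau) * l))"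
    "(LINT tau:{0..t}|lborel. exp (- (t - tau) * l))
        = exp (- (t - t) * l) / l - exp (- (t - 0) * l) / l"
    using assms by (intro set_integrable_nonneg_FTC[of 0 t "\<lambda>tau. exp (- (t - tau) * l) / l"];
      auto intro!: continuous_intros derivative_eq_intros)+
  then show "set_integrable lborel {0..t} (\<lambda>tau. exp (- (t - tau) * l))"
    "(LINT tau:{0..t}|lborel. exp (- (t - tau) * l)) \<le> 1 / l"
    using assms by (auto simp: divide_right_mono)
qed

locale ks_torus = rectangular_torus +
  assumes L1_less: "L1 < 2 * pi" and L2_less: "L2 < 2 * pi"
begin

definition wn :: "int \<times> int \<Rightarrow> real" where "wn k = norm (wv k)"

text \<open>
  The symbol of \<open>\<Delta>\<^sup>2 + \<Delta>\<close>.
\<close>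

definition symb :: "int \<times> int \<Rightarrow> real" where "symb k = wn k ^ 4 - wn k ^ 2"

text \<open>
  Since both periods are below \<open>2 \<pi>\<close>, nonzero wave vectors have length at least \<open>2 \<pi> / max L1 L2 >
  1\<close>; \<open>gap\<close> is the resulting fraction of \<open>|k|^4\<close> that remains in the symbol.
\<close>

definition gap :: real where "gap = 1 - (max L1 L2 / (2 * pi))\<^sup>2"

lemma wn_simps [simp]: "wn 0 = 0" "wn (- k) = wn k" "0 \<le> wn k" "wn k = 0 \<longleftrightarrow> k = 0"
  by (auto simp: wn_def)

lemma symb_simps [simp]: "symb 0 = 0" "symb (- k) = symb k"
  by (auto simp: symb_def)

lemma gap_bounds: "0 < gap" "gap \<le> 1"
proof -
  have "max L1 L2 / (2 * pi) < 1" "0 < max L1 L2 / (2 * pi)"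
    using L1_less L2_less L1_pos L2_pos by (auto simp: field_simps max_def)
  then show "0 < gap" "gap \<le> 1" unfolding gap_def by (auto simp: power_less_one_iff)
qed

lemma wn_lower: "\<bar>real_of_int (fst k)\<bar> * (2 * pi / max L1 L2)
    \<le> wn k" "\<bar>real_of_int (snd k)\<bar> * (2 * pi / max L1 L2) \<le> wn k"
proof -
  have "\<bar>real_of_int i\<bar> * (2 * pi / max L1 L2) \<le> \<bar>2 * pi * (real_of_int i / L)\<bar>"
      if "0 < L" "L \<le> max L1 L2" for i L
  proof -
    have "2 * pi / max L1 L2 \<le> 2 * pi / L" using that by (intro divide_left_mono) auto
    then have "\<bar>real_of_int i\<bar> * (2 * pi / max L1 L2) \<le> \<bar>real_of_int i\<bar> * (2 * pi / L)"
      by (rule mult_left_mono) simp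
    then show ?thesis using that by (simp add: abs_mult mult_ac)
  qed
  from this[of L1 "fst k"] this[of L2 "snd k"]
  show "\<bar>real_of_int (fst k)\<bar> * (2 * pi / max L1 L2)
      \<le> wn k" "\<bar>real_of_int (snd k)\<bar> * (2 * pi / max L1 L2) \<le> wn k"
    using norm_fst_le[of "fst (wv k)" "snd (wv k)"] norm_snd_le[of "snd (wv k)" "fst (wv k)"]
        L1_pos L2_pos
    by (auto simp: wn_def wavevector_def)
qed

lemma two_pi_over_max: "1 < 2 * pi / max L1 L2"
  using L1_less L2_less L1_pos L2_pos by (auto simp: field_simps max_def)

lemma wn_ge_index: "\<bar>real_of_int (fst k)\<bar> \<le> wn k" "\<bar>real_of_int (snd k)\<bar> \<le> wn k"
  using wn_lower[of k] two_pi_over_max mult_left_mono[of 1 "2 * pi / max L1 L2"]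
  by (smt (verit) mult.right_neutral abs_ge_zero)+

lemma wn_ge_gap:
  assumes "k \<noteq> 0"
  shows "2 * pi / max L1 L2 \<le> wn k"
proof -
  have "fst k \<noteq> 0 \<or> snd k \<noteq> 0" using assms by (auto simp: prod_eq_iff)
  then have "1 \<le> \<bar>real_of_int (fst k)\<bar> \<or> 1 \<le> \<bar>real_of_int (snd k)\<bar>" by linarith
  then show ?thesis
    using wn_lower[of k] two_pi_over_max mult_right_mono[of 1 _ "2 * pi / max L1 L2"]
    by (smt (verit) mult_1)
qed

lemma wn_ge_1: "k \<noteq> 0 \<Longrightarrow> 1 \<le> wn k"
  using wn_ge_gap two_pi_over_max by fastforce

lemma symb_ge: "gap * wn k ^ 4 \<le> symb k"
proof (cases "k = 0")
  case False
  have "1 \<le> (max L1 L2 / (2 * pi)) * wn k"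
    using wn_ge_gap[OF False] L1_pos L2_pos by (auto simp: field_simps max_def)
  then have "1 \<le> ((max L1 L2 / (2 * pi)) * wn k)\<^sup>2" by (simp add: power_le_one_iff one_le_power)
  then have "1 * (wn k)\<^sup>2 \<le> ((max L1 L2 / (2 * pi)) * wn k)\<^sup>2 * (wn k)\<^sup>2"
    by (rule mult_right_mono) simp
  then show ?thesis
    by (simp add: symb_def gap_def power_mult_distrib algebra_simps power2_eq_square power4_eq_xxxx)
qed simp

lemma symb_nonneg: "0 \<le> symb k"
  using symb_ge[of k] gap_bounds by (smt (verit) mult_nonneg_nonneg wn_simps(3) zero_le_power)

lemma symb_pos: "k \<noteq> 0 \<Longrightarrow> 0 < symb k"
  using symb_ge[of k] gap_bounds wn_ge_1[of k] by (smt (verit) mult_pos_pos zero_less_power)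

text \<open>
  Both indices are bounded by \<open>wn k\<close>, so the term is at most a product of two one-dimensional
  terms with exponent \<open>3/2 > 1\<close>. Convergence needs an exponent larger than the dimension two.
\<close>

lemma lattice_sum_3: "(\<lambda>k. inverse (wn k) ^ 3) summable_on UNIV"
proof -
  define p where "p m = (1 + \<bar>real_of_int m\<bar>) powr (-3/2)" for m
  have p: "p summable_on UNIV" unfolding p_def by (rule summable_on_int_powr)
  have "(\<lambda>k. p (fst k) * p (snd k)) summable_on (UNIV \<times> UNIV)"
  proof (rule summable_on_SigmaI[where g="\<lambda>m. p m * infsum p UNIV"])
    show "((\<lambda>y. p (fst (x, y)) * p (snd (x, y))) has_sum p x * infsum p UNIV) UNIV" for x
      using has_sum_cmult_right[OF has_sum_infsum[OF p], of "p x"] by simp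
    show "(\<lambda>m. p m * infsum p UNIV) summable_on UNIV" by (rule summable_on_cmult_left[OF p])
  qed (simp add: p_def)
  then have "(\<lambda>k. 8 * (p (fst k) * p (snd k))) summable_on UNIV"
    using summable_on_cmult_right by fastforce
  then show ?thesis
  proof (rule summable_on_comparison_test)
    fix k :: "int \<times> int"
    show "inverse (wn k) ^ 3 \<le> 8 * (p (fst k) * p (snd k))"
    proof (cases "k = 0")
      case False
      let ?x = "1 + \<bar>real_of_int (fst k)\<bar>" and ?y = "1 + \<bar>real_of_int (snd k)\<bar>"
      have w: "1 \<le> wn k" by (rule wn_ge_1[OF False])
      have xy: "?x * ?y \<le> (2 * wn k) * (2 * wn k)"
        using w wn_ge_index[of k] by (intro mult_mono) auto
      have "p (fst k) * p (snd k) = (?x * ?y) powr (-3/2)"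
        unfolding p_def by (simp add: powr_mult)
      also have "\<dots> \<ge> ((2 * wn k) * (2 * wn k)) powr (-3/2)"
        using xy by (intro powr_mono2') (auto intro!: mult_pos_pos)
      also have "((2 * wn k) * (2 * wn k)) powr (-3/2) = (2 * wn k) powr (-3)"
        using w by (subst powr_mult) (auto simp: powr_add[symmetric])
      also have "(2 * wn k) powr (-3) = inverse (2 * wn k) ^ 3"
        using w powr_realpow[of "2 * wn k" 3] unfolding powr_minus power_inverse by simp
      also have "inverse (2 * wn k) ^ 3 = inverse (wn k) ^ 3 / 8"
          by (simp add: field_simps power3_eq_cube)
      finally show ?thesis by simp
    qed (simp add: p_def)
  qed simp
qed

lemma inverse_wn_le_1: "inverse (wn k) \<le> 1"
  using wn_ge_1[of k] by (cases "k = 0") (auto simp: field_simps)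

lemma lattice_sum_4: "(\<lambda>k. inverse (wn k) ^ 4) summable_on UNIV"
  by (rule summable_on_comparison_test[OF lattice_sum_3])
     (auto intro!: power_decreasing inverse_wn_le_1)

text \<open>
  The response of mode \<open>k\<close> to a forcing of size \<open>1 / sqrt tau\<close>. This is the rate at which the
  coefficients of the squared gradient may blow up at time \<open>0\<close> for data in \<open>L\<^sup>2\<close>, so that \<open>Phi\<close> is the
  natural gauge for the nonlinear part of the solution.
\<close>

definition Phi :: "int \<times> int \<Rightarrow> real \<Rightarrow> real" where
  "Phi k t = (LINT tau:{0..t}|lborel. exp (- (t - tau) * symb k) / sqrt tau)"

lemma Phi_integrable: "set_integrable lborel {0..t} (\<lambda>tau. exp (- (t - tau) * symb k) / sqrt tau)"
proof (cases "0 \<le> t")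
  case True
  show ?thesis
  proof (rule set_integrable_bound[OF integral_inverse_sqrt(1)[OF True]])
    show "AE tau in lborel. tau \<in> {0..t} \<longrightarrow> norm (exp (- (t - tau) * symb k) / sqrt tau)
        \<le> norm (1 / sqrt tau)"
      using symb_nonneg[of k] by (auto simp: mult_nonpos_nonneg intro!: divide_right_mono)
  qed (simp add: set_borel_measurable_def)
qed (simp add: set_integrable_def)

lemma Phi_nonpos [simp]: "t \<le> 0 \<Longrightarrow> Phi k t = 0"
proof -
  assume "t \<le> 0"
  then have "indicator {0..t} tau *\<^sub>R (exp (- (t - tau) * symb k) / sqrt tau) = 0" for tau
  proof (cases "tau \<in> {0..t}")
    case True
    then have "tau = 0" using \<open>t \<le> 0\<close> by simp
    then show ?thesis by simp
  qed simp
  then show "Phi k t = 0"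
    unfolding Phi_def set_lebesgue_integral_def by (simp only: Bochner_Integration.integral_zero)
qed

lemma Phi_nonneg: "0 \<le> Phi k t"
  unfolding Phi_def set_lebesgue_integral_def
  by (rule Bochner_Integration.integral_nonneg) (auto simp: indicator_def)

lemma Phi_le_sqrt:
  assumes "0 \<le> t"
  shows "Phi k t \<le> 2 * sqrt t"
proof -
  have "Phi k t \<le> (LINT tau:{0..t}|lborel. 1 / sqrt tau)"
    unfolding Phi_def using symb_nonneg[of k]
    by (intro set_integral_mono Phi_integrable integral_inverse_sqrt assms divide_right_mono)
       (auto simp: mult_nonpos_nonneg)
  then show ?thesis by (simp add: integral_inverse_sqrt(2)[OF assms])
qed

text \<open>
  On the second half of the time interval the weight \<open>1 / sqrt tau\<close> is at most \<open>sqrt (2 / t)\<close> and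
  the exponential is integrated; on the first half the exponential is at most \<open>2 / (symb k * t)\<close>
  and the weight is integrated.
\<close>

lemma Phi_le_decay:
  assumes k: "k \<noteq> 0" and t: "0 < t"
  shows "Phi k t \<le> 6 / (symb k * sqrt t)"
proof -
  have l: "symb k > 0" by (rule symb_pos[OF k])
  have i: "set_integrable lborel {0..t} (\<lambda>tau. sqrt 2 / sqrt t * exp (- (t - tau) * symb k))"
    "set_integrable lborel {0..t} (\<lambda>tau. 2 / (symb k * t) * (1 / sqrt tau))"
    by (rule set_integrable_mult_right, use integral_exp_decay(1)[of t "symb k"] t l in simp)
       (rule set_integrable_mult_right, use integral_inverse_sqrt(1)[of t] t in simp)
  have "Phi k t \<le> (LINT tau:{0..t}|lborel. sqrt 2 / sqrt t * exp (- (t - tau) * symb k) + 2 /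
      (symb k * t) * (1 / sqrt tau))"
    unfolding Phi_def
  proof (intro set_integral_mono Phi_integrable set_integral_add i)
    fix tau assume tau: "tau \<in> {0..t}"
    show "exp (- (t - tau) * symb k) / sqrt tau
        \<le> sqrt 2 / sqrt t * exp (- (t - tau) * symb k) + 2 / (symb k * t) * (1 / sqrt tau)"
    proof (cases "t / 2 \<le> tau")
      case True
      have "1 / sqrt tau \<le> 1 / sqrt (t / 2)"
        using True t by (intro divide_left_mono) auto
      then have "exp (- (t - tau) * symb k) * (1 / sqrt tau)
          \<le> exp (- (t - tau) * symb k) * (1 / sqrt (t / 2))"
        by (rule mult_left_mono) simp
      then have "exp (- (t - tau) * symb k) / sqrt tau
          \<le> sqrt 2 / sqrt t * exp (- (t - tau) * symb k)"
        by (simp add: real_sqrt_divide mult.commute)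
      moreover have "0 \<le> 2 / (symb k * t) * (1 / sqrt tau)" using l t tau by simp
      ultimately show ?thesis by (rule add_increasing2[rotated])
    next
      case False
      have "symb k * t / 2 \<le> (t - tau) * symb k"
        using False l mult_right_mono[of "t / 2" "t - tau" "symb k"] by (simp add: mult.commute)
      then have "symb k * t / 2 \<le> exp ((t - tau) * symb k)"
        using exp_ge_add_one_self[of "(t - tau) * symb k"] by linarith
      then have "1 / exp ((t - tau) * symb k) \<le> 1 / (symb k * t / 2)"
        using l t by (intro divide_left_mono) auto
      moreover have "exp (- (t - tau) * symb k) = 1 / exp ((t - tau) * symb k)"
        unfolding mult_minus_left exp_minus inverse_eq_divide ..
      ultimately have "exp (- (t - tau) * symb k) \<le> 2 / (symb k * t)" by simp
      then have "exp (- (t - tau) * symb k) * (1 / sqrt tau) \<le> 2 / (symb k * t) * (1 / sqrt tau)"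
        using tau by (intro mult_right_mono) auto
      moreover have "0 \<le> sqrt 2 / sqrt t * exp (- (t - tau) * symb k)" using t by simp
      ultimately show ?thesis by simp
    qed
  qed
  also have "\<dots> = sqrt 2 / sqrt t * (LINT tau:{0..t}|lborel. exp (- (t - tau) * symb k))
      + 2 / (symb k * t) * (LINT tau:{0..t}|lborel. 1 / sqrt tau)"
    by (subst set_integral_add(2)[OF i]) (simp only: set_integral_mult_right)
  also have "\<dots> \<le> sqrt 2 / sqrt t * (1 / symb k) + 2 / (symb k * t) * (2 * sqrt t)"
    using integral_exp_decay(2)[of t "symb k"] integral_inverse_sqrt(2)[of t] t l
    by (intro add_mono mult_left_mono) auto
  also have "\<dots> = (sqrt 2 + 4) / (symb k * sqrt t)"
    using t l by (simp add: field_simps)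
  also have "\<dots> \<le> 6 / (symb k * sqrt t)"
    using t l sqrt2_less_2 by (intro divide_right_mono) auto
  finally show ?thesis .
qed

definition decay_const :: real where "decay_const = 6 / gap"

lemma decay_const_ge: "6 \<le> decay_const"
  using gap_bounds by (simp add: decay_const_def field_simps)

lemma Phi_le_decay_const:
  assumes "k \<noteq> 0" "0 < t"
  shows "Phi k t \<le> decay_const * inverse (wn k) ^ 4 / sqrt t"
proof -
  have "6 / (symb k * sqrt t) \<le> 6 / (gap * wn k ^ 4 * sqrt t)"
    using symb_ge[of k] gap_bounds wn_ge_1[OF assms(1)] assms(2) symb_pos[OF assms(1)]
    by (intro divide_left_mono mult_right_mono mult_pos_pos) auto
  also have "\<dots> = decay_const * inverse (wn k) ^ 4 / sqrt t"
    by (simp add: decay_const_def power_inverse divide_inverse)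
  finally show ?thesis using Phi_le_decay[OF assms] by linarith
qed

lemma Phi_uniform:
  assumes "k \<noteq> 0"
  shows "Phi k t \<le> decay_const * inverse (wn k) ^ 2"
proof (cases "0 < t")
  case t: True
  show ?thesis
  proof (cases "sqrt t \<le> inverse (wn k) ^ 2")
    case True
    have "Phi k t \<le> 2 * sqrt t" using t by (intro Phi_le_sqrt) simp
    also have "\<dots> \<le> decay_const * inverse (wn k) ^ 2"
      using True decay_const_ge t by (intro mult_mono) auto
    finally show ?thesis .
  next
    case False
    have "Phi k t \<le> decay_const * inverse (wn k) ^ 4 / sqrt t"
      by (rule Phi_le_decay_const[OF assms t])
    also have "\<dots> = decay_const * inverse (wn k) ^ 2 * (inverse (wn k) ^ 2 / sqrt t)"
      by (simp add: power2_eq_square power4_eq_xxxx)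
    also have "\<dots> \<le> decay_const * inverse (wn k) ^ 2 * 1"
      using False t decay_const_ge by (intro mult_left_mono) auto
    finally show ?thesis by simp
  qed
qed (use decay_const_ge in simp)

definition root4 :: "real \<Rightarrow> real" where "root4 t = sqrt (sqrt t)"

lemma root4_simps: "0 < t \<Longrightarrow> 0 < root4 t" "0 \<le> t \<Longrightarrow> root4 t * root4 t = sqrt t" "0 \<le> t \<Longrightarrow> root4 t ^ 4
    = t"
proof -
  show "0 < t \<Longrightarrow> 0 < root4 t" by (simp add: root4_def)
  show q: "0 \<le> t \<Longrightarrow> root4 t * root4 t = sqrt t" by (simp add: root4_def)
  show "root4 t ^ 4 = t" if "0 \<le> t"
  proof -
    have "root4 t ^ 4 = (root4 t * root4 t) * (root4 t * root4 t)" by (simp add: power4_eq_xxxx)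
    then show ?thesis using q[OF that] that by simp
  qed
qed

text \<open>
  Interpolation between \<open>Phi_le_sqrt\<close>, used for \<open>wn k * t^(1/4) \<le> 1\<close>, and \<open>Phi_le_decay\<close>, used
  otherwise. The power \<open>t^(-1/4)\<close> is the one that the linear flow attains for data in \<open>L\<^sup>2\<close>, and the
  factor \<open>inverse (wn k) ^ 2\<close> is square summable.
\<close>

lemma wn_Phi_le:
  assumes "0 < t"
  shows "wn k * Phi k t \<le> decay_const * inverse (wn k) ^ 2 / root4 t"
proof (cases "k = 0")
  case False
  have w: "1 \<le> wn k" by (rule wn_ge_1[OF False])
  have s: "0 < root4 t" and ss: "sqrt t = root4 t * root4 t" using assms root4_simps[of t] by auto
  show ?thesis
  proof (cases "wn k * root4 t \<le> 1")
    case True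
    have "wn k * Phi k t \<le> wn k * (2 * sqrt t)"
      using assms by (intro mult_left_mono Phi_le_sqrt) auto
    also have "\<dots> = 2 * (wn k * root4 t) ^ 3 * inverse (wn k) ^ 2 / root4 t"
      using w s unfolding ss by (simp add: field_simps power2_eq_square power3_eq_cube)
    also have "\<dots> \<le> decay_const * inverse (wn k) ^ 2 / root4 t"
      using True w s decay_const_ge power_le_one[of "wn k * root4 t" 3]
      by (intro divide_right_mono mult_right_mono) auto
    finally show ?thesis .
  next
    case F: False
    have "wn k * Phi k t \<le> wn k * (decay_const * inverse (wn k) ^ 4 / sqrt t)"
      using Phi_le_decay_const[OF False assms] by (intro mult_left_mono) auto
    also have "\<dots> = (decay_const * inverse (wn k) ^ 2 / root4 t) * (1 / (wn k * root4 t))"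
      using w s unfolding ss by (simp add: field_simps power2_eq_square power4_eq_xxxx)
    also have "\<dots> \<le> (decay_const * inverse (wn k) ^ 2 / root4 t) * 1"
      using F w s decay_const_ge by (intro mult_left_mono) auto
    finally show ?thesis by simp
  qed
qed (use decay_const_ge assms in simp)

definition lin_flow :: "(int \<times> int \<Rightarrow> complex) \<Rightarrow> int \<times> int \<Rightarrow> real \<Rightarrow> complex" where
  "lin_flow a k t = (if 0 < t then of_real (exp (- t * symb k)) * a k else 0)"

text \<open>
  By \<open>symb_ge\<close>, \<open>t * symb k\<close> is at least the fourth power of \<open>y = (t * gap)^(1/4) * wn k\<close>, and \<open>y ^ j \<le>
  1 + y ^ 4 \<le> exp (y ^ 4)\<close>.
\<close>

lemma exp_symbol_le:
  assumes t: "0 < t" and k: "k \<noteq> 0" and j: "j \<le> 4"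
  shows "exp (- t * symb k) \<le> 1 / (root4 t * root4 gap * wn k) ^ j"
proof -
  define y where "y = root4 t * root4 gap * wn k"
  have y: "0 < y" using root4_simps(1)[OF t] root4_simps(1)[OF gap_bounds(1)] wn_ge_1[OF k]
    by (simp add: y_def)
  have "y ^ 4 = t * (gap * wn k ^ 4)"
    using t gap_bounds by (simp add: y_def power_mult_distrib root4_simps)
  also have "\<dots> \<le> t * symb k" using symb_ge t by (intro mult_left_mono) auto
  finally have "y ^ 4 \<le> t * symb k" .
  moreover have "y ^ j \<le> 1 + y ^ 4"
  proof (cases "y \<le> 1")
    case True
    then have "y ^ j \<le> 1" using y by (intro power_le_one) auto
    then show ?thesis using zero_le_power[of y 4] y by linarith
  next
    case False
    then have "y ^ j \<le> y ^ 4" using j by (intro power_increasing) auto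
    then show ?thesis by linarith
  qed
  ultimately have "y ^ j \<le> exp (t * symb k)" using exp_ge_add_one_self[of "t * symb k"] by linarith
  then have "1 / exp (t * symb k) \<le> 1 / y ^ j" using y by (intro divide_left_mono) auto
  then show ?thesis unfolding mult_minus_left exp_minus inverse_eq_divide y_def .
qed

lemma wn_exp_le:
  assumes "0 < t"
  shows "wn k * exp (- t * symb k) \<le> 1 / (root4 gap * root4 t)"
proof (cases "k = 0")
  case False
  have "wn k * exp (- t * symb k) \<le> wn k * (1 / (root4 t * root4 gap * wn k) ^ 1)"
    by (intro mult_left_mono exp_symbol_le assms False) auto
  also have "\<dots> = 1 / (root4 gap * root4 t)" using False by (simp add: field_simps)
  finally show ?thesis .
qed (use assms gap_bounds root4_simps(1) in \<open>simp add: less_imp_le\<close>)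

lemma lin_flow_measurable [measurable]: "lin_flow a k \<in> borel_measurable borel"
  unfolding lin_flow_def[abs_def] by measurable

definition duhamel :: "int \<times> int \<Rightarrow> (real \<Rightarrow> complex) \<Rightarrow> real \<Rightarrow> complex" where
  "duhamel k g t = (LINT tau:{0..t}|lborel. exp (- (t - tau) * symb k) *\<^sub>R g tau)"

lemma duhamel_bound:
  assumes [measurable]: "g \<in> borel_measurable borel" and g: "\<And>tau. 0 \<le> tau \<Longrightarrow> norm (g tau)
      \<le> C / sqrt tau"
  shows "set_integrable lborel {0..t} (\<lambda>tau. exp (- (t - tau) * symb k) *\<^sub>R g tau)"
    "(LINT tau:{0..t}|lborel. norm (exp (- (t - tau) * symb k) *\<^sub>R g tau)) \<le> C * Phi k t"
    "norm (duhamel k g t) \<le> C * Phi k t"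
proof -
  have P: "set_integrable lborel {0..t} (\<lambda>tau. C * (exp (- (t - tau) * symb k) / sqrt tau))"
    by (rule set_integrable_mult_right) (rule Phi_integrable)
  have le: "norm (exp (- (t - tau) * symb k) *\<^sub>R g tau)
      \<le> C * (exp (- (t - tau) * symb k) / sqrt tau)" if "tau \<in> {0..t}" for tau
    using mult_left_mono[OF g[of tau], of "exp (- (t - tau) * symb k)"] that by (simp add: mult_ac)
  show i: "set_integrable lborel {0..t} (\<lambda>tau. exp (- (t - tau) * symb k) *\<^sub>R g tau)"
  proof (rule set_integrable_bound[OF P])
    show "AE tau in lborel. tau \<in> {0..t} \<longrightarrow> norm (exp (- (t - tau) * symb k) *\<^sub>R g tau)
        \<le> norm (C * (exp (- (t - tau) * symb k) / sqrt tau))"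
      using le by (intro AE_I2) (smt (verit) real_norm_def)
  qed (simp add: set_borel_measurable_def)
  have "(LINT tau:{0..t}|lborel. norm (exp (- (t - tau) * symb k) *\<^sub>R g tau))
      \<le> (LINT tau:{0..t}|lborel. C * (exp (- (t - tau) * symb k) / sqrt tau))"
    by (intro set_integral_mono set_integrable_norm i P le)
  also have "\<dots> = C * Phi k t" unfolding Phi_def by (rule set_integral_mult_right)
  finally show le2: "(LINT tau:{0..t}|lborel. norm (exp (- (t - tau) * symb k) *\<^sub>R g tau))
      \<le> C * Phi k t" .
  show "norm (duhamel k g t) \<le> C * Phi k t"
    unfolding duhamel_def by (rule order_trans[OF set_integral_norm_bound[OF i] le2])
qed

lemma duhamel_diff:
  assumes "set_integrable lborel {0..t} (\<lambda>tau. exp (- (t - tau) * symb k) *\<^sub>R g tau)"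
    "set_integrable lborel {0..t} (\<lambda>tau. exp (- (t - tau) * symb k) *\<^sub>R h tau)"
  shows "duhamel k g t - duhamel k h t = duhamel k (\<lambda>tau. g tau - h tau) t"
  unfolding duhamel_def scaleR_right_diff_distrib
    by (rule set_integral_diff(2)[OF assms, symmetric])

lemma duhamel_measurable [measurable]:
  assumes [measurable]: "g \<in> borel_measurable borel"
  shows "duhamel k g \<in> borel_measurable borel"
proof -
  have "(\<lambda>t. LINT tau|lborel. (if 0 \<le> tau \<and> tau
      \<le> t then exp (- (t - tau) * symb k) *\<^sub>R g tau else 0)) \<in> borel_measurable borel"
    by (rule lborel.borel_measurable_lebesgue_integral) measurable
  moreover have "duhamel k g t = (LINT tau|lborel. (if 0 \<le> tau \<and> tau
      \<le> t then exp (- (t - tau) * symb k) *\<^sub>R g tau else 0))" for t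
    unfolding duhamel_def set_lebesgue_integral_def
    by (intro Bochner_Integration.integral_cong) (auto simp: indicator_def)
  ultimately show ?thesis by (simp add: fun_eq_iff cong: measurable_cong)
qed

text \<open>
  The Fourier coefficients of the squared gradient. The sign is the square of the imaginary
  unit, one factor from each derivative.
\<close>

definition quad :: "(int \<times> int \<Rightarrow> complex) \<Rightarrow> int \<times> int \<Rightarrow> complex" where
  "quad v k = - (\<Sum>\<^sub>\<infinity>m. of_real (wv m \<bullet> wv (k - m)) * v m * v (k - m))"

lemma quad_uminus:
  assumes "\<And>k. v (- k) = cnj (v k)"
  shows "quad v (- k) = cnj (quad v k)"
proof -
  have "quad v (- k) = - (\<Sum>\<^sub>\<infinity>m. of_real (wv (- m) \<bullet> wv (- k - (- m))) * v (- m) * v (- k - (- m)))"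
    unfolding quad_def
    by (subst infsum_reindex_bij_betw[of uminus UNIV UNIV, symmetric]) (auto intro!:
        bij_betw_byWitness[of _ uminus])
  also have "\<dots> = - (\<Sum>\<^sub>\<infinity>m. cnj (of_real (wv m \<bullet> wv (k - m)) * v m * v (k - m)))"
  proof -
    have "of_real (wv (- m) \<bullet> wv (- k - (- m))) * v (- m) * v (- k - (- m))
        = cnj (of_real (wv m \<bullet> wv (k - m)) * v m * v (k - m))" for m
      using assms[of m] assms[of "k - m"] by (simp add: inner_diff_right)
    then show ?thesis by simp
  qed
  also have "\<dots> = cnj (quad v k)" by (simp add: quad_def infsum_cnj[symmetric])
  finally show ?thesis .
qed

lemma duhamel_uminus:
  assumes "\<And>tau. h tau = cnj (g tau)"
  shows "duhamel (- k) h t = cnj (duhamel k g t)"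
  unfolding duhamel_def set_lebesgue_integral_def assms
  by (subst Bochner_Integration.integral_cnj[symmetric]) simp

end

section \<open>Picard iteration for small data\<close>

text \<open>
  Here \<open>a\<close> are the Fourier coefficients of the initial data and \<open>eps\<close> is the radius of the ball in
  which the solution is sought. For every member of the ball \<open>env k / t^(1/4)\<close> dominates \<open>wn k\<close>
  times its coefficient; the constant mode is left out of \<open>env\<close> because \<open>wn 0 = 0\<close>. Of the two
  smallness conditions, \<open>env_small\<close> makes the Duhamel map preserve the ball; together with
  \<open>eps_small\<close> it makes the map a contraction.
\<close>

locale ks_small_data = ks_torus +
  fixes a :: "int \<times> int \<Rightarrow> complex" and eps :: real and env :: "int \<times> int \<Rightarrow> real"
  assumes eps_pos: "0 < eps"
    and env_def: "\<And>k. env k = (if k = 0 then 0 else norm (a k)) / root4 gap + eps * (decay_const *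
        inverse (wn k) ^ 2)"
    and env_summable: "(\<lambda>k. (env k)\<^sup>2) summable_on UNIV"
    and env_small: "(\<Sum>\<^sub>\<infinity>k. (env k)\<^sup>2) \<le> 2 * eps"
    and eps_small: "32 * eps * (\<Sum>\<^sub>\<infinity>k. (decay_const * inverse (wn k) ^ 2)\<^sup>2) \<le> 1"
begin

text \<open>
  Nonlinear parts are measured against \<open>Phi\<close>, mode by mode and time by time. As \<open>Phi\<close> and \<open>lin_flow\<close>
  vanish for \<open>t \<le> 0\<close>, members of the ball vanish there too. Measurability in time suffices for the
  iteration; continuity is recovered at the end from the integral equation.
\<close>

definition in_ball :: "(int \<times> int \<Rightarrow> real \<Rightarrow> complex) \<Rightarrow> bool" where
  "in_ball u \<longleftrightarrow> (\<forall>k. u k \<in> borel_measurable borel) \<and> (\<forall>k t. norm (u k t - lin_flow a k t)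
      \<le> eps * Phi k t)"

lemma in_ballD:
  assumes "in_ball u"
  shows "u k \<in> borel_measurable borel" "norm (u k t - lin_flow a k t) \<le> eps * Phi k t"
  using assms unfolding in_ball_def by blast+

lemma in_ball_nonpos:
  assumes "in_ball u" "t \<le> 0"
  shows "u k t = 0"
proof -
  have "norm (u k t - lin_flow a k t) \<le> eps * Phi k t" using assms(1) unfolding in_ball_def by blast
  then show ?thesis using assms(2) by (simp add: lin_flow_def)
qed

lemma in_ball_env:
  assumes u: "in_ball u" and t: "0 < t"
  shows "wn k * norm (u k t) \<le> env k / root4 t"
proof (cases "k = 0")
  case False
  have "norm (u k t) \<le> norm (lin_flow a k t) + eps * Phi k t"
  proof -
    have "norm (u k t - lin_flow a k t) \<le> eps * Phi k t" using u unfolding in_ball_def by blast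
    then show ?thesis using norm_triangle_ineq2[of "u k t" "lin_flow a k t"] by linarith
  qed
  then have "wn k * norm (u k t) \<le> wn k * (norm (lin_flow a k t) + eps * Phi k t)"
    by (rule mult_left_mono) simp
  also have "\<dots> = wn k * exp (- t * symb k) * norm (a k) + eps * (wn k * Phi k t)"
    using t by (simp add: lin_flow_def norm_mult algebra_simps)
  also have "\<dots> \<le> 1 / (root4 gap * root4 t) * norm (a k) + eps * (decay_const * inverse (wn k) ^ 2
      / root4 t)"
    using eps_pos by (intro add_mono mult_right_mono mult_left_mono wn_exp_le wn_Phi_le t) auto
  also have "\<dots> = env k / root4 t" using False by (simp add: env_def add_divide_distrib)
  finally show ?thesis .
qed (use t eps_pos in \<open>simp add: env_def\<close>)

lemma env_scaled:
  assumes "0 < t"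
  shows "(\<lambda>k. (env k / root4 t)\<^sup>2) summable_on UNIV" "(\<Sum>\<^sub>\<infinity>k. (env k / root4 t)\<^sup>2)
      \<le> 2 * eps / sqrt t"
proof -
  have q: "(env k / root4 t)\<^sup>2 = (env k)\<^sup>2 * (1 / sqrt t)" for k
    using root4_simps[of t] assms by (simp add: power_divide power2_eq_square)
  show "(\<lambda>k. (env k / root4 t)\<^sup>2) summable_on UNIV"
    unfolding q by (rule summable_on_cmult_left[OF env_summable])
  show "(\<Sum>\<^sub>\<infinity>k. (env k / root4 t)\<^sup>2) \<le> 2 * eps / sqrt t"
    unfolding q infsum_cmult_left' using env_small assms by (simp add: divide_right_mono)
qed

lemma quad_term_bound:
  fixes x y :: complex
  shows "norm (of_real (wv m \<bullet> wv (k - m)) * x * y) \<le> (wn m * norm x) * (wn (k - m) * norm y)"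
proof -
  have "\<bar>wv m \<bullet> wv (k - m)\<bar> * (norm x * norm y) \<le> (wn m * wn (k - m)) * (norm x * norm y)"
    unfolding wn_def by (rule mult_right_mono[OF Cauchy_Schwarz_ineq2]) simp
  then show ?thesis by (simp only: norm_mult norm_of_real mult_ac)
qed

text \<open>
  A convolution of two sequences bounded by \<open>env k / t^(1/4)\<close>. Nothing but the bound \<open>1 / sqrt t\<close> is
  kept: decay in \<open>k\<close> comes back from the Duhamel integral.
\<close>

lemma quad_in_ball:
  assumes u: "in_ball u"
  shows "(\<lambda>m. of_real (wv m \<bullet> wv (k - m)) * u m t * u (k - m) t) summable_on UNIV"
    and "0 \<le> t \<Longrightarrow> norm (quad (\<lambda>m. u m t) k) \<le> 2 * eps / sqrt t"
proof -
  have *: "(\<lambda>m. of_real (wv m \<bullet> wv (k - m)) * u m t * u (k - m) t) summable_on UNIV \<and>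
    norm (quad (\<lambda>m. u m t) k) \<le> 2 * eps / sqrt t" if "0 < t"
  proof -
    note c = infsum_convolution_bound[of "\<lambda>m. wn m * norm (u m t)" "\<lambda>m. env m / root4 t" "\<lambda>m. wn m
        * norm (u m t)"
        "\<lambda>m. env m / root4 t", OF _ in_ball_env[OF u that] _ in_ball_env[OF u that] env_scaled[OF
            that] env_scaled[OF that], of 1 k]
    have "(\<lambda>m. of_real (wv m \<bullet> wv (k - m)) * u m t * u (k - m) t) summable_on UNIV"
      by (rule norm_infsum_bound_le(2)[OF c(1) quad_term_bound]) auto
    moreover have "norm (\<Sum>\<^sub>\<infinity>m. of_real (wv m \<bullet> wv (k - m)) * u m t * u (k - m) t)
        \<le> 2 * eps / sqrt t"
      using norm_infsum_bound_le(3)[OF c(1) quad_term_bound] c(2) by fastforce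
    ultimately show ?thesis by (simp add: quad_def)
  qed
  have z: "u m t = 0" if "\<not> 0 < t" for m using in_ball_nonpos[OF u] that by simp
  show "(\<lambda>m. of_real (wv m \<bullet> wv (k - m)) * u m t * u (k - m) t) summable_on UNIV"
    using * z by (cases "0 < t") auto
  show "norm (quad (\<lambda>m. u m t) k) \<le> 2 * eps / sqrt t" if "0 \<le> t"
    using * z that by (cases "0 < t") (auto simp: quad_def)
qed

lemma quad_measurable:
  assumes u: "in_ball u"
  shows "(\<lambda>t. quad (\<lambda>m. u m t) k) \<in> borel_measurable borel"
  unfolding quad_def
  by (intro borel_measurable_uminus borel_measurable_infsum quad_in_ball(1) borel_measurable_times
      borel_measurable_const in_ballD(1)[OF u] u)

text \<open>
  The difference of the two quadratic terms is a convolution of \<open>u - v\<close> with \<open>u\<close> plus one of \<open>v\<close> with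
  \<open>u - v\<close>. In each of them one factor is bounded by the envelope and the other one gains \<open>|k|^(-2)\<close>
  from \<open>wn_Phi_le\<close>; \<open>eps_small\<close> bounds the resulting factor.
\<close>

lemma quad_lipschitz:
  assumes u: "in_ball u" and v: "in_ball v" and d: "0 < d"
    and uv: "\<And>k t. norm (u k t - v k t) \<le> d * Phi k t" and t: "0 \<le> t"
  shows "norm (quad (\<lambda>m. u m t) k - quad (\<lambda>m. v m t) k) \<le> (d / 2) / sqrt t"
proof (cases "0 < t")
  case False
  then show ?thesis using t in_ball_nonpos[OF u] in_ball_nonpos[OF v] by (simp add: quad_def)
next
  case True
  have q: "root4 t > 0" "root4 t * root4 t = sqrt t" using root4_simps True by auto
  define D where "D m = u m t - v m t" for m
  define S where "S = (\<Sum>\<^sub>\<infinity>k. (decay_const * inverse (wn k) ^ 2)\<^sup>2)"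
  let ?p = "\<lambda>m. d * (decay_const * inverse (wn m) ^ 2) / root4 t"
  have pD: "wn m * norm (D m) \<le> ?p m" for m
  proof -
    have "wn m * norm (D m) \<le> wn m * (d * Phi m t)"
      unfolding D_def by (intro mult_left_mono uv) simp
    also have "\<dots> = d * (wn m * Phi m t)" by simp
    also have "\<dots> \<le> d * (decay_const * inverse (wn m) ^ 2 / root4 t)"
      using d by (intro mult_left_mono wn_Phi_le True) auto
    finally show ?thesis by simp
  qed
  have pe: "(?p m)\<^sup>2 = (d\<^sup>2 / sqrt t) * (decay_const * inverse (wn m) ^ 2)\<^sup>2" for m
    unfolding power_divide power_mult_distrib power2_eq_square[of "root4 t"] q(2) by simp
  have S: "(\<lambda>k. (decay_const * inverse (wn k) ^ 2)\<^sup>2) summable_on UNIV"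
    using summable_on_cmult_right[OF lattice_sum_4, of "decay_const\<^sup>2"]
    by (simp add: power_mult_distrib power_mult[symmetric])
  have p: "(\<lambda>m. (?p m)\<^sup>2) summable_on UNIV" "(\<Sum>\<^sub>\<infinity>m. (?p m)\<^sup>2) \<le> d\<^sup>2 * S / sqrt t"
    unfolding pe S_def infsum_cmult_right' using summable_on_cmult_right[OF S] by blast (simp add:
        mult_ac)
  \<comment> \<open>This weight makes the two terms of the convolution bound comparable.\<close>
  have half: "(x * (d\<^sup>2 * S / sqrt t) + 2 * eps / sqrt t / x) / 2 \<le> (d / 4) / sqrt t"
      if "x = 8 * eps / d" for x
  proof -
    have "x * (d\<^sup>2 * S / sqrt t) + 2 * eps / sqrt t / x = d * (8 * eps * S + 1 / 4) / sqrt t"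
      using d eps_pos True by (simp add: that field_simps power2_eq_square)
    also have "\<dots> \<le> d * (1 / 4 + 1 / 4) / sqrt t"
      using eps_small d True by (intro divide_right_mono mult_left_mono) (auto simp: S_def)
    finally show ?thesis by simp
  qed
  let ?x = "8 * eps / d"
  have x: "0 < ?x" and x': "0 < 1 / ?x" using d eps_pos by auto
  have nn: "0 \<le> wn m * norm z" for m and z :: complex by simp
  note c1 = infsum_convolution_bound[OF nn pD nn in_ball_env[OF u True] p env_scaled[OF True] x,
      of k]
  note c2 = infsum_convolution_bound[OF nn in_ball_env[OF v True] nn pD env_scaled[OF True] p x',
      of k]
  let ?T1 = "\<lambda>m. of_real (wv m \<bullet> wv (k - m)) * D m * u (k - m) t"
  let ?T2 = "\<lambda>m. of_real (wv m \<bullet> wv (k - m)) * v m t * D (k - m)"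
  have b1: "norm (\<Sum>\<^sub>\<infinity>m. ?T1 m) \<le> (d / 4) / sqrt t"
    using norm_infsum_bound_le(3)[OF c1(1) quad_term_bound] c1(2) half[OF refl] by fastforce
  have "norm (\<Sum>\<^sub>\<infinity>m. ?T2 m) \<le> (1 / ?x * (2 * eps / sqrt t) + d\<^sup>2 * S / sqrt t / (1 / ?x)) / 2"
    by (rule order_trans[OF norm_infsum_bound_le(3)[OF c2(1) quad_term_bound] c2(2)])
  also have "\<dots> = (?x * (d\<^sup>2 * S / sqrt t) + 2 * eps / sqrt t / ?x) / 2"
    by (simp add: add.commute mult.commute)
  also have "\<dots> \<le> (d / 4) / sqrt t" by (rule half[OF refl])
  finally have b2: "norm (\<Sum>\<^sub>\<infinity>m. ?T2 m) \<le> (d / 4) / sqrt t" .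
  have s1: "?T1 summable_on UNIV" by (rule norm_infsum_bound_le(2)[OF c1(1) quad_term_bound])
  have s2: "?T2 summable_on UNIV"
    by (rule norm_infsum_bound_le(2)[OF c2(1) quad_term_bound])
  have "quad (\<lambda>m. u m t) k - quad (\<lambda>m. v m t) k
      = - ((\<Sum>\<^sub>\<infinity>m. of_real (wv m \<bullet> wv (k - m)) * u m t * u (k - m) t)
         - (\<Sum>\<^sub>\<infinity>m. of_real (wv m \<bullet> wv (k - m)) * v m t * v (k - m) t))"
    by (simp add: quad_def)
  also have "(\<Sum>\<^sub>\<infinity>m. of_real (wv m \<bullet> wv (k - m)) * u m t * u (k - m) t)
      = (\<Sum>\<^sub>\<infinity>m. of_real (wv m \<bullet> wv (k - m)) * v m t * v (k - m) t + (?T1 m + ?T2 m))"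
    by (intro infsum_cong) (simp add: D_def algebra_simps)
  also have "\<dots> = (\<Sum>\<^sub>\<infinity>m. of_real (wv m \<bullet> wv (k - m)) * v m t * v (k - m) t) + ((\<Sum>\<^sub>\<infinity>m. ?T1 m) +
      (\<Sum>\<^sub>\<infinity>m. ?T2 m))"
    by (simp only: infsum_add[OF quad_in_ball(1)[OF v] summable_on_add[OF s1 s2]] infsum_add[OF s1
        s2])
  finally have "quad (\<lambda>m. u m t) k - quad (\<lambda>m. v m t) k = - ((\<Sum>\<^sub>\<infinity>m. ?T1 m) + (\<Sum>\<^sub>\<infinity>m. ?T2 m))"
    by simp
  then have "norm (quad (\<lambda>m. u m t) k - quad (\<lambda>m. v m t) k) \<le> (d / 4) / sqrt t + (d / 4) / sqrt t"
    using b1 b2 norm_triangle_ineq[of "\<Sum>\<^sub>\<infinity>m. ?T1 m" "\<Sum>\<^sub>\<infinity>m. ?T2 m"] by (simp only: norm_minus_cancel)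
  then show ?thesis by (simp add: add_divide_distrib[symmetric])
qed

definition picard_map :: "(int \<times> int \<Rightarrow> real \<Rightarrow> complex) \<Rightarrow> int \<times> int \<Rightarrow> real \<Rightarrow> complex" where
  "picard_map u k t = lin_flow a k t - duhamel k (\<lambda>tau. quad (\<lambda>m. u m tau) k) t / 2"

lemma duhamel_quad:
  assumes u: "in_ball u"
  shows "set_integrable lborel {0..t} (\<lambda>tau. exp (- (t - tau) * symb k) *\<^sub>R quad (\<lambda>m. u m tau) k)"
    "norm (duhamel k (\<lambda>tau. quad (\<lambda>m. u m tau) k) t) \<le> 2 * eps * Phi k t"
  using duhamel_bound[OF quad_measurable[OF u] quad_in_ball(2)[OF u]] by auto

lemma picard_map_ball:
  assumes u: "in_ball u"
  shows "in_ball (picard_map u)"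
  unfolding in_ball_def
proof (intro conjI allI)
  fix k t
  show "picard_map u k \<in> borel_measurable borel"
    using quad_measurable[OF u] unfolding picard_map_def[abs_def] by measurable
  show "norm (picard_map u k t - lin_flow a k t) \<le> eps * Phi k t"
    using duhamel_quad(2)[OF u, of k t] by (simp add: picard_map_def norm_divide)
qed

lemma picard_map_contracts:
  assumes u: "in_ball u" and v: "in_ball v" and d: "0 < d"
    and uv: "\<And>k t. norm (u k t - v k t) \<le> d * Phi k t"
  shows "norm (picard_map u k t - picard_map v k t) \<le> d / 2 * Phi k t"
proof -
  have "picard_map u k t - picard_map v k t
      = - (duhamel k (\<lambda>tau. quad (\<lambda>m. u m tau) k - quad (\<lambda>m. v m tau) k) t) / 2"
    by (simp add: picard_map_def duhamel_diff[OF duhamel_quad(1)[OF u] duhamel_quad(1)[OF v],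
        symmetric] diff_divide_distrib)
  moreover have "norm (duhamel k (\<lambda>tau. quad (\<lambda>m. u m tau) k - quad (\<lambda>m. v m tau) k) t)
      \<le> d / 2 * Phi k t"
    using quad_measurable[OF u] quad_measurable[OF v]
    by (intro duhamel_bound(3) borel_measurable_diff quad_lipschitz[OF u v d uv])
  ultimately have "norm (picard_map u k t - picard_map v k t) \<le> d / 2 * Phi k t / 2"
    by (simp add: norm_divide)
  moreover have "0 \<le> d / 2 * Phi k t" using Phi_nonneg[of k t] d by simp
  ultimately show ?thesis by linarith
qed

fun picard :: "nat \<Rightarrow> int \<times> int \<Rightarrow> real \<Rightarrow> complex" where
  "picard 0 = lin_flow a"
| "picard (Suc n) = picard_map (picard n)"

lemma picard_in_ball: "in_ball (picard n)"
  by (induction n) (auto intro!: picard_map_ball simp: in_ball_def[of "lin_flow a"] eps_pos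
      less_imp_le Phi_nonneg)

lemma picard_step: "norm (picard (Suc n) k t - picard n k t) \<le> eps / 2 ^ n * Phi k t"
proof (induction n arbitrary: k t)
  case 0
  then show ?case using in_ballD(2)[OF picard_in_ball[of 1]] by simp
next
  case (Suc n)
  then show ?case
    using picard_map_contracts[OF picard_in_ball picard_in_ball _ Suc.IH] eps_pos
      by (simp add: mult.commute)
qed

lemma picard_distance:
  assumes "n \<le> m"
  shows "norm (picard m k t - picard n k t) \<le> (2 * eps / 2 ^ n - 2 * eps / 2 ^ m) * Phi k t"
  using assms
proof (induction m rule: dec_induct)
  case (step m)
  have "norm (picard (Suc m) k t - picard n k t)
      \<le> norm (picard (Suc m) k t - picard m k t) + norm (picard m k t - picard n k t)"
    by (metis diff_add_cancel add_diff_eq norm_triangle_ineq)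
  also have "\<dots> \<le> eps / 2 ^ m * Phi k t + (2 * eps / 2 ^ n - 2 * eps / 2 ^ m) * Phi k t"
    by (intro add_mono picard_step step)
  also have "\<dots> = (2 * eps / 2 ^ n - 2 * eps / 2 ^ Suc m) * Phi k t"
    by (simp add: algebra_simps)
  finally show ?case .
qed simp

lemma picard_Cauchy_bound:
  assumes "n \<le> m"
  shows "norm (picard m k t - picard n k t) \<le> 2 * eps / 2 ^ n * Phi k t"
proof -
  have "(2 * eps / 2 ^ n - 2 * eps / 2 ^ m) * Phi k t \<le> 2 * eps / 2 ^ n * Phi k t"
    using eps_pos by (intro mult_right_mono Phi_nonneg) auto
  then show ?thesis using picard_distance[OF assms, of k t] by linarith
qed

lemma geometric_to_0: "(\<lambda>n. c / 2 ^ n * P :: real) \<longlonglongrightarrow> 0"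
proof -
  have "(\<lambda>n. c * P * (1 / 2) ^ n) \<longlonglongrightarrow> c * P * 0"
    by (intro tendsto_mult_left LIMSEQ_power_zero) simp
  then show ?thesis by (simp add: power_divide)
qed

lemma picard_converges: "\<exists>l. (\<lambda>n. picard n k t) \<longlonglongrightarrow> l"
proof -
  have "Cauchy (\<lambda>n. picard n k t)"
  proof (rule CauchyI)
    fix e :: real assume "0 < e"
    then obtain N where N: "2 * (2 * eps) / 2 ^ N * Phi k t < e"
      using order_tendstoD(2)[OF geometric_to_0]
        by (metis (no_types, lifting) eventually_happens' sequentially_bot)
    have "norm (picard m k t - picard n k t) < e" if "N \<le> m" "N \<le> n" for m n
    proof -
      have "norm (picard m k t - picard n k t)
          \<le> norm (picard m k t - picard N k t) + norm (picard n k t - picard N k t)"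
        using norm_triangle_ineq4[of "picard m k t - picard N k t" "picard n k t - picard N k t"]
          by simp
      also have "\<dots> \<le> 2 * eps / 2 ^ N * Phi k t + 2 * eps / 2 ^ N * Phi k t"
        by (intro add_mono picard_Cauchy_bound that)
      finally show ?thesis using N by simp
    qed
    then show "\<exists>M. \<forall>m\<ge>M. \<forall>n\<ge>M. norm (picard m k t - picard n k t) < e" by blast
  qed
  then show ?thesis using Cauchy_convergent_iff convergent_def by blast
qed

definition sol :: "int \<times> int \<Rightarrow> real \<Rightarrow> complex" where
  "sol k t = lim (\<lambda>n. picard n k t)"

lemma picard_tendsto: "(\<lambda>n. picard n k t) \<longlonglongrightarrow> sol k t"
  using picard_converges[of k t] by (auto simp: sol_def limI)

lemma sol_picard: "norm (sol k t - picard n k t) \<le> 2 * eps / 2 ^ n * Phi k t"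
proof (rule Lim_bounded)
  show "(\<lambda>m. norm (picard m k t - picard n k t)) \<longlonglongrightarrow> norm (sol k t - picard n k t)"
    by (intro tendsto_intros picard_tendsto)
qed (use picard_Cauchy_bound in blast)

lemma sol_in_ball: "in_ball sol"
  unfolding in_ball_def
proof (intro conjI allI)
  fix k t
  show "sol k \<in> borel_measurable borel"
    by (rule borel_measurable_LIMSEQ_metric[OF in_ballD(1)[OF picard_in_ball] picard_tendsto])
  show "norm (sol k t - lin_flow a k t) \<le> eps * Phi k t"
  proof (rule Lim_bounded)
    show "(\<lambda>n. norm (picard n k t - lin_flow a k t)) \<longlonglongrightarrow> norm (sol k t - lin_flow a k t)"
      by (intro tendsto_intros picard_tendsto)
  qed (use in_ballD(2)[OF picard_in_ball] in blast)
qed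

text \<open>
  The iterates converge geometrically relative to \<open>Phi\<close>, and the Duhamel map is Lipschitz relative
  to \<open>Phi\<close>, so both sides of the equation are limits of consecutive iterates.
\<close>

theorem sol_fixed_point: "sol k t = lin_flow a k t - duhamel k (\<lambda>tau. quad (\<lambda>m. sol m tau) k) t / 2"
proof -
  have "norm (sol k t - picard_map sol k t) \<le> 2 * (2 * eps) / 2 ^ n * Phi k t" for n
  proof -
    define Q where "Q = eps / 2 ^ n * Phi k t"
    have "norm (picard (Suc n) k t - picard_map sol k t) \<le> (2 * eps / 2 ^ n) / 2 * Phi k t"
      unfolding picard.simps using eps_pos sol_picard
      by (intro picard_map_contracts picard_in_ball sol_in_ball) (auto simp: norm_minus_commute)
    moreover have "norm (sol k t - picard (Suc n) k t) \<le> 2 * eps / 2 ^ Suc n * Phi k t"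
      by (rule sol_picard)
    moreover have "norm (sol k t - picard_map sol k t)
        \<le> norm (sol k t - picard (Suc n) k t) + norm (picard (Suc n) k t - picard_map sol k t)"
      by (metis diff_add_cancel add_diff_eq norm_triangle_ineq)
    moreover have Q: "(2 * eps / 2 ^ n) / 2 * Phi k t = Q" "2 * eps / 2 ^ Suc n * Phi k t = Q"
      "2 * (2 * eps) / 2 ^ n * Phi k t = 4 * Q"
      by (simp_all add: Q_def)
    moreover have "0 \<le> Q" unfolding Q_def using eps_pos Phi_nonneg
      by (intro mult_nonneg_nonneg) auto
    ultimately show ?thesis unfolding Q by linarith
  qed
  then have "norm (sol k t - picard_map sol k t) \<le> 0"
    by (intro LIMSEQ_le_const[OF geometric_to_0]) auto
  then show ?thesis by (simp add: picard_map_def)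
qed

text \<open>
  Real data have real solutions: the symmetry holds for the linear flow and is inherited by each
  iterate.
\<close>

lemma sol_uminus:
  assumes a: "\<And>k. a (- k) = cnj (a k)"
  shows "sol (- k) t = cnj (sol k t)"
proof -
  have "picard n (- k) t = cnj (picard n k t)" for n k t
  proof (induction n arbitrary: k t)
    case 0
    then show ?case by (simp add: lin_flow_def a)
  next
    case (Suc n)
    have "lin_flow a (- k) t = cnj (lin_flow a k t)" by (simp add: lin_flow_def a)
    moreover have "duhamel (- k) (\<lambda>tau. quad (\<lambda>m. picard n m tau) (- k)) t
        = cnj (duhamel k (\<lambda>tau. quad (\<lambda>m. picard n m tau) k) t)"
      by (intro duhamel_uminus quad_uminus Suc.IH)
    ultimately show ?case by (simp add: picard_map_def)
  qed
  then have "(\<lambda>n. cnj (picard n k t)) \<longlonglongrightarrow> sol (- k) t"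
    using picard_tendsto[of "- k" t] by simp
  moreover have "(\<lambda>n. cnj (picard n k t)) \<longlonglongrightarrow> cnj (sol k t)"
    by (intro tendsto_intros picard_tendsto)
  ultimately show ?thesis by (rule LIMSEQ_unique)
qed

end

section \<open>Bochner integrals of Fourier series\<close>

lemma simple_L2_integral_eq:
  assumes M: "finite_measure M" and s: "simple_function M s"
  shows "integrable M (\<lambda>tau. s tau x)" "simple_L2_integral M s x = (LINT tau|M. s tau x)"
proof -
  interpret finite_measure M by (rule M)
  have fin: "finite (s ` space M)" by (rule simple_functionD(1)[OF s])
  have meas: "{tau \<in> space M. s tau = y} \<in> sets M" for y
  proof -
    have "{tau \<in> space M. s tau = y} = s -` {y} \<inter> space M" by auto
    then show ?thesis using simple_functionD(2)[OF s, of "{y}"] by simp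
  qed
  have eq: "s tau x = (\<Sum>y\<in>s ` space M. indicator {tau \<in> space M. s tau = y} tau * y x)"
      if "tau \<in> space M" for tau
  proof -
    have "(\<Sum>y\<in>s ` space M. indicator {tau \<in> space M. s tau = y} tau * y x) = (\<Sum>y\<in>s ` space M. if y
        = s tau then y x else 0)"
      using that by (intro sum.cong) (auto simp: indicator_def)
    then show ?thesis using that fin by (simp add: sum.delta')
  qed
  have i: "integrable M (\<lambda>tau. indicator {tau \<in> space M. s tau = y} tau * y x)" for y
    using meas by (intro integrable_mult_left integrable_real_indicator) (auto simp:
        emeasure_eq_measure)
  have "integrable M (\<lambda>tau. \<Sum>y\<in>s ` space M. indicator {tau \<in> space M. s tau = y} tau * y x)"
    by (intro Bochner_Integration.integrable_sum i)
  then show "integrable M (\<lambda>tau. s tau x)"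
    by (rule Bochner_Integration.integrable_cong[THEN iffD1, rotated -1]) (auto simp: eq)
  have "(LINT tau|M. s tau x) = (LINT tau|M. (\<Sum>y\<in>s ` space M. indicator {tau \<in> space M. s tau
      = y} tau * y x))"
    by (intro Bochner_Integration.integral_cong) (auto simp: eq)
  also have "\<dots> = (\<Sum>y\<in>s ` space M. LINT tau|M. indicator {tau \<in> space M. s tau = y} tau * y x)"
    by (intro Bochner_Integration.integral_sum i)
  also have "\<dots> = (\<Sum>y\<in>s ` space M. measure M {tau \<in> space M. s tau = y} * y x)"
    using meas by (intro sum.cong) auto
  finally show "simple_L2_integral M s x = (LINT tau|M. s tau x)"
    by (simp add: simple_L2_integral_def)
qed

lemma integrable_simple_approximation:
  fixes f :: "'t \<Rightarrow> 'b::{banach, second_countable_topology}"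
  assumes f: "integrable M f" and e: "0 < e"
  shows "\<exists>s. simple_function M s \<and> integrable M s \<and> (LINT tau|M. norm (f tau - s tau)) \<le> e"
proof -
  have [measurable]: "f \<in> borel_measurable M" using f by auto
  obtain S where "(\<forall>i. simple_function M (S i)) \<and> (\<forall>x\<in>space M. (\<lambda>i. S i x) \<longlonglongrightarrow> f x) \<and>
      (\<forall>i. \<forall>x\<in>space M. norm (S i x) \<le> 2 * norm (f x))"
    using borel_measurable_implies_sequence_metric[of f M 0]
      unfolding dist_norm diff_0_right by auto
  then have S: "\<And>i. simple_function M (S i)" "\<And>x. x \<in> space M \<Longrightarrow> (\<lambda>i. S i x) \<longlonglongrightarrow> f x"
    "\<And>i x. x \<in> space M \<Longrightarrow> norm (S i x) \<le> 2 * norm (f x)"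
    by blast+
  have [measurable]: "S i \<in> borel_measurable M" for i
    by (rule borel_measurable_simple_function[OF S(1)])
  have "(\<lambda>i. LINT x|M. norm (f x - S i x)) \<longlonglongrightarrow> (LINT x|M. 0)"
  proof (rule integral_dominated_convergence[where w="\<lambda>x. 3 * norm (f x)"])
    show "AE x in M. (\<lambda>i. norm (f x - S i x)) \<longlonglongrightarrow> 0"
    proof (rule AE_I2)
      fix x assume "x \<in> space M"
      then have "(\<lambda>i. norm (f x - S i x)) \<longlonglongrightarrow> norm (f x - f x)"
        by (intro tendsto_norm tendsto_diff tendsto_const S)
      then show "(\<lambda>i. norm (f x - S i x)) \<longlonglongrightarrow> 0" by simp
    qed
    show "AE x in M. norm (norm (f x - S i x)) \<le> 3 * norm (f x)" for i
    proof (rule AE_I2)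
      fix x assume "x \<in> space M"
      then show "norm (norm (f x - S i x)) \<le> 3 * norm (f x)"
        using norm_triangle_ineq4[of "f x" "S i x"] S(3)[of x i] by simp
    qed
  qed (use f in auto)
  then have conv: "(\<lambda>i. LINT x|M. norm (f x - S i x)) \<longlonglongrightarrow> 0" by simp
  then obtain i where "(LINT x|M. norm (f x - S i x)) < e"
    using order_tendstoD(2)[OF conv e] by (metis (no_types, lifting) eventually_happens'
        sequentially_bot)
  moreover have "integrable M (S i)"
    by (rule Bochner_Integration.integrable_bound[of M "\<lambda>x. 2 * norm (f x)"]) (use f S(3) in auto)
  ultimately show ?thesis using S(1) by (intro exI[of _ "S i"]) auto
qed

context rectangular_torus
begin

lemma square_integrable_Re_fseries:
  assumes "(\<lambda>k. norm (c k)) summable_on UNIV"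
  shows "square_integrable TT (\<lambda>x. Re (fseries c x))"
proof -
  have "\<bar>Re (fseries c x)\<bar> \<le> \<bar>\<Sum>\<^sub>\<infinity>k. norm (c k)\<bar>" for x
    using abs_Re_le_cmod[of "fseries c x"] norm_fseries_le[OF assms, of x] by linarith
  then have "(Re (fseries c x))\<^sup>2 \<le> (\<Sum>\<^sub>\<infinity>k. norm (c k))\<^sup>2" for x
    by (simp only: abs_le_square_iff)
  then show ?thesis
    unfolding square_integrable_def using measurable_TT[OF fseries_measurable[OF assms]]
    by (auto intro!: integrable_TT_bounded[of _ "(\<Sum>\<^sub>\<infinity>k. norm (c k))\<^sup>2"])
qed

lemma L2norm_Re_fseries_le:
  assumes "(\<lambda>k. norm (c k)) summable_on UNIV"
  shows "L2norm TT (\<lambda>x. Re (fseries c x)) \<le> sqrt (L1 * L2) * (\<Sum>\<^sub>\<infinity>k. norm (c k))"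
proof -
  let ?S = "\<Sum>\<^sub>\<infinity>k. norm (c k)"
  have S0: "0 \<le> ?S" by (rule infsum_nonneg) simp
  have b: "\<bar>Re (fseries c x)\<bar> \<le> \<bar>?S\<bar>" for x
    using abs_Re_le_cmod[of "fseries c x"] norm_fseries_le[OF assms, of x] by linarith
  have "norm (LINT x|TT. (Re (fseries c x))\<^sup>2) \<le> ?S\<^sup>2 * (L1 * L2)"
    using b abs_le_square_iff by (intro integral_TT_norm_bound) auto
  then have "L2norm TT (\<lambda>x. Re (fseries c x)) \<le> sqrt (?S\<^sup>2 * (L1 * L2))"
    unfolding L2norm_def by (intro real_sqrt_le_mono) simp
  then show ?thesis using S0 by (simp add: real_sqrt_mult mult.commute)
qed

lemma fourier_coeff_Re_fseries:
  assumes c: "(\<lambda>k. norm (c k)) summable_on UNIV"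
  shows "fourier_coeff L1 L2 (\<lambda>x. Re (fseries c x)) k = (c k + cnj (c (- k))) / 2"
proof (rule fourier_coeff_fseries)
  let ?d = "\<lambda>k. (c k + cnj (c (- k))) / 2"
  have "norm (?d k) \<le> norm (c k) + norm (c (- k))" for k
  proof -
    have "norm (?d k) = norm (c k + cnj (c (- k))) / 2" by (simp add: norm_divide)
    moreover have "norm (c k + cnj (c (- k))) \<le> norm (c k) + norm (c (- k))"
      using norm_triangle_ineq[of "c k" "cnj (c (- k))"] by simp
    ultimately show ?thesis using norm_ge_zero[of "c k"] norm_ge_zero[of "c (- k)"] by linarith
  qed
  then show d: "(\<lambda>k. norm (?d k)) summable_on UNIV"
    by (rule norm_infsum_bound_le(1)[OF summable_on_add[OF c summable_uminus[OF c]]])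
  have cc: "(\<lambda>k. norm (cnj (c (- k)))) summable_on UNIV" using summable_uminus[OF c] by simp
  have cd: "(\<lambda>k. norm (c k + cnj (c (- k)))) summable_on UNIV"
    using summable_on_cmult_right[OF d, of 2] by (simp add: norm_divide)
  fix x
  have "complex_of_real (Re (fseries c x)) = (1 / 2) * (fseries c x + fseries (\<lambda>k. cnj (c (- k)))
      x)"
    by (simp add: complex_eq_iff flip: cnj_fseries)
  also have "\<dots> = (1 / 2) * fseries (\<lambda>k. c k + cnj (c (- k))) x"
    by (simp only: fseries_linear(1)[OF c cc])
  also have "\<dots> = fseries (\<lambda>k. (1 / 2) * (c k + cnj (c (- k)))) x"
    by (rule fseries_linear(3)[OF cd cd, symmetric])
  finally show "complex_of_real (Re (fseries c x)) = fseries ?d x" by simp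
qed

text \<open>
  By Parseval's identity the norm is a function of a countable sum of measurable functions.
\<close>

lemma L2norm_Re_fseries_measurable:
  assumes [measurable]: "\<And>k. c k \<in> borel_measurable M"
    and c: "\<And>tau. tau \<in> space M \<Longrightarrow> (\<lambda>k. norm (c k tau)) summable_on UNIV"
  shows "(\<lambda>tau. L2norm TT (\<lambda>x. Re (fseries (\<lambda>k. c k tau) x))) \<in> borel_measurable M"
proof -
  let ?g = "\<lambda>k tau. (norm ((c k tau + cnj (c (- k) tau)) / 2))\<^sup>2"
  have [measurable]: "(\<lambda>tau. \<Sum>\<^sub>\<infinity>k. ?g k tau) \<in> borel_measurable M"
  proof (rule borel_measurable_infsum)
    have cnj: "cnj \<in> borel_measurable borel" by (intro borel_measurable_continuous_onI
        continuous_intros)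
    have [measurable]: "(\<lambda>tau. cnj (c k tau)) \<in> borel_measurable M" for k
      by (rule measurable_compose[OF assms(1) cnj])
    show "?g k \<in> borel_measurable M" for k by (intro borel_measurable_power borel_measurable_norm
        borel_measurable_divide borel_measurable_add) measurable
    show "(\<lambda>k. ?g k tau) summable_on UNIV" if "tau \<in> space M" for tau
      using parseval(1)[OF square_integrable_Re_fseries[OF c[OF that]]]
      unfolding fourier_coeff_Re_fseries[OF c[OF that]] .
  qed
  have "(\<lambda>tau. sqrt (L1 * L2 * (\<Sum>\<^sub>\<infinity>k. ?g k tau))) \<in> borel_measurable M" by measurable
  moreover have "L2norm TT (\<lambda>x. Re (fseries (\<lambda>k. c k tau) x)) = sqrt (L1 * L2 * (\<Sum>\<^sub>\<infinity>k. ?g k tau))"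
      if "tau \<in> space M" for tau
    unfolding L2norm_def parseval(2)[OF square_integrable_Re_fseries[OF c[OF that]]]
      fourier_coeff_Re_fseries[OF c[OF that]] ..
  ultimately show ?thesis by (subst measurable_cong) auto
qed

text \<open>
  The approximating simple functions are truncated Fourier series in which each coefficient is
  replaced by a simple function of time. Since the \<open>L\<^sup>2\<close> norm on the torus is bounded, up to a
  factor, by the sum of the absolute values of the coefficients, both error terms of the Bochner
  integral are controlled by the sum over \<open>k\<close> of the \<open>L\<^sup>1\<close> distances in time.
\<close>

theorem has_L2_bochner_integral_fseries:
  assumes M: "finite_measure M" and c: "\<And>k. integrable M (c k)"
    and cs: "\<And>tau. tau \<in> space M \<Longrightarrow> (\<lambda>k. norm (c k tau)) summable_on UNIV"
    and b: "\<And>k. (LINT tau|M. norm (c k tau)) \<le> b k" "b summable_on UNIV"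
    and F: "\<And>tau. tau \<in> space M \<Longrightarrow> F tau = (\<lambda>x. Re (fseries (\<lambda>k. c k tau) x))"
  shows "has_L2_bochner_integral M TT F (\<lambda>x. Re (fseries (\<lambda>k. LINT tau|M. c k tau) x))"
proof -
  interpret M: finite_measure M by (rule M)
  \<comment> \<open>The tolerance for one coefficient, so that the at most \<open>card (freq_box n)\<close> errors add up to less
      than \<open>1 / (n + 1)\<close>.\<close>
  define \<eta> where "\<eta> n = 1 / (real (Suc n) * real (Suc (card (freq_box n))))" for n
  have \<eta>: "0 < \<eta> n" "real (card (freq_box n)) * \<eta> n \<le> 1 / real (Suc n)" for n
  proof -
    show "0 < \<eta> n" by (simp add: \<eta>_def del: of_nat_Suc)
    have "real (card (freq_box n)) * \<eta> n = (real (card (freq_box n)) / real (Suc (card (freq_box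
        n)))) * (1 / real (Suc n))"
      by (simp add: \<eta>_def del: of_nat_Suc)
    also have "\<dots> \<le> 1 * (1 / real (Suc n))" by (rule mult_right_mono) auto
    finally show "real (card (freq_box n)) * \<eta> n \<le> 1 / real (Suc n)" by simp
  qed
  have "\<forall>k n. \<exists>s. simple_function M s \<and> integrable M s \<and> (LINT tau|M. norm (c k tau - s tau)) \<le> \<eta> n"
    using integrable_simple_approximation[OF c \<eta>(1)] by blast
  then obtain s where s: "\<And>k n. simple_function M (s k n)" "\<And>k n. integrable M (s k n)"
    "\<And>k n. (LINT tau|M. norm (c k tau - s k n tau)) \<le> \<eta> n"
    by metis
  define d where "d n k tau = (if k \<in> freq_box n then s k n tau else 0)" for n k tau
  define S where "S n tau x = Re (fseries (\<lambda>k. d n k tau) x)" for n tau x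
  \<comment> \<open>\<open>\<beta> n k\<close> bounds the error in the coefficient \<open>k\<close>: the tolerance inside the truncation, and the whole
      coefficient outside.\<close>
  define \<beta> where "\<beta> n k = b k + (if k \<in> freq_box n then \<eta> n - b k else 0)" for n k
  define r where "r n = (\<Sum>\<^sub>\<infinity>k. \<beta> n k)" for n
  have di: "integrable M (d n k)" for n k unfolding d_def
    by (cases "k \<in> freq_box n") (use s(2) in simp_all)
  have ds: "(\<lambda>k. norm (d n k tau)) summable_on UNIV" for n tau
    by (rule finite_nonzero_values_imp_summable_on)
       (auto simp: d_def intro: finite_subset[OF _ finite_freq_box[of n]])
  have \<delta>s: "(\<lambda>k. norm (c k tau - d n k tau)) summable_on UNIV" if "tau \<in> space M" for n tau
    by (rule norm_infsum_bound_le(1)[OF summable_on_add[OF cs[OF that] ds]]) (rule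
        norm_triangle_ineq4)
  have \<delta>b: "(LINT tau|M. norm (c k tau - d n k tau)) \<le> \<beta> n k" for n k
    using s(3)[of k n] b(1)[of k] by (auto simp: d_def \<beta>_def)
  have fsum: "((\<lambda>k. if k \<in> freq_box n then \<eta> n - b k else 0) has_sum (\<Sum>k\<in>freq_box n. \<eta> n - b k))
      UNIV" for n
    by (rule has_sum_finite_neutralI[of "freq_box n"]) auto
  have \<beta>s: "\<beta> n summable_on UNIV" and r: "r n
      = ((\<Sum>\<^sub>\<infinity>k. b k) - (\<Sum>k\<in>freq_box n. b k)) + real (card (freq_box n)) * \<eta> n" for n
  proof -
    have "(\<beta> n has_sum ((\<Sum>\<^sub>\<infinity>k. b k) + (\<Sum>k\<in>freq_box n. \<eta> n - b k))) UNIV"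
      unfolding \<beta>_def by (intro has_sum_add has_sum_infsum b fsum)
    then show "\<beta> n summable_on UNIV" "r n = ((\<Sum>\<^sub>\<infinity>k. b k) - (\<Sum>k\<in>freq_box n. b k)) + real (card
        (freq_box n)) * \<eta> n"
      unfolding r_def by (auto simp: summable_on_def infsumI sum_subtractf)
  qed
  have r0: "r \<longlonglongrightarrow> 0"
  proof -
    have "(\<lambda>n. real (card (freq_box n)) * \<eta> n) \<longlonglongrightarrow> 0"
      by (rule tendsto_sandwich[OF _ _ tendsto_const LIMSEQ_inverse_real_of_nat])
         (use \<eta> in \<open>auto simp: inverse_eq_divide less_imp_le\<close>)
    moreover have "(\<lambda>n. (\<Sum>\<^sub>\<infinity>k. b k) - (\<Sum>k\<in>freq_box n. b k)) \<longlonglongrightarrow> (\<Sum>\<^sub>\<infinity>k. b k) - (\<Sum>\<^sub>\<infinity>k. b k)"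
      by (intro tendsto_diff tendsto_const infsum_freq_box_limit b)
    ultimately show ?thesis unfolding r[abs_def] using tendsto_add by fastforce
  qed
  have FS: "(\<lambda>x. F tau x - S n tau x) = (\<lambda>x. Re (fseries (\<lambda>k. c k tau - d n k tau) x))"
      if "tau \<in> space M" for n tau
    using fseries_linear(2)[OF cs[OF that] ds] by (simp add: F[OF that] S_def fun_eq_iff)
  have simple: "simple_function M (S n)" for n
  proof -
    have "simple_function M (\<lambda>tau x. Re (\<Sum>k\<in>K. s k n tau * mode k x))" if "finite K" for K
      using that
    proof (induction K)
      case (insert k K)
      have "simple_function M (\<lambda>tau. (\<lambda>z f x. Re (z * mode k x) + f x) (s k n tau) (\<lambda>x. Re (\<Sum>k\<in>K.
          s k n tau * mode k x)))"
        by (rule simple_function_compose2[OF s(1) insert.IH])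
      then show ?case using insert.hyps by simp
    qed simp
    moreover have "S n = (\<lambda>tau x. Re (\<Sum>k\<in>freq_box n. s k n tau * mode k x))"
    proof (intro ext)
      fix tau x
      have "fseries (\<lambda>k. d n k tau) x = (\<Sum>\<^sub>\<infinity>k\<in>freq_box n. s k n tau * mode k x)"
        unfolding fseries_def d_def by (intro infsum_cong_neutral) auto
      then show "S n tau x = Re (\<Sum>k\<in>freq_box n. s k n tau * mode k x)" by (simp add: S_def)
    qed
    ultimately show ?thesis by simp
  qed
  have sint: "simple_L2_integral M (S n) x = Re (fseries (\<lambda>k. LINT tau|M. d n k tau) x)" for n x
  proof -
    have e: "fseries (\<lambda>k. d n k tau) x = (\<Sum>k\<in>freq_box n. d n k tau * mode k x)" for tau
    proof -
      have "fseries (\<lambda>k. d n k tau) x = (\<Sum>\<^sub>\<infinity>k\<in>freq_box n. d n k tau * mode k x)"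
        unfolding fseries_def by (intro infsum_cong_neutral) (auto simp: d_def)
      then show ?thesis by simp
    qed
    have e': "fseries (\<lambda>k. LINT tau|M. d n k tau) x
        = (\<Sum>k\<in>freq_box n. (LINT tau|M. d n k tau) * mode k x)"
    proof -
      have "fseries (\<lambda>k. LINT tau|M. d n k tau) x
          = (\<Sum>\<^sub>\<infinity>k\<in>freq_box n. (LINT tau|M. d n k tau) * mode k x)"
        unfolding fseries_def by (intro infsum_cong_neutral) (auto simp: d_def[abs_def])
      then show ?thesis by simp
    qed
    have i: "integrable M (\<lambda>tau. \<Sum>k\<in>freq_box n. d n k tau * mode k x)"
      by (intro Bochner_Integration.integrable_sum integrable_mult_left di)
    have "simple_L2_integral M (S n) x = (LINT tau|M. Re (\<Sum>k\<in>freq_box n. d n k tau * mode k x))"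
      unfolding simple_L2_integral_eq(2)[OF M simple] S_def e ..
    also have "\<dots> = Re (LINT tau|M. (\<Sum>k\<in>freq_box n. d n k tau * mode k x))"
      by (rule integral_Re[OF i])
    also have "(LINT tau|M. (\<Sum>k\<in>freq_box n. d n k tau * mode k x))
        = fseries (\<lambda>k. LINT tau|M. d n k tau) x"
      unfolding e' using di by simp
    finally show ?thesis .
  qed
  have cI: "(\<lambda>k. norm (LINT tau|M. c k tau)) summable_on UNIV"
    by (rule norm_infsum_bound_le(1)[OF b(2)]) (rule order_trans[OF integral_norm_bound b(1)])
  have dI: "(\<lambda>k. norm (LINT tau|M. d n k tau)) summable_on UNIV" for n
  proof (rule finite_nonzero_values_imp_summable_on)
    have "(LINT tau|M. d n k tau) = 0" if "k \<notin> freq_box n" for k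
      using that by (simp add: d_def)
    then have "{k. norm (LINT tau|M. d n k tau) \<noteq> 0} \<subseteq> freq_box n" by auto
    then show "finite {k \<in> UNIV. norm (LINT tau|M. d n k tau) \<noteq> 0}"
      by (simp add: finite_subset[OF _ finite_freq_box])
  qed
  have dcI: "norm ((LINT tau|M. d n k tau) - (LINT tau|M. c k tau)) \<le> \<beta> n k" for n k
  proof -
    have "norm ((LINT tau|M. d n k tau) - (LINT tau|M. c k tau))
        = norm (LINT tau|M. c k tau - d n k tau)"
      using c di by (simp add: norm_minus_commute)
    also have "\<dots> \<le> (LINT tau|M. norm (c k tau - d n k tau))" by (rule integral_norm_bound)
    finally show ?thesis using \<delta>b[of k n] by linarith
  qed
  show ?thesis
    unfolding has_L2_bochner_integral_def
  proof (intro conjI exI[of _ S] allI ballI)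
    show "finite_measure M" by (rule M)
    show "AE tau in M. square_integrable TT (F tau)"
      by (intro AE_I2) (simp add: F square_integrable_Re_fseries cs)
    show "square_integrable TT (\<lambda>x. Re (fseries (\<lambda>k. LINT tau|M. c k tau) x))"
      by (rule square_integrable_Re_fseries[OF cI])
    show "simple_function M (S n)" for n by (rule simple)
    show "square_integrable TT (S n tau)" for n tau
      unfolding S_def by (rule square_integrable_Re_fseries[OF ds])
    show "(\<lambda>tau. L2norm TT (\<lambda>x. F tau x - S n tau x)) \<in> borel_measurable M" for n
    proof -
      have "(\<lambda>tau. L2norm TT (\<lambda>x. Re (fseries (\<lambda>k. c k tau - d n k tau) x))) \<in> borel_measurable M"
        using c di by (intro L2norm_Re_fseries_measurable \<delta>s borel_measurable_diff) auto
      then show ?thesis by (subst measurable_cong) (auto simp: FS)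
    qed
    show "(\<lambda>n. \<integral>\<^sup>+tau. ennreal (L2norm TT (\<lambda>x. F tau x - S n tau x)) \<partial>M) \<longlonglongrightarrow> 0"
    proof (rule tendsto_sandwich[OF _ _ tendsto_const])
      show "\<forall>\<^sub>F n in sequentially. (\<integral>\<^sup>+tau. ennreal (L2norm TT (\<lambda>x. F tau x - S n tau x)) \<partial>M)
          \<le> ennreal (sqrt (L1 * L2) * r n)"
      proof (intro always_eventually allI)
        fix n
        have "(\<integral>\<^sup>+tau. ennreal (L2norm TT (\<lambda>x. F tau x - S n tau x)) \<partial>M)
            \<le> (\<integral>\<^sup>+tau. ennreal (\<Sum>\<^sub>\<infinity>k. sqrt (L1 * L2) * norm (c k tau - d n k tau)) \<partial>M)"
          using L2norm_Re_fseries_le[OF \<delta>s]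
          by (intro nn_integral_mono ennreal_leI) (simp add: FS infsum_cmult_right')
        also have "\<dots> \<le> ennreal (\<Sum>\<^sub>\<infinity>k. sqrt (L1 * L2) * \<beta> n k)"
        proof (rule nn_integral_infsum_le)
          show "integrable M (\<lambda>tau. sqrt (L1 * L2) * norm (c k tau - d n k tau))" for k
            using c di by (intro integrable_mult_right integrable_norm
                Bochner_Integration.integrable_diff)
          show "AE tau in M. (\<lambda>k. sqrt (L1 * L2) * norm (c k tau - d n k tau)) summable_on UNIV"
            by (intro AE_I2 summable_on_cmult_right \<delta>s)
          show "(LINT tau|M. sqrt (L1 * L2) * norm (c k tau - d n k tau))
              \<le> sqrt (L1 * L2) * \<beta> n k" for k
            unfolding integral_mult_right_zero using L1_pos L2_pos by (intro mult_left_mono \<delta>b) auto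
          show "(\<lambda>k. sqrt (L1 * L2) * \<beta> n k) summable_on UNIV"
            by (rule summable_on_cmult_right[OF \<beta>s])
        qed (use L1_pos L2_pos in auto)
        finally show "(\<integral>\<^sup>+tau. ennreal (L2norm TT (\<lambda>x. F tau x - S n tau x)) \<partial>M)
            \<le> ennreal (sqrt (L1 * L2) * r n)"
          by (simp only: r_def infsum_cmult_right')
      qed
      show "(\<lambda>n. ennreal (sqrt (L1 * L2) * r n)) \<longlonglongrightarrow> 0"
        using tendsto_ennrealI[OF tendsto_mult_left[OF r0, of "sqrt (L1 * L2)"]] by simp
    qed simp
    show "(\<lambda>n. L2norm TT (\<lambda>x. simple_L2_integral M (S n) x - Re (fseries (\<lambda>k. LINT tau|M. c k tau)
        x))) \<longlonglongrightarrow> 0"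
    proof (rule tendsto_sandwich[OF _ _ tendsto_const])
      show "\<forall>\<^sub>F n in sequentially. L2norm TT (\<lambda>x. simple_L2_integral M (S n) x - Re (fseries (\<lambda>k.
          LINT tau|M. c k tau) x))
          \<le> sqrt (L1 * L2) * r n"
      proof (intro always_eventually allI)
        fix n
        note e = norm_infsum_bound_le(1)[OF \<beta>s dcI, of n]
        have "L2norm TT (\<lambda>x. simple_L2_integral M (S n) x - Re (fseries (\<lambda>k. LINT tau|M. c k tau)
            x))
            = L2norm TT (\<lambda>x. Re (fseries (\<lambda>k. (LINT tau|M. d n k tau) - (LINT tau|M. c k tau)) x))"
          by (simp only: sint fseries_linear(2)[OF dI cI] minus_complex.sel)
        also have "\<dots> \<le> sqrt (L1 * L2) * (\<Sum>\<^sub>\<infinity>k. norm ((LINT tau|M. d n k tau) - (LINT tau|M. c k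
            tau)))"
          by (rule L2norm_Re_fseries_le[OF e])
        also have "\<dots> \<le> sqrt (L1 * L2) * r n"
          unfolding r_def using L1_pos L2_pos by (intro mult_left_mono infsum_mono e \<beta>s dcI) auto
        finally show "L2norm TT (\<lambda>x. simple_L2_integral M (S n) x - Re (fseries (\<lambda>k. LINT tau|M. c
            k tau) x))
            \<le> sqrt (L1 * L2) * r n" .
      qed
      show "(\<lambda>n. sqrt (L1 * L2) * r n) \<longlonglongrightarrow> 0"
        using tendsto_mult_left[OF r0, of "sqrt (L1 * L2)"] by simp
    qed (simp add: L2norm_def)
  qed
qed

end

section \<open>From Fourier coefficients to a mild solution\<close>

lemma lebesgue_on_interval:
  fixes g :: "real \<Rightarrow> 'b::{banach, second_countable_topology}"
  assumes [measurable]: "g \<in> borel_measurable borel"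
  shows "integrable (lebesgue_on {a..b}) g \<longleftrightarrow> set_integrable lborel {a..b} g"
    "(LINT x|lebesgue_on {a..b}. g x) = (LINT x:{a..b}|lborel. g x)"
proof -
  show "integrable (lebesgue_on {a..b}) g \<longleftrightarrow> set_integrable lborel {a..b} g"
    unfolding set_integrable_def by (subst integrable_restrict_space) (auto intro!:
        integrable_completion)
  show "(LINT x|lebesgue_on {a..b}. g x) = (LINT x:{a..b}|lborel. g x)"
    unfolding set_lebesgue_integral_def by (subst integral_restrict_space) (auto intro!:
        integral_completion)
qed

context ks_torus
begin

lemma Phi_summable: "(\<lambda>k. Phi k t) summable_on UNIV"
proof (cases "0 < t")
  case True
  show ?thesis
  proof (rule summable_on_comparison_test)
    show "(\<lambda>k. decay_const / sqrt t * inverse (wn k) ^ 4 + (if k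
        = 0 then Phi 0 t else 0)) summable_on UNIV"
      by (intro summable_on_add summable_on_cmult_right lattice_sum_4)
         (auto intro!: finite_nonzero_values_imp_summable_on intro: finite_subset[of _ "{0}"])
    show "Phi k t \<le> decay_const / sqrt t * inverse (wn k) ^ 4 + (if k = 0 then Phi 0 t else 0)"
        for k
      using Phi_le_decay_const[of k t] True by auto
  qed (rule Phi_nonneg)
qed simp

text \<open>
  An integrable bound, up to a constant, for the supremum of the gradient at time \<open>t\<close>: the first
  summand comes from the linear flow, the second one from the nonlinear part.
\<close>

definition rate :: "real \<Rightarrow> real" where "rate t = 1 / (root4 t * sqrt t) + 1 / sqrt t"

lemma rate_integrable:
  assumes "0 \<le> T"
  shows "set_integrable lborel {0..T} rate"
proof (rule set_integrable_nonneg_FTC(1)[OF assms])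
  show "continuous_on {0..T} (\<lambda>t. 4 * sqrt (sqrt t) + 2 * sqrt t)" by (intro continuous_intros)
  show "((\<lambda>t. 4 * sqrt (sqrt t) + 2 * sqrt t) has_real_derivative rate x) (at x)"
      if "x \<in> {0<..<T}" for x
  proof -
    have x: "0 < x" "0 < sqrt x" using that by auto
    have "((\<lambda>t. 4 * sqrt (sqrt t) + 2 * sqrt t) has_real_derivative
        4 * (inverse (sqrt (sqrt x)) / 2 * (inverse (sqrt x) / 2)) + 2 * (inverse (sqrt x) / 2))
            (at x)"
      by (intro DERIV_add DERIV_cmult DERIV_chain2[OF DERIV_real_sqrt[OF x(2)] DERIV_real_sqrt[OF
          x(1)]]
          DERIV_real_sqrt[OF x(1)])
    then show ?thesis by (simp add: rate_def root4_def inverse_eq_divide)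
  qed
qed (auto simp: rate_def[abs_def] root4_def)

text \<open>
  Compared with \<open>wn_exp_le\<close>, a more singular power of \<open>t\<close> is traded for decay in \<open>k\<close>, which makes the
  gradient of the linear flow absolutely convergent.
\<close>

lemma wn_exp_le_cubic:
  assumes "0 < t"
  shows "wn k * exp (- t * symb k) \<le> inverse (wn k) ^ 2 / root4 gap ^ 3 * (1 / (root4 t * sqrt t))"
proof (cases "k = 0")
  case False
  have q: "0 < root4 t" "0 < root4 gap" "root4 t * root4 t = sqrt t" and w: "0 < wn k"
    using root4_simps assms gap_bounds(1) wn_ge_1[OF False] by auto
  have "wn k * exp (- t * symb k) \<le> wn k * (1 / (root4 t * root4 gap * wn k) ^ 3)"
    by (intro mult_left_mono exp_symbol_le assms False) auto
  also have "\<dots> = inverse (wn k) ^ 2 / root4 gap ^ 3 * (1 / (root4 t * (root4 t * root4 t)))"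
    using w q(1,2) by (simp add: field_simps power2_eq_square power3_eq_cube)
  finally show ?thesis unfolding q(3) .
qed simp

lemma wn_Phi_le_cubic:
  assumes "0 < t"
  shows "wn k * Phi k t \<le> decay_const * inverse (wn k) ^ 3 * (1 / sqrt t)"
proof (cases "k = 0")
  case False
  have w: "0 < wn k" using wn_ge_1[OF False] by simp
  have "wn k * Phi k t \<le> wn k * (decay_const * inverse (wn k) ^ 4 / sqrt t)"
    using Phi_le_decay_const[OF False assms] by (intro mult_left_mono) auto
  also have "\<dots> = decay_const * inverse (wn k) ^ 3 * (1 / sqrt t)"
    using w by (simp add: field_simps power3_eq_cube power4_eq_xxxx)
  finally show ?thesis .
qed (use assms decay_const_ge in simp)

lemma ks_semigroup_fseries:
  assumes "0 < t"
  shows "ks_semigroup L1 L2 t h x = Re (fseries (\<lambda>k. of_real (exp (- t * symb k)) * fourier_coeff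
      L1 L2 h k) x)"
  using assms by (simp add: ks_semigroup_def fseries_def mode_def symb_def wn_def)

lemma fseries_joint_measurable:
  assumes c: "\<And>k. c k \<in> borel_measurable borel" and cs: "\<And>t. (\<lambda>k. norm (c k t)) summable_on UNIV"
  shows "(\<lambda>z :: real \<times> (real \<times> real). fseries (\<lambda>k. c k (fst z)) (snd z)) \<in> borel_measurable borel"
  unfolding fseries_def
proof (rule borel_measurable_infsum)
  have f: "(fst :: real \<times> (real \<times> real) \<Rightarrow> real) \<in> borel_measurable borel"
    "(snd :: real \<times> (real \<times> real) \<Rightarrow> real \<times> real) \<in> borel_measurable borel"
    by (auto intro!: borel_measurable_continuous_onI continuous_intros)
  show "(\<lambda>z. c k (fst z) * mode k (snd z)) \<in> borel_measurable borel" for k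
    by (intro borel_measurable_times measurable_compose[OF f(1) c] measurable_compose[OF f(2)
        mode_measurable])
qed (rule summable_modes[OF cs])

lemma fourier_coeff_diff:
  assumes "integrable TT g" "integrable TT h"
  shows "fourier_coeff L1 L2 (\<lambda>x. g x - h x) k = fourier_coeff L1 L2 g k - fourier_coeff L1 L2 h k"
proof -
  have i: "integrable TT (\<lambda>x. of_real (u x) * cnj (mode k x))" if "integrable TT u"
      for u :: "real \<times> real \<Rightarrow> real"
    unfolding cnj_mode
  proof (rule Bochner_Integration.integrable_bound[OF that])
    show "(\<lambda>x. of_real (u x) * mode (- k) x) \<in> borel_measurable TT"
      using measurable_compose[OF borel_measurable_integrable[OF that] borel_measurable_of_real]
        measurable_TT[OF mode_measurable] by (intro borel_measurable_times)
  qed (simp add: norm_mult)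
  show ?thesis
    unfolding fourier_coeff_eq diff_divide_distrib[symmetric]
    by (simp only: of_real_diff left_diff_distrib Bochner_Integration.integral_diff[OF i[OF
        assms(1)] i[OF assms(2)]])
qed

text \<open>
  The factor \<open>exp (- t * symb k)\<close> is pulled out of the integral, which leaves an indefinite
  integral in \<open>t\<close>.
\<close>

lemma duhamel_continuous:
  assumes g [measurable]: "g \<in> borel_measurable borel" and gb: "\<And>tau. 0 \<le> tau \<Longrightarrow> norm (g tau)
      \<le> C / sqrt tau"
    and T: "0 \<le> T"
  shows "continuous_on {0..T} (duhamel k g)"
proof -
  let ?h = "\<lambda>tau. exp (tau * symb k) *\<^sub>R g tau"
  have i: "set_integrable lborel {0..t} ?h" for t
  proof -
    have "set_integrable lborel {0..t} (\<lambda>tau. exp (t * symb k) *\<^sub>R (exp (- (t - tau) * symb k) *\<^sub>R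
        g tau))"
      by (intro set_integrable_scaleR_right duhamel_bound(1)[OF g gb])
    then show ?thesis by (simp add: exp_add[symmetric] algebra_simps)
  qed
  have e: "duhamel k g t = exp (- t * symb k) *\<^sub>R integral {0..t} ?h" for t
  proof -
    have "duhamel k g t = (LINT tau:{0..t}|lborel. exp (- t * symb k) *\<^sub>R ?h tau)"
      unfolding duhamel_def by (simp add: exp_add[symmetric] algebra_simps)
    also have "\<dots> = exp (- t * symb k) *\<^sub>R (LINT tau:{0..t}|lborel. ?h tau)"
      by (rule set_integral_scaleR_right)
    finally show ?thesis by (simp only: set_borel_integral_eq_integral(2)[OF i])
  qed
  have "continuous_on {0..T} (\<lambda>t. integral {0..t} ?h)"
    by (rule indefinite_integral_continuous_1[OF set_borel_integral_eq_integral(1)[OF i]])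
  then show ?thesis unfolding e[abs_def] by (intro continuous_intros)
qed

end

locale ks_small_initial = ks_small_data +
  fixes f :: "real \<times> real \<Rightarrow> real"
  assumes f_L2: "square_integrable TT f" and a_coeff: "a = fourier_coeff L1 L2 f"
begin

lemma a_uminus: "a (- k) = cnj (a k)"
  unfolding a_coeff fourier_coeff_eq
  by (simp add: cnj_mode Bochner_Integration.integral_cnj[symmetric] del:
      Bochner_Integration.integral_cnj)

lemma a_square_summable: "(\<lambda>k. (norm (a k))\<^sup>2) summable_on UNIV"
  unfolding a_coeff by (rule parseval(1)[OF f_L2])

definition nonlin :: "real \<Rightarrow> int \<times> int \<Rightarrow> complex" where
  "nonlin t k = quad (\<lambda>m. sol m t) k"

definition grad_env :: "int \<times> int \<Rightarrow> real" where
  "grad_env k = inverse (wn k) ^ 2 / root4 gap ^ 3 * norm (a k) + eps * (decay_const * inverse (wn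
      k) ^ 3)"

lemma sol_le: "norm (sol k t) \<le> norm (lin_flow a k t) + eps * Phi k t"
  using in_ballD(2)[OF sol_in_ball, of k t] norm_triangle_ineq2[of "sol k t" "lin_flow a k t"] by
      linarith

lemma grad_env_nonneg: "0 \<le> grad_env k"
  using eps_pos decay_const_ge gap_bounds root4_simps(1)[of gap]
  by (auto simp: grad_env_def intro!: add_nonneg_nonneg mult_nonneg_nonneg)

lemma grad_env_summable: "grad_env summable_on UNIV"
proof -
  have "(\<lambda>k. inverse (wn k) ^ 2 * norm (a k)) summable_on UNIV"
  proof (rule summable_on_comparison_test[OF summable_on_add[OF lattice_sum_4 a_square_summable]])
    show "inverse (wn k) ^ 2 * norm (a k) \<le> inverse (wn k) ^ 4 + (norm (a k))\<^sup>2" for k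
    proof -
      have "0 \<le> (inverse (wn k) ^ 2 - norm (a k))\<^sup>2" "0 \<le> inverse (wn k) ^ 2 * norm (a k)" by auto
      moreover have "(inverse (wn k) ^ 2 - norm (a k))\<^sup>2
          = inverse (wn k) ^ 4 + (norm (a k))\<^sup>2 - 2 * (inverse (wn k) ^ 2 * norm (a k))"
        by (simp add: power2_diff power_mult[symmetric])
      ultimately show ?thesis by linarith
    qed
  qed simp
  from summable_on_add[OF summable_on_cmult_right[OF this, of "1 / root4 gap ^ 3"]
      summable_on_cmult_right[OF lattice_sum_3, of "eps * decay_const"]]
  show ?thesis unfolding grad_env_def[abs_def] by (simp add: mult_ac)
qed

lemma wn_sol_le:
  assumes "0 < t"
  shows "wn k * norm (sol k t) \<le> grad_env k * rate t"
proof -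
  have q: "0 < root4 t" "0 < root4 gap" using root4_simps assms gap_bounds(1) by auto
  have "wn k * norm (sol k t) \<le> wn k * (norm (lin_flow a k t) + eps * Phi k t)"
    by (intro mult_left_mono sol_le) simp
  also have "\<dots> = (wn k * exp (- t * symb k)) * norm (a k) + eps * (wn k * Phi k t)"
    using assms by (simp add: lin_flow_def norm_mult algebra_simps)
  also have "\<dots> \<le> (inverse (wn k) ^ 2 / root4 gap ^ 3 * (1 / (root4 t * sqrt t))) * norm (a k)
      + eps * (decay_const * inverse (wn k) ^ 3 * (1 / sqrt t))"
    using eps_pos by (intro add_mono mult_right_mono mult_left_mono wn_exp_le_cubic
        wn_Phi_le_cubic assms) auto
  also have "\<dots> = (inverse (wn k) ^ 2 / root4 gap ^ 3 * norm (a k)) * (1 / (root4 t * sqrt t))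
      + (eps * (decay_const * inverse (wn k) ^ 3)) * (1 / sqrt t)"
    by simp
  also have "\<dots> \<le> (inverse (wn k) ^ 2 / root4 gap ^ 3 * norm (a k)) * rate t
      + (eps * (decay_const * inverse (wn k) ^ 3)) * rate t"
    using q assms eps_pos decay_const_ge unfolding rate_def by (intro add_mono mult_left_mono) auto
  also have "\<dots> = grad_env k * rate t" by (simp add: grad_env_def algebra_simps)
  finally show ?thesis .
qed

lemma sol_nonpos [simp]: "t \<le> 0 \<Longrightarrow> sol k t = 0"
  by (rule in_ball_nonpos[OF sol_in_ball])

lemma wn_sol_summable: "(\<lambda>k. wn k * norm (sol k t)) summable_on UNIV"
proof (cases "0 < t")
  case True
  show ?thesis
    by (rule summable_on_comparison_test[OF summable_on_cmult_left[OF grad_env_summable]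
        wn_sol_le[OF True]]) auto
qed simp

lemma sol_summable: "(\<lambda>k. norm (sol k t)) summable_on UNIV"
proof (rule summable_on_comparison_test)
  show "(\<lambda>k. wn k * norm (sol k t) + (if k = 0 then norm (sol 0 t) else 0)) summable_on UNIV"
    by (intro summable_on_add wn_sol_summable finite_nonzero_values_imp_summable_on)
       (auto intro: finite_subset[of _ "{0}"])
  show "norm (sol k t) \<le> wn k * norm (sol k t) + (if k = 0 then norm (sol 0 t) else 0)" for k
    using mult_right_mono[OF wn_ge_1[of k], of "norm (sol k t)"] by auto
qed simp

lemma nonlin_measurable [measurable]: "(\<lambda>t. nonlin t k) \<in> borel_measurable borel"
  unfolding nonlin_def by (rule quad_measurable[OF sol_in_ball])

lemma nonlin_le: "0 \<le> t \<Longrightarrow> norm (nonlin t k) \<le> 2 * eps / sqrt t"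
  unfolding nonlin_def by (rule quad_in_ball(2)[OF sol_in_ball])

lemma sol_eq: "sol k t = lin_flow a k t - duhamel k (\<lambda>tau. nonlin tau k) t / 2"
  unfolding nonlin_def by (rule sol_fixed_point)

definition grad1 :: "real \<Rightarrow> int \<times> int \<Rightarrow> complex" where
  "grad1 t k = \<i> * of_real (fst (wv k)) * sol k t"

definition grad2 :: "real \<Rightarrow> int \<times> int \<Rightarrow> complex" where
  "grad2 t k = \<i> * of_real (snd (wv k)) * sol k t"

lemma grad_le: "norm (grad1 t k) \<le> wn k * norm (sol k t)" "norm (grad2 t k) \<le> wn k * norm (sol k t)"
  using norm_fst_le[of "fst (wv k)" "snd (wv k)"] norm_snd_le[of "snd (wv k)" "fst (wv k)"]
  by (auto simp: norm_mult grad1_def grad2_def wn_def intro!: mult_right_mono)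

lemma grad_summable: "(\<lambda>k. norm (grad1 t k)) summable_on UNIV" "(\<lambda>k. norm (grad2 t k)) summable_on
    UNIV"
  using norm_infsum_bound_le(1)[OF wn_sol_summable grad_le(1)] norm_infsum_bound_le(1)[OF
      wn_sol_summable grad_le(2)]
  by blast+

lemma grad_real: "of_real (Re (fseries (grad1 t) x))
    = fseries (grad1 t) x" "of_real (Re (fseries (grad2 t) x)) = fseries (grad2 t) x"
  by (rule fseries_real; simp add: grad1_def grad2_def sol_uminus[OF a_uminus])+

definition G :: "real \<Rightarrow> real \<times> real \<Rightarrow> real \<times> real" where
  "G t x = (Re (fseries (grad1 t) x), Re (fseries (grad2 t) x))"

text \<open>
  At \<open>t = 0\<close> the coefficients are only square summable, hence the given function is used itself.
\<close>

definition \<phi> :: "real \<Rightarrow> real \<times> real \<Rightarrow> real" where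
  "\<phi> t x = (if 0 < t then Re (fseries (\<lambda>k. sol k t) x) else f x)"

text \<open>
  The product of two absolutely convergent series is the series of the convolution; the sum over
  the two components of the gradient assembles the inner product of the wave vectors.
\<close>

lemma norm_G_square: "of_real ((norm (G t x))\<^sup>2) = fseries (nonlin t) x"
  and nonlin_summable: "(\<lambda>k. norm (nonlin t k)) summable_on UNIV"
proof -
  let ?p = "\<lambda>k. \<Sum>\<^sub>\<infinity>m. grad1 t m * grad1 t (k - m)" and ?q = "\<lambda>k. \<Sum>\<^sub>\<infinity>m. grad2 t m * grad2 t (k - m)"
  have s: "(\<lambda>k. norm (?p k)) summable_on UNIV" "(\<lambda>k. norm (?q k)) summable_on UNIV"
    by (intro abs_summable_convolution grad_summable)+
  have sm: "(\<lambda>m. h m * h (k - m)) summable_on UNIV"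
    if h: "(\<lambda>m. norm (h m)) summable_on UNIV" for h :: "int \<times> int \<Rightarrow> complex" and k
  proof (rule norm_infsum_bound_le(2)[OF summable_on_cmult_left[OF h]])
    show "norm (h m * h (k - m)) \<le> norm (h m) * (\<Sum>\<^sub>\<infinity>k. norm (h k))" for m
      unfolding norm_mult using finite_sum_le_infsum[OF h, of "{k - m}"]
        by (intro mult_left_mono) auto
  qed
  have pq: "?p k + ?q k = nonlin t k" for k
  proof -
    have ii: "(\<i> * \<i>) * z * y * y' = - (z * y * y')" for z y y' :: complex by simp
    have "?p k + ?q k = (\<Sum>\<^sub>\<infinity>m. grad1 t m * grad1 t (k - m) + grad2 t m * grad2 t (k - m))"
      by (rule infsum_add[OF sm[OF grad_summable(1)] sm[OF grad_summable(2)], symmetric])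
    also have "\<dots> = (\<Sum>\<^sub>\<infinity>m. - (of_real (wv m \<bullet> wv (k - m)) * sol m t * sol (k - m) t))"
    proof (rule infsum_cong)
      fix m
      have "grad1 t m * grad1 t (k - m) + grad2 t m * grad2 t (k - m)
          = (\<i> * \<i>) * of_real (fst (wv m) * fst (wv (k - m)) + snd (wv m) * snd (wv (k - m))) *
              sol m t * sol (k - m) t"
        unfolding grad1_def grad2_def of_real_add of_real_mult by algebra
      then show "grad1 t m * grad1 t (k - m) + grad2 t m * grad2 t (k - m)
          = - (of_real (wv m \<bullet> wv (k - m)) * sol m t * sol (k - m) t)"
        by (simp only: inner_prod_def inner_real_def ii)
    qed
    finally show ?thesis by (simp only: infsum_uminus nonlin_def quad_def)
  qed
  have "complex_of_real ((norm (G t x))\<^sup>2) = of_real (Re (fseries (grad1 t) x)) * of_real (Re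
      (fseries (grad1 t) x))
      + of_real (Re (fseries (grad2 t) x)) * of_real (Re (fseries (grad2 t) x))"
    by (simp add: G_def norm_prod_def power2_eq_square)
  also have "\<dots> = fseries ?p x + fseries ?q x"
    unfolding grad_real by (simp only: fseries_mult grad_summable)
  also have "\<dots> = fseries (nonlin t) x"
    unfolding fseries_linear(1)[OF s, symmetric] pq by simp
  finally show "of_real ((norm (G t x))\<^sup>2) = fseries (nonlin t) x" .
  show "(\<lambda>k. norm (nonlin t k)) summable_on UNIV"
    unfolding pq[symmetric] by (rule norm_infsum_bound_le(1)[OF summable_on_add[OF s]]) (rule
        norm_triangle_ineq)
qed

lemma norm_G_le: "norm (G t x) \<le> 2 * (\<Sum>\<^sub>\<infinity>k. wn k * norm (sol k t))"
proof -
  have "norm (G t x) \<le> norm (Re (fseries (grad1 t) x)) + norm (Re (fseries (grad2 t) x))"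
    unfolding G_def by (rule norm_Pair_le)
  moreover have "norm (Re (fseries (grad1 t) x)) \<le> (\<Sum>\<^sub>\<infinity>k. wn k * norm (sol k t))"
    using abs_Re_le_cmod[of "fseries (grad1 t) x"] norm_fseries_le[OF grad_summable(1), of t x]
      infsum_mono[OF grad_summable(1) wn_sol_summable grad_le(1), of t] by simp
  moreover have "norm (Re (fseries (grad2 t) x)) \<le> (\<Sum>\<^sub>\<infinity>k. wn k * norm (sol k t))"
    using abs_Re_le_cmod[of "fseries (grad2 t) x"] norm_fseries_le[OF grad_summable(2), of t x]
      infsum_mono[OF grad_summable(2) wn_sol_summable grad_le(2), of t] by simp
  ultimately show ?thesis by simp
qed

lemma G_measurable: "G t \<in> borel_measurable borel"
proof -
  have "(\<lambda>x. (Re (fseries (grad1 t) x), Re (fseries (grad2 t) x))) \<in> borel_measurable borel"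
    using fseries_measurable[OF grad_summable(1)] fseries_measurable[OF grad_summable(2)]
    by (intro borel_measurable_Pair measurable_compose[OF _ borel_measurable_Re])
  then show ?thesis by (simp add: G_def[abs_def])
qed

lemma norm_G_square_integrable: "integrable TT (\<lambda>x. (norm (G t x))\<^sup>2)"
proof (rule integrable_TT_bounded)
  show "(\<lambda>x. (norm (G t x))\<^sup>2) \<in> borel_measurable TT"
    using measurable_TT[OF G_measurable] by measurable
  show "norm ((norm (G t x))\<^sup>2) \<le> (2 * (\<Sum>\<^sub>\<infinity>k. wn k * norm (sol k t)))\<^sup>2" for x
    using power_mono[OF norm_G_le norm_ge_zero, of t x 2] by (simp only: real_norm_def abs_power2)
qed

lemma norm_G_square_coeff: "fourier_coeff L1 L2 (\<lambda>x. (norm (G t x))\<^sup>2) k = nonlin t k"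
  by (rule fourier_coeff_fseries[OF nonlin_summable norm_G_square])

lemma weak_gradient_\<phi>: "0 < t \<Longrightarrow> weak_gradient L1 L2 (\<phi> t) (G t)"
  using weak_gradient_fseries[OF sol_summable wn_sol_summable[unfolded wn_def]]
  by (simp add: \<phi>_def[abs_def] G_def[abs_def] grad1_def[abs_def] grad2_def[abs_def])

text \<open>
  At \<open>tau = t\<close> the semigroup is the identity by definition; as the coefficients of the squared
  gradient are absolutely summable, the series represents the function itself there as well.
\<close>

lemma semigroup_norm_G_square:
  assumes "0 \<le> tau" "tau \<le> t"
  shows "ks_semigroup L1 L2 (t - tau) (\<lambda>x. (norm (G tau x))\<^sup>2)
      = (\<lambda>x. Re (fseries (\<lambda>k. exp (- (t - tau) * symb k) *\<^sub>R nonlin tau k) x))"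
proof (cases "tau < t")
  case True
  then have "0 < t - tau" by simp
  then show ?thesis
    by (intro ext) (simp only: ks_semigroup_fseries norm_G_square_coeff scaleR_conv_of_real)
next
  case False
  then have "tau = t" using assms by simp
  have "(norm (G t x))\<^sup>2 = Re (fseries (nonlin t) x)" for x
    using norm_G_square[of t x] by (metis Re_complex_of_real)
  then show ?thesis using \<open>tau = t\<close> by (simp add: ks_semigroup_def)
qed

lemma duhamel_nonlin_le: "norm (duhamel k (\<lambda>tau. nonlin tau k) t) \<le> 2 * eps * Phi k t"
  by (rule duhamel_bound(3)[OF nonlin_measurable nonlin_le])

lemma duhamel_nonlin_summable: "(\<lambda>k. norm (duhamel k (\<lambda>tau. nonlin tau k) t)) summable_on UNIV"
  by (rule norm_infsum_bound_le(1)[OF summable_on_cmult_right[OF Phi_summable] duhamel_nonlin_le])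

lemma duhamel_bochner:
  assumes t: "0 \<le> t"
  shows "has_L2_bochner_integral (lebesgue_on {0..t}) TT
    (\<lambda>tau. ks_semigroup L1 L2 (t - tau) (\<lambda>x. (norm (G tau x))\<^sup>2))
    (\<lambda>x. Re (fseries (\<lambda>k. duhamel k (\<lambda>tau. nonlin tau k) t) x))"
proof -
  let ?c = "\<lambda>k tau. exp (- (t - tau) * symb k) *\<^sub>R nonlin tau k"
  have m: "?c k \<in> borel_measurable borel" for k by measurable
  have n: "(\<lambda>tau. norm (?c k tau)) \<in> borel_measurable borel" for k by measurable
  have duhamel: "duhamel k (\<lambda>tau. nonlin tau k) t = (LINT tau|lebesgue_on {0..t}. ?c k tau)" for k
    unfolding duhamel_def lebesgue_on_interval(2)[OF m] ..
  show ?thesis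
    unfolding duhamel
  proof (rule has_L2_bochner_integral_fseries)
    show "finite_measure (lebesgue_on {0..t})" by (rule finite_measure_lebesgue_on) simp
    show "integrable (lebesgue_on {0..t}) (?c k)" for k
      unfolding lebesgue_on_interval(1)[OF m]
        by (rule duhamel_bound(1)[OF nonlin_measurable nonlin_le])
    show "(\<lambda>k. norm (?c k tau)) summable_on UNIV" if "tau \<in> space (lebesgue_on {0..t})" for tau
    proof (rule norm_infsum_bound_le(1)[OF nonlin_summable])
      have "exp (- (t - tau) * symb k) \<le> 1" for k
        using that symb_nonneg[of k] by (simp add: mult_nonpos_nonneg)
      then show "norm (?c k tau) \<le> norm (nonlin tau k)" for k
        by (simp add: mult_left_le_one_le)
    qed
    show "(LINT tau|lebesgue_on {0..t}. norm (?c k tau)) \<le> 2 * eps * Phi k t" for k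
      unfolding lebesgue_on_interval(2)[OF n]
        by (rule duhamel_bound(2)[OF nonlin_measurable nonlin_le])
    show "(\<lambda>k. 2 * eps * Phi k t) summable_on UNIV"
      by (rule summable_on_cmult_right[OF Phi_summable])
    show "ks_semigroup L1 L2 (t - tau) (\<lambda>x. (norm (G tau x))\<^sup>2)
        = (\<lambda>x. Re (fseries (\<lambda>k. ?c k tau) x))"
      if "tau \<in> space (lebesgue_on {0..t})" for tau
      using that by (intro semigroup_norm_G_square) auto
  qed
qed

lemma lin_flow_summable: "(\<lambda>k. norm (lin_flow a k t)) summable_on UNIV"
proof -
  have "lin_flow a k t = sol k t + duhamel k (\<lambda>tau. nonlin tau k) t / 2" for k by (simp add: sol_eq)
  then have "norm (lin_flow a k t) \<le> norm (sol k t) + norm (duhamel k (\<lambda>tau. nonlin tau k) t)" for k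
  proof -
    have "norm (lin_flow a k t) \<le> norm (sol k t) + norm (duhamel k (\<lambda>tau. nonlin tau k) t / 2)"
      unfolding \<open>lin_flow a k t = _\<close> by (rule norm_triangle_ineq)
    moreover have "norm (duhamel k (\<lambda>tau. nonlin tau k) t / 2)
        = norm (duhamel k (\<lambda>tau. nonlin tau k) t) / 2" by (simp add: norm_divide)
    ultimately show ?thesis using norm_ge_zero[of "duhamel k (\<lambda>tau. nonlin tau k) t"] by linarith
  qed
  then show ?thesis by (rule norm_infsum_bound_le(1)[OF summable_on_add[OF sol_summable
      duhamel_nonlin_summable]])
qed

lemma mild_equation:
  assumes "0 \<le> t"
  shows "\<phi> t x = ks_semigroup L1 L2 t f x - 1 / 2 * Re (fseries (\<lambda>k. duhamel k (\<lambda>tau. nonlin tau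
      k) t) x)"
proof (cases "0 < t")
  case True
  have s: "(\<lambda>k. norm ((1 / 2) * duhamel k (\<lambda>tau. nonlin tau k) t)) summable_on UNIV"
    using summable_on_cmult_right[OF duhamel_nonlin_summable, of "1 / 2"]
      by (simp only: norm_mult) simp
  have "fseries (\<lambda>k. sol k t) x = fseries (\<lambda>k. lin_flow a k t - (1 / 2) * duhamel k (\<lambda>tau. nonlin
      tau k) t) x"
    by (simp add: sol_eq)
  also have "\<dots> = fseries (\<lambda>k. lin_flow a k t) x - (1 / 2) * fseries (\<lambda>k. duhamel k (\<lambda>tau. nonlin
      tau k) t) x"
    by (simp only: fseries_linear(2)[OF lin_flow_summable s] fseries_linear(3)[OF
        duhamel_nonlin_summable duhamel_nonlin_summable])
  finally show ?thesis
    using True by (simp add: \<phi>_def ks_semigroup_fseries lin_flow_def a_coeff[symmetric])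
next
  case False
  then have "duhamel k (\<lambda>tau. nonlin tau k) t = 0" for k using duhamel_nonlin_le[of k t] by simp
  then show ?thesis using False assms by (simp add: \<phi>_def ks_semigroup_def fseries_def)
qed

text \<open>
  The supremum of the gradient in space is at most a multiple of \<open>rate\<close>, which is integrable in
  time.
\<close>

lemma G_jointly_integrable:
  assumes T: "0 < T"
  shows "integrable (lebesgue_on ({0..T} \<times> torus_box L1 L2)) (\<lambda>(tau, x). G tau x)"
proof -
  define C where "C = 2 * (\<Sum>\<^sub>\<infinity>k. grad_env k)"
  have C0: "0 \<le> C" unfolding C_def using grad_env_nonneg by (simp add: infsum_nonneg)
  have Gb: "norm (G tau x) \<le> C * rate tau" if "0 \<le> tau" for tau x
  proof (cases "0 < tau")
    case True
    have "(\<Sum>\<^sub>\<infinity>k. wn k * norm (sol k tau)) \<le> (\<Sum>\<^sub>\<infinity>k. grad_env k * rate tau)"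
      by (intro infsum_mono wn_sol_summable summable_on_cmult_left grad_env_summable wn_sol_le True)
    then show ?thesis using norm_G_le[of tau x] by (simp add: C_def infsum_cmult_left')
  next
    case False
    then have "norm (G tau x) \<le> 0" using norm_G_le[of tau x] by simp
    moreover have "rate tau = 0" using False that by (simp add: rate_def)
    ultimately show ?thesis by simp
  qed
  have solm: "sol k \<in> borel_measurable borel" for k by (rule in_ballD(1)[OF sol_in_ball])
  have gm: "(\<lambda>t. grad1 t k) \<in> borel_measurable borel" "(\<lambda>t. grad2 t k) \<in> borel_measurable borel"
      for k
    unfolding grad1_def grad2_def using solm by measurable
  have mG [measurable]: "(\<lambda>z. G (fst z) (snd z)) \<in> borel_measurable borel"
    unfolding G_def using fseries_joint_measurable[OF gm(1) grad_summable(1)]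
        fseries_joint_measurable[OF gm(2) grad_summable(2)]
    by (intro borel_measurable_Pair measurable_compose[OF _ borel_measurable_Re])
  have rate_m [measurable]: "rate \<in> borel_measurable borel"
    by (simp add: rate_def[abs_def] root4_def)
  have box: "torus_box L1 L2 \<in> sets borel" unfolding torus_box_cbox by simp
  define S where "S = {0..T} \<times> torus_box L1 L2"
  have S: "S \<in> sets borel" unfolding S_def torus_box_cbox by (intro borel_closed closed_Times) auto
  define H where "H z = indicator {0..T} (fst z) * (C * rate (fst z)) * indicator (torus_box L1
      L2) (snd z)"
    for z :: "real \<times> (real \<times> real)"
  have ir: "integrable lborel (\<lambda>tau. indicator {0..T} tau * (C * rate tau))"
    using integrable_mult_right[OF rate_integrable[of T, unfolded set_integrable_def], of C] T
      by (simp add: mult_ac)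
  have "integrable (lborel \<Otimes>\<^sub>M lborel) H"
  proof (rule lborel_pair.Fubini_integrable)
    show "H \<in> borel_measurable (lborel \<Otimes>\<^sub>M lborel)"
      unfolding H_def[abs_def] using box by measurable
    have ib: "integrable lborel (indicator (torus_box L1 L2) :: _ \<Rightarrow> real)"
      unfolding torus_box_cbox by (intro integrable_real_indicator) (auto simp:
          emeasure_lborel_cbox_eq)
    then show "AE tau in lborel. integrable lborel (\<lambda>x. H (tau, x))" by (auto simp: H_def)
    have nonneg: "0 \<le> indicator {0..T} tau * (C * rate tau)" for tau
      using C0 norm_ge_zero[of "G tau (0, 0)"] Gb[of tau "(0, 0)"] order_trans[of 0 "norm (G tau
          (0, 0))" "C * rate tau"]
      by (auto simp: indicator_def)
    have "(LINT x|lborel. norm (H (tau, x))) = indicator {0..T} tau * (C * rate tau) * (LINT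
        x|lborel. indicator (torus_box L1 L2) x)" for tau
    proof -
      have "norm (H (tau, x)) = indicator {0..T} tau * (C * rate tau) * indicator (torus_box L1
          L2) x" for x
        unfolding H_def fst_conv snd_conv real_norm_def
          by (intro abs_of_nonneg mult_nonneg_nonneg[OF nonneg]) auto
      then show ?thesis by (simp only: integral_mult_right_zero)
    qed
    then show "integrable lborel (\<lambda>tau. LINT x|lborel. norm (H (tau, x)))"
      using integrable_mult_left[OF ir] by simp
  qed
  then have H: "integrable lborel H" by (simp add: lborel_prod)
  have m: "(\<lambda>z. indicator S z *\<^sub>R G (fst z) (snd z)) \<in> borel_measurable borel"
    using S by measurable
  have "integrable lborel (\<lambda>z. indicator S z *\<^sub>R G (fst z) (snd z))"
  proof (rule Bochner_Integration.integrable_bound[OF H])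
    show "(\<lambda>z. indicator S z *\<^sub>R G (fst z) (snd z)) \<in> borel_measurable lborel" using m by simp
    show "AE z in lborel. norm (indicator S z *\<^sub>R G (fst z) (snd z)) \<le> norm (H z)"
    proof (rule AE_I2)
      fix z :: "real \<times> (real \<times> real)"
      show "norm (indicator S z *\<^sub>R G (fst z) (snd z)) \<le> norm (H z)"
      proof (cases "z \<in> S")
        case True
        then have "norm (H z) = \<bar>C * rate (fst z)\<bar>" by (auto simp: H_def S_def)
        moreover have "norm (G (fst z) (snd z)) \<le> C * rate (fst z)" using True
          by (intro Gb) (auto simp: S_def)
        ultimately show ?thesis using True by simp
      qed simp
    qed
  qed
  then have "integrable lebesgue (\<lambda>z. indicator S z *\<^sub>R G (fst z) (snd z))"
    using m by (subst integrable_completion) auto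
  then have "integrable (lebesgue_on S) (\<lambda>z. G (fst z) (snd z))"
    using S by (subst integrable_restrict_space) auto
  then show ?thesis by (simp add: S_def case_prod_unfold)
qed

text \<open>
  The coefficients of \<open>\<phi> t\<close> for all \<open>t \<ge> 0\<close>. In contrast to \<open>sol\<close>, which vanishes at \<open>t = 0\<close>, they are
  continuous there.
\<close>

definition phi_hat :: "real \<Rightarrow> int \<times> int \<Rightarrow> complex" where
  "phi_hat t k = of_real (exp (- t * symb k)) * a k - duhamel k (\<lambda>tau. nonlin tau k) t / 2"

lemma \<phi>_square_integrable: "square_integrable TT (\<phi> t)"
  using square_integrable_Re_fseries[OF sol_summable] f_L2
    by (cases "0 < t") (auto simp: \<phi>_def[abs_def])

lemma \<phi>_coeff:
  assumes "0 \<le> t"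
  shows "fourier_coeff L1 L2 (\<phi> t) k = phi_hat t k"
proof (cases "0 < t")
  case True
  have "fourier_coeff L1 L2 (\<phi> t) k = sol k t"
    using True
    by (intro fourier_coeff_fseries[OF sol_summable]) (simp add: \<phi>_def fseries_real sol_uminus[OF
        a_uminus])
  then show ?thesis using True sol_eq[of k t] by (simp add: phi_hat_def lin_flow_def)
next
  case False
  then have "t = 0" using assms by simp
  then show ?thesis using duhamel_nonlin_le[of k 0]
    by (simp add: phi_hat_def \<phi>_def[abs_def] a_coeff[symmetric])
qed

lemma L2norm_\<phi>_diff:
  assumes "0 \<le> s" "0 \<le> t"
  shows "L2norm TT (\<lambda>x. \<phi> s x - \<phi> t x) = sqrt (L1 * L2 * (\<Sum>\<^sub>\<infinity>k. (norm (phi_hat s k - phi_hat t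
      k))\<^sup>2))"
proof -
  have "L2_fun (\<lambda>x. of_real (\<phi> s x) - of_real (\<phi> t x))"
    using \<phi>_square_integrable by (intro L2_fun_diff) (auto simp: L2_fun_of_real[symmetric])
  then have "square_integrable TT (\<lambda>x. \<phi> s x - \<phi> t x)" by (simp add: L2_fun_of_real)
  from parseval(2)[OF this]
  show ?thesis
    by (simp add: L2norm_def fourier_coeff_diff square_integrable_imp_integrable
        \<phi>_square_integrable \<phi>_coeff assms)
qed

text \<open>
  By Parseval's identity this is dominated convergence for the sum of \<open>|phi_hat s k - phi_hat t
  k|\<^sup>2\<close>. The majorant is square summable because \<open>Phi k\<close> is bounded by \<open>decay_const * inverse (wn k)
  ^ 2\<close> at all times for \<open>k \<noteq> 0\<close>, and \<open>Phi 0\<close> is bounded on bounded time intervals.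
\<close>

lemma \<phi>_continuous:
  assumes T: "0 < T"
  shows "L2_continuous_on TT {0..T} \<phi>"
  unfolding L2_continuous_on_def
proof (intro conjI ballI \<phi>_square_integrable)
  fix t assume t: "t \<in> {0..T}"
  define \<beta> where "\<beta> k = norm (a k) + eps * (decay_const * inverse (wn k) ^ 2 + (if k
      = 0 then 2 * sqrt T else 0))" for k
  have vb: "norm (phi_hat s k) \<le> \<beta> k" if s: "s \<in> {0..T}" for s k
  proof -
    have "Phi k s \<le> decay_const * inverse (wn k) ^ 2 + (if k = 0 then 2 * sqrt T else 0)"
    proof (cases "k = 0")
      case True
      have "Phi k s \<le> 2 * sqrt s" using s by (intro Phi_le_sqrt) auto
      also have "\<dots> \<le> 2 * sqrt T" using s by simp
      finally show ?thesis using True decay_const_ge by simp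
    next
      case False
      then show ?thesis using Phi_uniform[of k s] by simp
    qed
    then have "eps * Phi k s \<le> eps * (decay_const * inverse (wn k) ^ 2 + (if k
        = 0 then 2 * sqrt T else 0))"
      using eps_pos by (intro mult_left_mono) auto
    moreover have "norm (of_real (exp (- s * symb k)) * a k) \<le> norm (a k)"
      using s symb_nonneg[of k] by (simp add: norm_mult mult_left_le_one_le)
    moreover have "norm (duhamel k (\<lambda>tau. nonlin tau k) s / 2) \<le> eps * Phi k s"
      using duhamel_nonlin_le[of k s] by (simp add: norm_divide)
    moreover have "norm (phi_hat s k) \<le> norm (of_real (exp (- s * symb k)) * a k) + norm (duhamel
        k (\<lambda>tau. nonlin tau k) s / 2)"
      unfolding phi_hat_def by (rule norm_triangle_ineq4)
    ultimately show ?thesis unfolding \<beta>_def by linarith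
  qed
  have \<beta>s: "(\<lambda>k. (2 * \<beta> k)\<^sup>2) summable_on UNIV"
  proof (rule summable_on_comparison_test)
    let ?p = "\<lambda>k. decay_const * inverse (wn k) ^ 2" and ?q = "\<lambda>k :: int \<times> int. if k
        = 0 then 2 * sqrt T else 0"
    show "(\<lambda>k. 8 * (norm (a k))\<^sup>2 + 16 * eps\<^sup>2 * decay_const\<^sup>2 * inverse (wn k) ^ 4 + 16 * eps\<^sup>2 *
        (?q k)\<^sup>2) summable_on UNIV"
      by (intro summable_on_add summable_on_cmult_right a_square_summable lattice_sum_4
          finite_nonzero_values_imp_summable_on) (auto intro: finite_subset[of _ "{0}"])
    show "(2 * \<beta> k)\<^sup>2 \<le> 8 * (norm (a k))\<^sup>2 + 16 * eps\<^sup>2 * decay_const\<^sup>2 * inverse (wn k) ^ 4 + 16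
        * eps\<^sup>2 * (?q k)\<^sup>2" for k
    proof -
      have sq: "(x + y)\<^sup>2 \<le> 2 * x\<^sup>2 + 2 * y\<^sup>2" for x y :: real
        using norm_add_square_le[of x y] by simp
      have "(2 * \<beta> k)\<^sup>2 = 4 * (norm (a k) + eps * (?p k + ?q k))\<^sup>2"
      proof -
        have "(2 * z)\<^sup>2 = 4 * z\<^sup>2" for z :: real by (simp add: power2_eq_square)
        then show ?thesis unfolding \<beta>_def .
      qed
      also have "\<dots> \<le> 4 * (2 * (norm (a k))\<^sup>2 + 2 * (eps * (?p k + ?q k))\<^sup>2)"
        by (intro mult_left_mono sq) auto
      also have "(eps * (?p k + ?q k))\<^sup>2 = eps\<^sup>2 * (?p k + ?q k)\<^sup>2" by (rule power_mult_distrib)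
      also have "4 * (2 * (norm (a k))\<^sup>2 + 2 * (eps\<^sup>2 * (?p k + ?q k)\<^sup>2))
          \<le> 4 * (2 * (norm (a k))\<^sup>2 + 2 * (eps\<^sup>2 * (2 * (?p k)\<^sup>2 + 2 * (?q k)\<^sup>2)))"
        by (intro mult_left_mono add_left_mono sq) auto
      also have "(?p k)\<^sup>2 = decay_const\<^sup>2 * inverse (wn k) ^ 4"
        by (simp add: power_mult_distrib power_mult[symmetric])
      finally show ?thesis by (simp add: algebra_simps)
    qed
  qed simp
  have vc: "((\<lambda>s. phi_hat s k) \<longlongrightarrow> phi_hat t k) (at t within {0..T})" for k
  proof -
    have "continuous_on {0..T} (\<lambda>s. phi_hat s k)"
      unfolding phi_hat_def using T
      by (intro continuous_intros duhamel_continuous[OF nonlin_measurable nonlin_le]) auto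
    then show ?thesis using t by (simp add: continuous_on)
  qed
  show "((\<lambda>s. L2norm TT (\<lambda>x. \<phi> s x - \<phi> t x)) \<longlongrightarrow> 0) (at t within {0..T})"
  proof (cases "at t within {0..T} = bot")
    case False
    have ev: "\<forall>\<^sub>F s in at t within {0..T}. s \<in> {0..T}"
      by (simp add: eventually_at_filter)
    have "((\<lambda>s. \<Sum>\<^sub>\<infinity>k. (norm (phi_hat s k - phi_hat t k))\<^sup>2) \<longlongrightarrow> (\<Sum>\<^sub>\<infinity>k. (norm (phi_hat t k - phi_hat
        t k))\<^sup>2)) (at t within {0..T})"
    proof (rule tendsto_infsum_dominated[OF _ _ \<beta>s False])
      show "((\<lambda>s. (norm (phi_hat s k - phi_hat t k))\<^sup>2) \<longlongrightarrow> (norm (phi_hat t k - phi_hat t k))\<^sup>2)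
          (at t within {0..T})" for k
        by (rule tendsto_power[OF tendsto_norm[OF tendsto_diff[OF vc tendsto_const]]])
      show "\<forall>\<^sub>F s in at t within {0..T}. \<forall>k. norm ((norm (phi_hat s k - phi_hat t k))\<^sup>2)
          \<le> (2 * \<beta> k)\<^sup>2"
        using ev
      proof eventually_elim
        case (elim s)
        have "norm (phi_hat s k - phi_hat t k) \<le> 2 * \<beta> k" for k
          using norm_triangle_ineq4[of "phi_hat s k" "phi_hat t k"] vb[OF elim, of k] vb[OF t, of
              k] by linarith
        then show ?case by (simp only: real_norm_def abs_power2 power_mono norm_ge_zero) simp
      qed
    qed
    then have "((\<lambda>s. \<Sum>\<^sub>\<infinity>k. (norm (phi_hat s k - phi_hat t k))\<^sup>2) \<longlongrightarrow> 0) (at t within {0..T})" by simp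
    from tendsto_real_sqrt[OF tendsto_mult_left[OF this, of "L1 * L2"]]
    have lim: "((\<lambda>s. sqrt (L1 * L2 * (\<Sum>\<^sub>\<infinity>k. (norm (phi_hat s k - phi_hat t k))\<^sup>2))) \<longlongrightarrow> 0) (at t
        within {0..T})"
      by simp
    show ?thesis
    proof (rule Lim_transform_eventually[OF lim])
      show "\<forall>\<^sub>F s in at t within {0..T}. sqrt (L1 * L2 * (\<Sum>\<^sub>\<infinity>k. (norm (phi_hat s k - phi_hat t
          k))\<^sup>2)) = L2norm TT (\<lambda>x. \<phi> s x - \<phi> t x)"
        using ev t by (auto elim!: eventually_mono simp: L2norm_\<phi>_diff)
    qed
  qed simp
qed

theorem mild_solution_\<phi>:
  assumes T: "0 < T"
  shows "mild_solution L1 L2 T f \<phi>"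
  unfolding mild_solution_def
proof (intro conjI exI[of _ G] ballI)
  show "L2_continuous_on TT {0..T} \<phi>" by (rule \<phi>_continuous[OF T])
  show "integrable (lebesgue_on ({0..T} \<times> torus_box L1 L2)) (\<lambda>(tau, x). G tau x)"
    by (rule G_jointly_integrable[OF T])
  have "AE tau in lebesgue. tau \<in> {0..T} \<longrightarrow> 0 < tau"
  proof -
    have "{0 :: real} \<in> null_sets lebesgue" by (simp add: negligible_iff_null_sets[symmetric])
    from AE_not_in[OF this] show ?thesis by eventually_elim auto
  qed
  then have "AE tau in lebesgue_on {0..T}. 0 < tau"
    by (subst AE_restrict_space_iff) auto
  then show "AE tau in lebesgue_on {0..T}. weak_gradient L1 L2 (\<phi> tau) (G tau)
      \<and> integrable TT (\<lambda>x. (norm (G tau x))\<^sup>2)"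
    by eventually_elim (simp add: weak_gradient_\<phi> norm_G_square_integrable)
next
  fix t assume "t \<in> {0..T}"
  then have t: "0 \<le> t" by simp
  show "\<exists>I. has_L2_bochner_integral (lebesgue_on {0..t}) TT (\<lambda>tau. ks_semigroup L1 L2 (t - tau)
      (\<lambda>x. (norm (G tau x))\<^sup>2)) I \<and>
      (AE x in TT. \<phi> t x = ks_semigroup L1 L2 t f x - 1 / 2 * I x)"
    using duhamel_bochner[OF t] mild_equation[OF t]
    by (intro exI[of _ "\<lambda>x. Re (fseries (\<lambda>k. duhamel k (\<lambda>tau. nonlin tau k) t) x)"]) auto
qed

end

section \<open>Choice of the threshold\<close>

context ks_torus
begin

lemma mean_free_coeff:
  assumes f: "square_integrable TT f"
  shows "square_integrable TT (mean_free L1 L2 f)"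
    "fourier_coeff L1 L2 (mean_free L1 L2 f) k = (if k = 0 then 0 else fourier_coeff L1 L2 f k)"
proof -
  define m where "m = 1 / (L1 * L2) * (LINT y|TT. f y)"
  have mf: "mean_free L1 L2 f = (\<lambda>x. f x - m)" by (simp add: mean_free_def m_def)
  have c: "L2_fun (\<lambda>x. complex_of_real m)" by (rule L2_fun_bounded[of _ "\<bar>m\<bar>"]) auto
  show "square_integrable TT (mean_free L1 L2 f)"
    using L2_fun_diff[OF f[unfolded L2_fun_of_real] c] by (simp add: mf L2_fun_of_real)
  have "fourier_coeff L1 L2 (\<lambda>x. m) k = (if k = 0 then of_real m else 0)"
    using L1_pos L2_pos by (simp add: fourier_coeff_eq cnj_mode integral_mode)
  moreover have "fourier_coeff L1 L2 f 0 = of_real m"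
    by (simp add: fourier_coeff_eq m_def)
  ultimately show "fourier_coeff L1 L2 (mean_free L1 L2 f) k = (if k
      = 0 then 0 else fourier_coeff L1 L2 f k)"
    unfolding mf by (subst fourier_coeff_diff[OF square_integrable_imp_integrable[OF f]]) auto
qed

text \<open>
  The radius \<open>eps\<close> is chosen from the lattice sum alone. The envelope has a part of order \<open>eps\<close>,
  whose square sum is of order \<open>eps\<^sup>2\<close>, and a part proportional to the oscillating coefficients of
  the data, whose square sum is controlled by \<open>\<delta>\<close>.
\<close>

lemma small_data_parameters:
  obtains eps \<delta> where "0 < \<delta>"
    "\<And>f. square_integrable TT f \<Longrightarrow> L2norm TT (mean_free L1 L2 f) < \<delta> \<Longrightarrow>
       ks_small_initial L1 L2 (fourier_coeff L1 L2 f) eps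
         (\<lambda>k. (if k = 0 then 0 else norm (fourier_coeff L1 L2 f k)) / root4 gap + eps *
             (decay_const * inverse (wn k) ^ 2)) f"
proof
  define S where "S = (\<Sum>\<^sub>\<infinity>k. (decay_const * inverse (wn k) ^ 2)\<^sup>2)"
  \<comment> \<open>The summand \<open>1\<close> only keeps the denominator away from \<open>0\<close>.\<close>
  define eps where "eps = 1 / (32 * (S + 1))"
  define \<delta> where "\<delta> = sqrt (L1 * L2 * (eps * sqrt gap / 2))"
  have Ss: "(\<lambda>k. (decay_const * inverse (wn k) ^ 2)\<^sup>2) summable_on UNIV"
    using summable_on_cmult_right[OF lattice_sum_4, of "decay_const\<^sup>2"]
    by (simp add: power_mult_distrib power_mult[symmetric])
  have S0: "0 \<le> S" unfolding S_def by (rule infsum_nonneg) simp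
  then have eps: "0 < eps" "32 * eps * S \<le> 1" by (auto simp: eps_def field_simps)
  have q: "0 < root4 gap" "root4 gap * root4 gap = sqrt gap" "0 < sqrt gap"
      using root4_simps gap_bounds by auto
  have A: "0 < L1 * L2" using L1_pos L2_pos by simp
  show "0 < \<delta>" unfolding \<delta>_def using A eps q by simp
  fix f assume f: "square_integrable TT f" and small: "L2norm TT (mean_free L1 L2 f) < \<delta>"
  let ?a = "fourier_coeff L1 L2 f"
  let ?osc = "\<lambda>k. if k = 0 then 0 else norm (?a k)"
  let ?env = "\<lambda>k. ?osc k / root4 gap + eps * (decay_const * inverse (wn k) ^ 2)"
  have eq: "(norm (fourier_coeff L1 L2 (mean_free L1 L2 f) k))\<^sup>2 = (?osc k)\<^sup>2" for k
    by (simp add: mean_free_coeff(2)[OF f])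
  note P = parseval[OF mean_free_coeff(1)[OF f], unfolded eq]
  have "L1 * L2 * (\<Sum>\<^sub>\<infinity>k. (?osc k)\<^sup>2) < L1 * L2 * (eps * sqrt gap / 2)"
    using small unfolding L2norm_def \<delta>_def real_sqrt_less_iff P(2) .
  then have a0: "(\<Sum>\<^sub>\<infinity>k. (?osc k)\<^sup>2) < eps * sqrt gap / 2"
    using A by (simp only: mult_less_cancel_left_pos)
  have le: "(?env k)\<^sup>2 \<le> 2 / sqrt gap * (?osc k)\<^sup>2 + 2 * eps\<^sup>2 * (decay_const * inverse (wn k) ^
      2)\<^sup>2" for k
  proof -
    have "(?env k)\<^sup>2 \<le> 2 * (?osc k / root4 gap)\<^sup>2 + 2 * (eps * (decay_const * inverse (wn k) ^
        2))\<^sup>2"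
      using norm_add_square_le[of "?osc k / root4 gap" "eps * (decay_const * inverse (wn k) ^ 2)"]
      by (simp only: real_norm_def power2_abs)
    also have "(?osc k / root4 gap)\<^sup>2 = (?osc k)\<^sup>2 / sqrt gap"
      unfolding power_divide power2_eq_square[of "root4 gap"] q(2) ..
    finally show ?thesis by (simp add: power_mult_distrib)
  qed
  have s: "(\<lambda>k. 2 / sqrt gap * (?osc k)\<^sup>2 + 2 * eps\<^sup>2 * (decay_const * inverse (wn k) ^ 2)\<^sup>2)
      summable_on UNIV"
    by (intro summable_on_add summable_on_cmult_right P(1) Ss)
  have es: "(\<lambda>k. (?env k)\<^sup>2) summable_on UNIV"
    by (rule summable_on_comparison_test[OF s le]) simp
  have "(\<Sum>\<^sub>\<infinity>k. (?env k)\<^sup>2) \<le> (\<Sum>\<^sub>\<infinity>k. 2 / sqrt gap * (?osc k)\<^sup>2 + 2 * eps\<^sup>2 * (decay_const * inverse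
      (wn k) ^ 2)\<^sup>2)"
    by (rule infsum_mono[OF es s le])
  also have "\<dots> = 2 / sqrt gap * (\<Sum>\<^sub>\<infinity>k. (?osc k)\<^sup>2) + 2 * eps\<^sup>2 * S"
    unfolding S_def
    by (subst infsum_add[OF summable_on_cmult_right[OF P(1)] summable_on_cmult_right[OF Ss]])
        (simp only: infsum_cmult_right')
  also have "\<dots> \<le> eps + eps"
  proof (rule add_mono)
    have "2 / sqrt gap * (\<Sum>\<^sub>\<infinity>k. (?osc k)\<^sup>2) \<le> 2 / sqrt gap * (eps * sqrt gap / 2)"
      using a0 q by (intro mult_left_mono less_imp_le) auto
    also have "\<dots> = eps" using q by simp
    finally show "2 / sqrt gap * (\<Sum>\<^sub>\<infinity>k. (?osc k)\<^sup>2) \<le> eps" .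
    have "2 * eps * S \<le> 1" using eps S0 mult_nonneg_nonneg[of eps S] by linarith
    then have "eps * (2 * eps * S) \<le> eps * 1" using eps by (intro mult_left_mono) auto
    then show "2 * eps\<^sup>2 * S \<le> eps" by (simp add: power2_eq_square mult_ac)
  qed
  finally have sum: "(\<Sum>\<^sub>\<infinity>k. (?env k)\<^sup>2) \<le> 2 * eps" by simp
  show "ks_small_initial L1 L2 ?a eps ?env f"
    by unfold_locales (use eps es sum f in \<open>simp_all only: S_def\<close>)
qed

end

theorem corollary3p2:
  fixes L1 L2 :: real
  assumes "0 < L1" "L1 < 2 * pi" "0 < L2" "L2 < 2 * pi"
  shows "\<exists>\<delta>>0. \<forall>\<phi>0 :: real \<times> real \<Rightarrow> real.
           square_integrable (torus L1 L2) \<phi>0 \<and>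
           L2norm (torus L1 L2) (mean_free L1 L2 \<phi>0) < \<delta> \<longrightarrow>
           (\<forall>T>0. \<exists>\<phi>. mild_solution L1 L2 T \<phi>0 \<phi>)"
proof -
  interpret ks_torus L1 L2 by unfold_locales (use assms in auto)
  obtain eps \<delta> where \<delta>: "0 < \<delta>" and small: "\<And>f. square_integrable TT f \<Longrightarrow> L2norm TT (mean_free L1
      L2 f) < \<delta> \<Longrightarrow>
       ks_small_initial L1 L2 (fourier_coeff L1 L2 f) eps
         (\<lambda>k. (if k = 0 then 0 else norm (fourier_coeff L1 L2 f k)) / root4 gap + eps *
             (decay_const * inverse (wn k) ^ 2)) f"
    using small_data_parameters by blast
  show ?thesis
    using \<delta> ks_small_initial.mild_solution_\<phi>[OF small] by blast
qed

end
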